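(* Let $k$ be an algebraically closed field of arbitrary characteristic, let $n$ be a positive integer, and let $T$ be an affine algebraic torus in the Cremona group $\mathcal{C}_n=\mathrm{Aut}_k\,k(\mathbf{A}^n)$. The following properties are equivalent: (i) $T$ is rationally triangulable; (ii) $T$ is linearizable, i.e., conjugate in $\mathcal{C}_n$ to a subgroup of $\mathrm{GL}_n$; (iii) $T$ is conjugate in $\mathcal{C}_n$ to the diagonal torus of $\mathrm{GL}_d$, where $d=\dim T$.
   Context: All fields contain $k$ and all field embeddings are the identity on $k$. The Cremona group of rank $n$ over $k$ is $\mathcal{C}_n:=\mathrm{Aut}_k\,k(\mathbf{A}^n)$, where $k(\mathbf{A}^n)=k(x_1,\ldots,x_n)$ and $x_i$ are the standard coordinate functions; it is identified with the group $\mathrm{Bir}\,\mathbf{A}^n$ of birational self-maps of $\mathbf{A}^n$ via $\varphi\mapsto(\varphi^* )^{-1}$. For $d\leqslant n$, $\mathcal{C}_d$ is regarded as a subgroup of $\mathcal{C}_n$ by letting $\varphi\in\mathcal{C}_d$ act on $x_1,\ldots,x_d$ as before and fix $x_{d+1},\ldots,x_n$. The group $\mathrm{GL}_d$ is regarded as the subgroup of $\mathcal{C}_d\subset\mathcal{C}_n$ given by its linear action on $\mathbf{A}^d$; thus the diagonal torus of $\mathrm{GL}_d$ consists of the automorphisms $x_i\mapsto t_ix_i$ for $i\leqslant d$, $x_i\mapsto x_i$ for $d<i\leqslant n$, with $t_i\in k^\times$. A rational action of an algebraic group $H$ on an irreducible variety $X$ is a homomorphism $\alpha\colon H\to\mathrm{Bir}\,X$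 such that the partially defined map $H\times X\dashrightarrow X$, $(h,x)\mapsto\alpha(h)(x)$, is defined on a dense open subset of $H\times X$ and coincides there with a rational map. An algebraic subgroup of $\mathcal{C}_n$ is a subgroup $G$ endowed with a structure of an algebraic group such that the inclusion $G\hookrightarrow\mathcal{C}_n=\mathrm{Bir}\,\mathbf{A}^n$ is a rational action of $G$ on $\mathbf{A}^n$. An affine algebraic torus in $\mathcal{C}_n$ is an algebraic subgroup of $\mathcal{C}_n$ that is isomorphic, as an algebraic group, to a product of copies of the multiplicative group $k^\times$. A field $K$ is a $1$-extension of a subfield $L$ if $K$ is purely transcendental over $L$ of transcendence degree $1$. A subgroup $G$ of $\mathcal{C}_n$ is rationally triangulable if there is a flag $k(\mathbf{A}^n)=:K_n\supset K_{n-1}\supset\cdots\supset K_1\supset K_0:=k$ of $G$-stable subfields of $k(\mathbf{A}^n)$ such that $K_i$ is a $1$-extension of $K_{i-1}$ for every $i>0$. *)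

theory Defs
  imports
    "HOL-Analysis.Abstract_Topology"
    "HOL-Algebra.Bij"
    "HOL-Algebra.Product_Groups"
    "HOL-Computational_Algebra.Fraction_Field"
    "HOL-Computational_Algebra.Polynomial"
    "HOL-Library.Poly_Mapping"
begin

section \<open>Rational functions and the Cremona group\<close>

text \<open>
  All rational function fields live inside the field of rational functions in countably many
  variables; the coordinates \<open>x\<^sub>1, \<dots>, x\<^sub>n\<close> are \<open>var 0, \<dots>, var (n - 1)\<close>.
  The index type \<open>nat\<close> makes \<open>'k mpoly\<close> an integral domain.
\<close>

type_synonym 'k mpoly = "(nat \<Rightarrow>\<^sub>0 nat) \<Rightarrow>\<^sub>0 'k"

type_synonym 'k ratfun = "'k mpoly fract"

definition polys :: "nat \<Rightarrow> 'k::field mpoly set" where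
  "polys n = {P. \<forall>m \<in> Poly_Mapping.keys P. Poly_Mapping.keys m \<subseteq> {..<n}}"

definition eval_mpoly :: "'k::field mpoly \<Rightarrow> (nat \<Rightarrow> 'k) \<Rightarrow> 'k" where
  "eval_mpoly P x = (\<Sum>m \<in> Poly_Mapping.keys P. Poly_Mapping.lookup P m *
     (\<Prod>i \<in> Poly_Mapping.keys m. x i ^ Poly_Mapping.lookup m i))"

definition const :: "'k::field \<Rightarrow> 'k ratfun" where
  "const c = Fract (Poly_Mapping.single 0 c) 1"

definition var :: "nat \<Rightarrow> 'k::field ratfun" where
  "var i = Fract (Poly_Mapping.single (Poly_Mapping.single i 1) 1) 1"

definition ratfuns :: "nat \<Rightarrow> 'k::field ratfun set" where
  "ratfuns n = {Fract P Q | P Q. P \<in> polys n \<and> Q \<in> polys n \<and> Q \<noteq> 0}"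

definition cremona :: "nat \<Rightarrow> ('k::field ratfun \<Rightarrow> 'k ratfun) monoid" where
  "cremona n = BijGroup (ratfuns n)
     \<lparr>carrier := {s \<in> Bij (ratfuns n).
        (\<forall>f \<in> ratfuns n. \<forall>g \<in> ratfuns n. s (f + g) = s f + s g \<and> s (f * g) = s f * s g) \<and>
        (\<forall>c. s (const c) = const c)}\<rparr>"

definition conjugate_in_cremona ::
    "nat \<Rightarrow> ('k::field ratfun \<Rightarrow> 'k ratfun) set \<Rightarrow> ('k ratfun \<Rightarrow> 'k ratfun) set \<Rightarrow> bool" where
  "conjugate_in_cremona n G H \<longleftrightarrow>
     (\<exists>s \<in> carrier (cremona n).
        H = (\<lambda>g. s \<otimes>\<^bsub>cremona n\<^esub> g \<otimes>\<^bsub>cremona n\<^esub> inv\<^bsub>cremona n\<^esub> s) ` G)"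

text \<open>
  \<open>has_value n f x v\<close>: the rational function \<open>f\<close> on affine \<open>n\<close>-space is defined at the
  point \<open>x\<close> and takes the value \<open>v\<close> there.
\<close>

definition has_value :: "nat \<Rightarrow> 'k::field ratfun \<Rightarrow> (nat \<Rightarrow> 'k) \<Rightarrow> 'k \<Rightarrow> bool" where
  "has_value n f x v \<longleftrightarrow>
     (\<exists>P \<in> polys n. \<exists>Q \<in> polys n. f = Fract P Q \<and> eval_mpoly Q x \<noteq> 0 \<and>
        v = eval_mpoly P x / eval_mpoly Q x)"

definition affine_space :: "nat \<Rightarrow> (nat \<Rightarrow> 'k::field) set" where
  "affine_space n = {..<n} \<rightarrow>\<^sub>E UNIV"

text \<open>
  An element \<open>s\<close> of the Cremona group is identified with the birational map \<open>\<phi>\<close> such that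
  \<open>s\<close> is the inverse of \<open>\<phi>\<^sup>*\<close>; hence the \<open>i\<close>-th component of \<open>\<phi>\<close> is the rational
  function \<open>\<phi>\<^sup>* x\<^sub>i\<close>, the image of \<open>x\<^sub>i\<close> under the inverse of \<open>s\<close>.
  \<open>maps_point n s x y\<close> says that \<open>\<phi>\<close> is defined at \<open>x\<close> and sends it to \<open>y\<close>.
\<close>

definition maps_point ::
    "nat \<Rightarrow> ('k::field ratfun \<Rightarrow> 'k ratfun) \<Rightarrow> (nat \<Rightarrow> 'k) \<Rightarrow> (nat \<Rightarrow> 'k) \<Rightarrow> bool" where
  "maps_point n s x y \<longleftrightarrow>
     x \<in> affine_space n \<and> y \<in> affine_space n \<and>
     (\<forall>i<n. has_value n ((inv\<^bsub>cremona n\<^esub> s) (var i)) x (y i))"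


section \<open>Affine varieties and algebraic groups\<close>

text \<open>
  Over an algebraically closed field, an affine variety is given by a set of points \<open>X\<close>
  together with its algebra \<open>A\<close> of regular functions, a finitely generated algebra of
  functions such that \<open>X\<close> corresponds bijectively to the algebra homomorphisms from \<open>A\<close>
  to the ground field. Functions on \<open>X\<close> are extensional (undefined outside \<open>X\<close>).
\<close>

definition function_algebra :: "'a set \<Rightarrow> ('a \<Rightarrow> 'k::field) set \<Rightarrow> bool" where
  "function_algebra X A \<longleftrightarrow>
     A \<subseteq> X \<rightarrow>\<^sub>E UNIV \<and>
     (\<forall>c. (\<lambda>x\<in>X. c) \<in> A) \<and>
     (\<forall>f\<in>A. \<forall>g\<in>A. (\<lambda>x\<in>X. f x + g x) \<in> A \<and> (\<lambda>x\<in>X. f x * g x) \<in> A)"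

definition generated_algebra :: "'a set \<Rightarrow> ('a \<Rightarrow> 'k::field) set \<Rightarrow> ('a \<Rightarrow> 'k) set" where
  "generated_algebra X S = \<Inter>{A. function_algebra X A \<and> S \<subseteq> A}"

definition algebra_character ::
    "'a set \<Rightarrow> ('a \<Rightarrow> 'k::field) set \<Rightarrow> (('a \<Rightarrow> 'k) \<Rightarrow> 'k) \<Rightarrow> bool" where
  "algebra_character X A \<chi> \<longleftrightarrow>
     (\<forall>c. \<chi> (\<lambda>x\<in>X. c) = c) \<and>
     (\<forall>f\<in>A. \<forall>g\<in>A. \<chi> (\<lambda>x\<in>X. f x + g x) = \<chi> f + \<chi> g \<and> \<chi> (\<lambda>x\<in>X. f x * g x) = \<chi> f * \<chi> g)"

definition affine_variety :: "'a set \<Rightarrow> ('a \<Rightarrow> 'k::field) set \<Rightarrow> bool" where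
  "affine_variety X A \<longleftrightarrow>
     function_algebra X A \<and>
     (\<exists>S. finite S \<and> S \<subseteq> A \<and> A = generated_algebra X S) \<and>
     (\<forall>x\<in>X. \<forall>y\<in>X. (\<forall>f\<in>A. f x = f y) \<longrightarrow> x = y) \<and>
     (\<forall>\<chi>. algebra_character X A \<chi> \<longrightarrow> (\<exists>x\<in>X. \<forall>f\<in>A. \<chi> f = f x))"

definition regular_map ::
    "'a set \<Rightarrow> ('a \<Rightarrow> 'k::field) set \<Rightarrow> 'b set \<Rightarrow> ('b \<Rightarrow> 'k) set \<Rightarrow> ('a \<Rightarrow> 'b) \<Rightarrow> bool" where
  "regular_map X A Y B \<phi> \<longleftrightarrow> \<phi> \<in> X \<rightarrow> Y \<and> (\<forall>f\<in>B. (\<lambda>x\<in>X. f (\<phi> x)) \<in> A)"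

definition product_functions ::
    "'a set \<Rightarrow> ('a \<Rightarrow> 'k::field) set \<Rightarrow> 'b set \<Rightarrow> ('b \<Rightarrow> 'k) set \<Rightarrow> ('a \<times> 'b \<Rightarrow> 'k) set" where
  "product_functions X A Y B =
     generated_algebra (X \<times> Y)
       ((\<lambda>f. \<lambda>p\<in>X \<times> Y. f (fst p)) ` A \<union> (\<lambda>g. \<lambda>p\<in>X \<times> Y. g (snd p)) ` B)"

definition zariski :: "'a set \<Rightarrow> ('a \<Rightarrow> 'k::field) set \<Rightarrow> 'a topology" where
  "zariski X A = topology_generated_by ((\<lambda>f. {x \<in> X. f x \<noteq> 0}) ` A)"

definition dense_open :: "'a topology \<Rightarrow> 'a set \<Rightarrow> bool" where
  "dense_open Z U \<longleftrightarrow> openin Z U \<and> Z closure_of U = topspace Z"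

definition affine_functions :: "nat \<Rightarrow> ((nat \<Rightarrow> 'k::field) \<Rightarrow> 'k) set" where
  "affine_functions n =
     generated_algebra (affine_space n) ((\<lambda>i. \<lambda>x\<in>affine_space n. x i) ` {..<n})"

definition algebraic_group ::
    "('g, 'm) monoid_scheme \<Rightarrow> ('g \<Rightarrow> 'k::field) set \<Rightarrow> bool" where
  "algebraic_group G A \<longleftrightarrow>
     group G \<and>
     affine_variety (carrier G) A \<and>
     regular_map (carrier G \<times> carrier G) (product_functions (carrier G) A (carrier G) A)
       (carrier G) A (\<lambda>(g, h). g \<otimes>\<^bsub>G\<^esub> h) \<and>
     regular_map (carrier G) A (carrier G) A (\<lambda>g. inv\<^bsub>G\<^esub> g)"

definition algebraic_group_iso ::
    "('g, 'm) monoid_scheme \<Rightarrow> ('g \<Rightarrow> 'k::field) set \<Rightarrow>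
     ('h, 'l) monoid_scheme \<Rightarrow> ('h \<Rightarrow> 'k) set \<Rightarrow> ('g \<Rightarrow> 'h) \<Rightarrow> bool" where
  "algebraic_group_iso G A H B \<phi> \<longleftrightarrow>
     \<phi> \<in> iso G H \<and>
     regular_map (carrier G) A (carrier H) B \<phi> \<and>
     regular_map (carrier H) B (carrier G) A (inv_into (carrier G) \<phi>)"

definition Gm :: "'k::field monoid" where
  "Gm = \<lparr>carrier = {c. c \<noteq> 0}, monoid.mult = (*), one = 1\<rparr>"

definition torus :: "nat \<Rightarrow> (nat \<Rightarrow> 'k::field) monoid" where
  "torus d = product_group {..<d} (\<lambda>_. Gm)"

definition torus_functions :: "nat \<Rightarrow> ((nat \<Rightarrow> 'k::field) \<Rightarrow> 'k) set" where
  "torus_functions d =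
     generated_algebra (carrier (torus d))
       ((\<lambda>i. \<lambda>t\<in>carrier (torus d). t i) ` {..<d} \<union>
        (\<lambda>i. \<lambda>t\<in>carrier (torus d). inverse (t i)) ` {..<d})"


section \<open>Algebraic subgroups of the Cremona group\<close>

text \<open>
  A rational map to affine \<open>n\<close>-space on an affine variety is given, on some dense open subset,
  by \<open>n\<close> quotients of regular functions.
\<close>

definition rational_action ::
    "('g, 'm) monoid_scheme \<Rightarrow> ('g \<Rightarrow> 'k::field) set \<Rightarrow> nat \<Rightarrow>
     ('g \<Rightarrow> 'k ratfun \<Rightarrow> 'k ratfun) \<Rightarrow> bool" where
  "rational_action G A n \<alpha> \<longleftrightarrow>
     \<alpha> \<in> hom G (cremona n) \<and>
     (let X = carrier G \<times> affine_space n;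
          R = product_functions (carrier G) A (affine_space n) (affine_functions n)
      in \<exists>U p q. dense_open (zariski X R) U \<and>
           (\<forall>i<n. p i \<in> R \<and> q i \<in> R) \<and>
           (\<forall>(g, x) \<in> U. \<exists>y. maps_point n (\<alpha> g) x y \<and>
              (\<forall>i<n. q i (g, x) \<noteq> 0 \<and> y i = p i (g, x) / q i (g, x))))"

definition algebraic_subgroup ::
    "nat \<Rightarrow> ('k::field ratfun \<Rightarrow> 'k ratfun) set \<Rightarrow> (('k ratfun \<Rightarrow> 'k ratfun) \<Rightarrow> 'k) set \<Rightarrow> bool"
where
  "algebraic_subgroup n G A \<longleftrightarrow>
     subgroup G (cremona n) \<and>
     algebraic_group (cremona n\<lparr>carrier := G\<rparr>) A \<and>
     rational_action (cremona n\<lparr>carrier := G\<rparr>) A n (\<lambda>g. g)"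

text \<open>
  The dimension of a torus is the number \<open>d\<close> of factors in the product of copies of the
  multiplicative group to which it is isomorphic.
\<close>

definition torus_subgroup ::
    "nat \<Rightarrow> nat \<Rightarrow> ('k::field ratfun \<Rightarrow> 'k ratfun) set \<Rightarrow> (('k ratfun \<Rightarrow> 'k ratfun) \<Rightarrow> 'k) set \<Rightarrow> bool"
where
  "torus_subgroup n d T A \<longleftrightarrow>
     algebraic_subgroup n T A \<and>
     (\<exists>\<phi>. algebraic_group_iso (cremona n\<lparr>carrier := T\<rparr>) A (torus d) (torus_functions d) \<phi>)"


section \<open>Rational triangulability and linearizability\<close>

definition is_subfield :: "'a::field set \<Rightarrow> bool" where
  "is_subfield L \<longleftrightarrow>
     0 \<in> L \<and> 1 \<in> L \<and> (\<forall>a\<in>L. \<forall>b\<in>L. a + b \<in> L \<and> a * b \<in> L) \<and>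
     (\<forall>a\<in>L. - a \<in> L \<and> inverse a \<in> L)"

definition transcendental_over :: "'a::field set \<Rightarrow> 'a \<Rightarrow> bool" where
  "transcendental_over L z \<longleftrightarrow> (\<forall>p. (\<forall>i. coeff p i \<in> L) \<and> poly p z = 0 \<longrightarrow> p = 0)"

definition one_extension :: "'a::field set \<Rightarrow> 'a set \<Rightarrow> bool" where
  "one_extension K L \<longleftrightarrow>
     is_subfield K \<and> is_subfield L \<and> L \<subseteq> K \<and>
     (\<exists>z\<in>K. transcendental_over L z \<and> K = \<Inter>{M. is_subfield M \<and> insert z L \<subseteq> M})"

definition rationally_triangulable :: "nat \<Rightarrow> ('k::field ratfun \<Rightarrow> 'k ratfun) set \<Rightarrow> bool" where
  "rationally_triangulable n G \<longleftrightarrow>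
     (\<exists>K. K n = ratfuns n \<and> K 0 = range const \<and>
        (\<forall>i\<le>n. is_subfield (K i) \<and> (\<forall>g\<in>G. g ` K i \<subseteq> K i)) \<and>
        (\<forall>i<n. one_extension (K (Suc i)) (K i)))"

text \<open>
  The matrix \<open>M\<close> (with inverse \<open>N\<close>) describes the action on affine \<open>d\<close>-space of the
  birational map identified with \<open>s\<close>.
\<close>

definition GL_subgroup :: "nat \<Rightarrow> nat \<Rightarrow> ('k::field ratfun \<Rightarrow> 'k ratfun) set" where
  "GL_subgroup n d =
     {s \<in> carrier (cremona n). \<exists>M N :: nat \<Rightarrow> nat \<Rightarrow> 'k.
        (\<forall>i<d. \<forall>j<d. (\<Sum>l<d. M i l * N l j) = (if i = j then 1 else 0) \<and>
                     (\<Sum>l<d. N i l * M l j) = (if i = j then 1 else 0)) \<and>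
        (\<forall>i<n. (inv\<^bsub>cremona n\<^esub> s) (var i) =
           (if i < d then (\<Sum>j<d. const (M i j) * var j) else var i))}"

definition linearizable :: "nat \<Rightarrow> ('k::field ratfun \<Rightarrow> 'k ratfun) set \<Rightarrow> bool" where
  "linearizable n G \<longleftrightarrow>
     (\<exists>H. subgroup H (cremona n) \<and> H \<subseteq> GL_subgroup n n \<and> conjugate_in_cremona n G H)"

definition diagonal_torus :: "nat \<Rightarrow> nat \<Rightarrow> ('k::field ratfun \<Rightarrow> 'k ratfun) set" where
  "diagonal_torus n d =
     {s \<in> carrier (cremona n). \<exists>t :: nat \<Rightarrow> 'k.
        (\<forall>i<d. t i \<noteq> 0) \<and>
        (\<forall>i<n. s (var i) = (if i < d then const (t i) * var i else var i))}"

end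

theory Submission
  imports Defs
begin

text \<open>
  A diagonal torus acts linearly, so one implication is immediate. A linearized torus acts by
  commuting linear maps on the span of \<open>n\<close> free generators of \<open>k(x\<^sub>1, \<dots>, x\<^sub>n)\<close>; over an algebraically
  closed field such maps have a common stable full flag of subspaces, and the subfields generated by
  the members of the flag triangulate the torus (\<open>commuting_linear_imp_triangulable\<close>). The substance
  is that a triangulable torus is conjugate to a diagonal one (\<open>triangulable_imp_diagonalizable\<close>).

  Consider one step \<open>L \<subset> K = L(z)\<close> of a stable tower and a one-parameter subgroup \<open>\<sigma>\<close> of the torus.
  Every automorphism of \<open>K\<close> that maps \<open>L\<close> onto itself sends \<open>z\<close> to a fraction \<open>(a z + b) / (c z + d)\<close>
  over \<open>L\<close> (\<open>generator_is_moebius\<close>). As the action is rational, the fractions for \<open>\<sigma> s\<close> can be written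
  with coefficients \<open>a, b, c, d\<close> that are polynomials in \<open>s\<close> over \<open>L\<close> (\<open>rel_exists\<close>), and if the degree
  of \<open>c, d\<close> is chosen as small as possible, these polynomials are unique up to a common factor from
  \<open>L\<close> (\<open>rel_unique\<close>). An element of the torus commutes with \<open>\<sigma>\<close>, so it turns this minimal expression
  into another minimal one (\<open>rel_transform\<close>). By uniqueness it multiplies all coefficients of
  \<open>a z + b\<close> and of \<open>c z + d\<close>, as polynomials in \<open>s\<close>, by one common element of \<open>K\<close>, up to scalars.
  The quotients of these coefficients by the top coefficient of \<open>c z + d\<close> are therefore
  semi-invariants of the torus. They are fractions of degree at most one in \<open>z\<close>, and they do not all
  lie in \<open>L\<close>, because otherwise \<open>\<sigma> s z\<close> would; one that lies outside \<open>L\<close> generates \<open>K\<close> over \<open>L\<close>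
  (\<open>semi_invariant_generator\<close>). Applied to the coordinate subgroups of the torus one after the other
  and to all steps of the tower, this yields free generators of \<open>k(x\<^sub>1, \<dots>, x\<^sub>n)\<close> on which the torus
  acts through characters (\<open>semi_invariant_free_generators\<close>).

  The exponents of these characters form an integer matrix with \<open>n\<close> rows and \<open>d\<close> columns.
  Multiplying a generator by a power of another one is a row operation, so the Euclidean algorithm
  makes the matrix upper triangular. Faithfulness of the action supplies a pivot in every column, so
  \<open>d \<le> n\<close>, and the rows below the first \<open>d\<close> vanish (\<open>semi_invariant_triangular\<close>). Since every
  non-trivial power map of \<open>k\<^sup>\<times>\<close> is onto, the first \<open>d\<close> characters map the torus onto \<open>(k\<^sup>\<times>)\<^sup>d\<close>
  (\<open>triangular_monomial_system\<close>). Hence the automorphism that takes the new generators to the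
  coordinates conjugates the torus onto the diagonal one.

  Algebraic geometry enters only through the claim that \<open>s \<mapsto> \<sigma> s f\<close> is a quotient of polynomials in
  \<open>s\<close>. It holds because a dense open set on which the action is given by regular functions meets some
  translate of \<open>\<sigma>\<close>, and on such a translate regular functions are Laurent polynomials in \<open>s\<close>
  (\<open>torus_subgroup_parametrization\<close>).
\<close>

section \<open>Subfields, adjunction and transcendental elements\<close>

definition polys_over :: "'a::field set \<Rightarrow> 'a poly set" where
  "polys_over L = {p. \<forall>i. coeff p i \<in> L}"

definition adjoin :: "'a::field set \<Rightarrow> 'a set \<Rightarrow> 'a set" where
  "adjoin L S = \<Inter>{M. is_subfield M \<and> S \<union> L \<subseteq> M}"

lemma subfield_closed:
  assumes "is_subfield L"
  shows subfield_0: "0 \<in> L" and subfield_1: "1 \<in> L"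
    and subfield_add: "\<And>a b. a \<in> L \<Longrightarrow> b \<in> L \<Longrightarrow> a + b \<in> L"
    and subfield_mult: "\<And>a b. a \<in> L \<Longrightarrow> b \<in> L \<Longrightarrow> a * b \<in> L"
    and subfield_minus: "\<And>a. a \<in> L \<Longrightarrow> - a \<in> L"
    and subfield_inverse: "\<And>a. a \<in> L \<Longrightarrow> inverse a \<in> L"
  using assms by (auto simp: is_subfield_def)

lemma subfield_diff:
  assumes "is_subfield L" "a \<in> L" "b \<in> L" shows "a - b \<in> L"
  using subfield_add[OF assms(1,2) subfield_minus[OF assms(1,3)]] by simp

lemma subfield_divide:
  assumes "is_subfield L" "a \<in> L" "b \<in> L" shows "a / b \<in> L"
  using subfield_mult[OF assms(1,2) subfield_inverse[OF assms(1,3)]] by (simp add: field_simps)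

lemma subfield_power:
  assumes "is_subfield L" "a \<in> L" shows "a ^ n \<in> L"
  by (induction n) (auto intro: subfield_closed[OF assms(1)] assms)

lemma subfield_power_int:
  assumes "is_subfield L" "a \<in> L" shows "a powi m \<in> L"
  using assms by (auto simp: power_int_def intro: subfield_closed subfield_power)

lemma subfield_sum:
  assumes "is_subfield L" "\<And>i. i \<in> S \<Longrightarrow> f i \<in> L" shows "sum f S \<in> L"
  using assms(2) by (induction S rule: infinite_finite_induct) (auto intro: subfield_closed[OF assms(1)])

lemma subfield_prod:
  assumes "is_subfield L" "\<And>i. i \<in> S \<Longrightarrow> f i \<in> L" shows "prod f S \<in> L"
  using assms(2) by (induction S rule: infinite_finite_induct) (auto intro: subfield_closed[OF assms(1)])

lemmas subfield_intros =
  subfield_closed subfield_diff subfield_divide subfield_power subfield_power_int subfield_sum subfield_prod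

lemma is_subfieldI:
  assumes "0 \<in> L" "1 \<in> L" "\<And>a b. a \<in> L \<Longrightarrow> b \<in> L \<Longrightarrow> a + b \<in> L"
    "\<And>a b. a \<in> L \<Longrightarrow> b \<in> L \<Longrightarrow> a * b \<in> L" "\<And>a. a \<in> L \<Longrightarrow> - a \<in> L"
    "\<And>a. a \<in> L \<Longrightarrow> a \<noteq> 0 \<Longrightarrow> inverse a \<in> L"
  shows "is_subfield L"
  using assms unfolding is_subfield_def by (metis inverse_zero)

lemma subfield_adjoin: "is_subfield (adjoin L S)"
  by (auto simp: adjoin_def is_subfield_def)

lemma adjoin_superset: "S \<union> L \<subseteq> adjoin L S"
  by (auto simp: adjoin_def)

lemma adjoin_least: "is_subfield M \<Longrightarrow> S \<subseteq> M \<Longrightarrow> L \<subseteq> M \<Longrightarrow> adjoin L S \<subseteq> M"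
  by (auto simp: adjoin_def)

lemma adjoin_mono: "S \<subseteq> S' \<Longrightarrow> adjoin L S \<subseteq> adjoin L S'"
  using adjoin_superset[of S' L] by (intro adjoin_least subfield_adjoin) auto

lemma polys_over_pCons [simp]:
  "pCons a p \<in> polys_over L \<longleftrightarrow> a \<in> L \<and> p \<in> polys_over L"
  by (auto simp: polys_over_def coeff_pCons split: nat.splits)

lemma polys_over_intros:
  assumes L: "is_subfield L"
  shows polys_over_0: "0 \<in> polys_over L" and polys_over_1: "1 \<in> polys_over L"
    and polys_over_add: "\<And>p q. p \<in> polys_over L \<Longrightarrow> q \<in> polys_over L \<Longrightarrow> p + q \<in> polys_over L"
    and polys_over_minus: "\<And>p. p \<in> polys_over L \<Longrightarrow> - p \<in> polys_over L"
    and polys_over_diff: "\<And>p q. p \<in> polys_over L \<Longrightarrow> q \<in> polys_over L \<Longrightarrow> p - q \<in> polys_over L"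
    and polys_over_smult: "\<And>a p. a \<in> L \<Longrightarrow> p \<in> polys_over L \<Longrightarrow> smult a p \<in> polys_over L"
    and polys_over_monom: "\<And>a m. a \<in> L \<Longrightarrow> monom a m \<in> polys_over L"
    and polys_over_mult: "\<And>p q. p \<in> polys_over L \<Longrightarrow> q \<in> polys_over L \<Longrightarrow> p * q \<in> polys_over L"
  by (auto simp: polys_over_def coeff_mult coeff_pCons split: nat.splits
      intro: subfield_intros[OF L])

lemma polys_over_power:
  assumes "is_subfield L" "p \<in> polys_over L" shows "p ^ n \<in> polys_over L"
  by (induction n) (auto intro: polys_over_intros[OF assms(1)] assms)

lemma polys_over_sum:
  assumes "is_subfield L" "\<And>i. i \<in> S \<Longrightarrow> f i \<in> polys_over L" shows "sum f S \<in> polys_over L"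
  using assms(2)
  by (induction S rule: infinite_finite_induct) (auto intro: polys_over_intros[OF assms(1)])

lemma polys_over_mono: "L \<subseteq> K \<Longrightarrow> p \<in> polys_over L \<Longrightarrow> p \<in> polys_over K"
  by (auto simp: polys_over_def)

lemma poly_in_subfield:
  assumes "is_subfield L" "p \<in> polys_over L" "x \<in> L" shows "poly p x \<in> L"
  using assms by (auto simp: poly_altdef polys_over_def intro!: subfield_intros[OF assms(1)])

lemma polys_over_pcompose:
  assumes L: "is_subfield L" and "p \<in> polys_over L" "q \<in> polys_over L"
  shows "pcompose p q \<in> polys_over L"
  using assms(2) by (induction p) (auto simp: pcompose_pCons intro!: polys_over_intros[OF L] assms(3))

lemma transcendental_overD:
  assumes "transcendental_over L z" "p \<in> polys_over L" "poly p z = 0" shows "p = 0"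
  using assms by (auto simp: transcendental_over_def polys_over_def)

text \<open>
  The fractions form a subfield, since sums, products and inverses of fractions are fractions again.
  Every field containing \<open>L\<close> and \<open>z\<close> contains them.
\<close>

lemma adjoin_single:
  assumes L: "is_subfield L"
  shows "adjoin L {z} =
    {poly p z / poly q z | p q. p \<in> polys_over L \<and> q \<in> polys_over L \<and> poly q z \<noteq> 0}" (is "_ = ?M")
proof
  have in_M: "poly p z / poly q z \<in> ?M"
    if "p \<in> polys_over L" "q \<in> polys_over L" "poly q z \<noteq> 0" for p q
    using that by blast
  have poly_M: "poly p z \<in> ?M" if "p \<in> polys_over L" for p
    using in_M[OF that polys_over_1[OF L]] by simp
  have "is_subfield ?M"
  proof (rule is_subfieldI)
    show "0 \<in> ?M" "1 \<in> ?M"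
      using poly_M[OF polys_over_0[OF L]] poly_M[OF polys_over_1[OF L]] by simp_all
  next
    fix a b assume "a \<in> ?M" "b \<in> ?M"
    then obtain p q r s where *: "p \<in> polys_over L" "q \<in> polys_over L" "poly q z \<noteq> 0"
      "r \<in> polys_over L" "s \<in> polys_over L" "poly s z \<noteq> 0"
      "a = poly p z / poly q z" "b = poly r z / poly s z"
      by blast
    have "a + b = poly (p * s + r * q) z / poly (q * s) z"
      using * by (simp add: add_frac_eq)
    also have "\<dots> \<in> ?M" using * by (intro in_M polys_over_intros[OF L]) simp_all
    finally show "a + b \<in> ?M" .
    have "a * b = poly (p * r) z / poly (q * s) z"
      using * by (simp add: times_divide_times_eq)
    also have "\<dots> \<in> ?M" using * by (intro in_M polys_over_intros[OF L]) simp_all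
    finally show "a * b \<in> ?M" .
  next
    fix a assume "a \<in> ?M"
    then obtain p q where *: "p \<in> polys_over L" "q \<in> polys_over L" "poly q z \<noteq> 0"
      "a = poly p z / poly q z" by blast
    have "- a = poly (- p) z / poly q z" using * by simp
    also have "\<dots> \<in> ?M" using * by (intro in_M polys_over_intros[OF L])
    finally show "- a \<in> ?M" .
    assume "a \<noteq> 0"
    then have "inverse a = poly q z / poly p z" "poly p z \<noteq> 0" using * by simp_all
    then show "inverse a \<in> ?M" using in_M[OF *(2,1)] by simp
  qed
  moreover have "z \<in> ?M"
    using poly_M[of "[:0, 1:]"] by (simp add: subfield_0[OF L] subfield_1[OF L] polys_over_0[OF L])
  moreover have "L \<subseteq> ?M"
    using poly_M[of "[:c:]" for c] by (auto simp: polys_over_0[OF L])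
  ultimately show "adjoin L {z} \<subseteq> ?M" by (intro adjoin_least) auto
next
  have *: "L \<subseteq> adjoin L {z}" "z \<in> adjoin L {z}" using adjoin_superset[of "{z}" L] by auto
  have "poly p z \<in> adjoin L {z}" if "p \<in> polys_over L" for p
    by (rule poly_in_subfield[OF subfield_adjoin polys_over_mono[OF *(1) that] *(2)])
  then show "?M \<subseteq> adjoin L {z}"
    by (auto intro!: subfield_divide subfield_adjoin)
qed

lemma one_extension_adjoin:
  "one_extension K L \<longleftrightarrow> is_subfield L \<and> (\<exists>z. transcendental_over L z \<and> K = adjoin L {z})"
proof
  assume "one_extension K L"
  then show "is_subfield L \<and> (\<exists>z. transcendental_over L z \<and> K = adjoin L {z})"
    by (auto simp: one_extension_def adjoin_def)
next
  assume "is_subfield L \<and> (\<exists>z. transcendental_over L z \<and> K = adjoin L {z})"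
  then obtain z where z: "is_subfield L" "transcendental_over L z" "K = adjoin L {z}" by blast
  moreover have "z \<in> K" "L \<subseteq> K" "is_subfield K"
    using adjoin_superset[of "{z}" L] subfield_adjoin[of L "{z}"] z(3) by auto
  ultimately show "one_extension K L"
    unfolding one_extension_def by (auto simp: adjoin_def)
qed

text \<open>
  A polynomial that vanishes at \<open>a * z + b\<close> becomes a polynomial that vanishes at \<open>z\<close> when \<open>a * X + b\<close>
  is substituted in it, and this substitution is injective.
\<close>

lemma transcendental_over_affine:
  assumes L: "is_subfield L" and z: "transcendental_over L z" and ab: "a \<in> L" "b \<in> L" "a \<noteq> 0"
  shows "transcendental_over L (a * z + b)"
  unfolding transcendental_over_def
proof (intro allI impI)
  fix p assume p: "(\<forall>i. coeff p i \<in> L) \<and> poly p (a * z + b) = 0"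
  have "pcompose p [:b, a:] = 0"
  proof (rule transcendental_overD[OF z])
    show "pcompose p [:b, a:] \<in> polys_over L"
      using p ab by (intro polys_over_pcompose[OF L]) (simp_all add: polys_over_0[OF L], simp add: polys_over_def)
    show "poly (pcompose p [:b, a:]) z = 0"
      using p by (simp add: poly_pcompose add.commute mult.commute)
  qed
  then show "p = 0"
    using ab by (simp add: pcompose_eq_0_iff)
qed

text \<open>
  Homomorphisms are needed in two forms: everywhere defined ones, such as evaluations, and
  automorphisms of a subfield, about whose values outside the subfield nothing is known. The
  hypotheses on \<open>h\<close> are therefore restricted to a set \<open>K\<close>.
\<close>

lemma map_poly_hom:
  fixes h :: "'a::comm_ring_1 \<Rightarrow> 'b::comm_ring_1" and K :: "'a set"
  assumes K: "0 \<in> K" "\<And>a b. a \<in> K \<Longrightarrow> b \<in> K \<Longrightarrow> a + b \<in> K \<and> a * b \<in> K"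
    and h: "h 0 = 0" "\<And>a b. a \<in> K \<Longrightarrow> b \<in> K \<Longrightarrow> h (a + b) = h a + h b \<and> h (a * b) = h a * h b"
    and p: "\<And>i. coeff p i \<in> K" and x: "x \<in> K"
  shows "h (poly p x) = poly (map_poly h p) (h x)"
proof -
  have "poly p x \<in> K \<and> h (poly p x) = poly (map_poly h p) (h x)"
    using p
  proof (induction p)
    case 0
    then show ?case by (simp add: K h)
  next
    case (pCons a p)
    have a: "a \<in> K" and p: "coeff p i \<in> K" for i
      using pCons.prems[of 0] pCons.prems[of "Suc i"] by simp_all
    note IH = pCons.IH[OF p]
    have m: "x * poly p x \<in> K" using IH K x by blast
    then have s: "a + x * poly p x \<in> K" using K a by blast
    have "h (a + x * poly p x) = h a + h x * h (poly p x)"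
      using IH a x h(2)[OF a m] h(2)[OF x, of "poly p x"] by simp
    moreover have "map_poly h (pCons a p) = pCons (h a) (map_poly h p)"
      by (intro poly_eqI) (auto simp: coeff_map_poly h coeff_pCons split: nat.splits)
    ultimately show ?case using IH s by simp
  qed
  then show ?thesis by simp
qed

section \<open>Evaluation of multivariate polynomials\<close>

definition monom_value :: "(nat \<Rightarrow> 'a::comm_ring_1) \<Rightarrow> (nat \<Rightarrow>\<^sub>0 nat) \<Rightarrow> 'a" where
  "monom_value z m = (\<Prod>i \<in> Poly_Mapping.keys m. z i ^ Poly_Mapping.lookup m i)"

text \<open>
  The ring homomorphism that maps constants by \<open>\<phi>\<close> and the variables to \<open>z\<close>, provided that \<open>\<phi>\<close> is a
  homomorphism. It is used with the identity, as evaluation at a point, and with the embedding of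
  the constants, as substitution of rational functions.
\<close>

definition insertion :: "('k::field \<Rightarrow> 'a::comm_ring_1) \<Rightarrow> (nat \<Rightarrow> 'a) \<Rightarrow> 'k mpoly \<Rightarrow> 'a" where
  "insertion \<phi> z P = (\<Sum>m \<in> Poly_Mapping.keys P. \<phi> (Poly_Mapping.lookup P m) * monom_value z m)"

definition polys_in :: "nat set \<Rightarrow> 'k::field mpoly set" where
  "polys_in I = {P. \<forall>m \<in> Poly_Mapping.keys P. Poly_Mapping.keys m \<subseteq> I}"

definition mvar :: "nat \<Rightarrow> 'k::field mpoly" where
  "mvar i = Poly_Mapping.single (Poly_Mapping.single i 1) 1"

lemma polys_eq_polys_in: "polys n = polys_in {..<n}"
  by (simp add: polys_def polys_in_def)

lemma eval_mpoly_eq_insertion: "eval_mpoly P x = insertion (\<lambda>c. c) x P"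
  by (simp add: eval_mpoly_def insertion_def monom_value_def)

lemma polys_in_mono: "I \<subseteq> J \<Longrightarrow> P \<in> polys_in I \<Longrightarrow> P \<in> polys_in J"
  by (auto simp: polys_in_def)

lemma polys_in_0: "0 \<in> polys_in I"
  and polys_in_const: "Poly_Mapping.single 0 c \<in> polys_in I"
  and polys_in_mvar: "i \<in> I \<Longrightarrow> mvar i \<in> polys_in I"
  by (auto simp: polys_in_def mvar_def)

lemma polys_in_1: "1 \<in> polys_in I"
  using polys_in_const[of 1 I] by simp

lemma polys_in_add: "P \<in> polys_in I \<Longrightarrow> Q \<in> polys_in I \<Longrightarrow> P + Q \<in> polys_in I"
  using Poly_Mapping.keys_add[of P Q] by (fastforce simp: polys_in_def)

lemma polys_in_uminus: "P \<in> polys_in I \<Longrightarrow> - P \<in> polys_in I"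
  by (auto simp: polys_in_def in_keys_iff)

lemma polys_in_diff: "P \<in> polys_in I \<Longrightarrow> Q \<in> polys_in I \<Longrightarrow> P - Q \<in> polys_in I"
  using polys_in_add[of P I "- Q"] polys_in_uminus[of Q I] by simp

lemma polys_in_mult:
  assumes "P \<in> polys_in I" "Q \<in> polys_in I" shows "P * Q \<in> polys_in I"
  unfolding polys_in_def
proof (intro CollectI ballI)
  fix m assume "m \<in> Poly_Mapping.keys (P * Q)"
  then obtain a b where "m = a + b" "a \<in> Poly_Mapping.keys P" "b \<in> Poly_Mapping.keys Q"
    using keys_mult[of P Q] by blast
  then have "m = a + b" "Poly_Mapping.keys a \<subseteq> I" "Poly_Mapping.keys b \<subseteq> I"
    using assms by (auto simp: polys_in_def)
  then show "Poly_Mapping.keys m \<subseteq> I"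
    using Poly_Mapping.keys_add[of a b] by blast
qed

lemma polys_in_power: "P \<in> polys_in I \<Longrightarrow> P ^ e \<in> polys_in I"
  by (induction e) (auto intro: polys_in_1 polys_in_mult)

lemma polys_in_sum: "(\<And>i. i \<in> S \<Longrightarrow> f i \<in> polys_in I) \<Longrightarrow> sum f S \<in> polys_in I"
  by (induction S rule: infinite_finite_induct) (auto intro: polys_in_0 polys_in_add)

lemma poly_in_polys_in:
  assumes "\<And>i. coeff p i \<in> polys_in I" "x \<in> polys_in I" shows "poly p x \<in> polys_in I"
  using assms by (auto simp: poly_altdef intro!: polys_in_sum polys_in_mult polys_in_power)

lemma monom_value_superset:
  assumes "finite S" "Poly_Mapping.keys m \<subseteq> S"
  shows "monom_value z m = (\<Prod>i \<in> S. z i ^ Poly_Mapping.lookup m i)"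
  unfolding monom_value_def
  by (rule prod.mono_neutral_left) (use assms in \<open>auto simp: in_keys_iff\<close>)

lemma monom_value_add: "monom_value z (m + m') = monom_value z m * monom_value z m'"
proof -
  let ?S = "Poly_Mapping.keys m \<union> Poly_Mapping.keys m'"
  have "Poly_Mapping.keys (m + m') \<subseteq> ?S" by (rule Poly_Mapping.keys_add)
  then have "monom_value z (m + m') = (\<Prod>i \<in> ?S. z i ^ Poly_Mapping.lookup (m + m') i)"
    by (intro monom_value_superset) auto
  also have "\<dots> = monom_value z m * monom_value z m'"
    by (simp add: monom_value_superset[of ?S] lookup_add power_add prod.distrib)
  finally show ?thesis .
qed

lemma monom_value_0 [simp]: "monom_value z 0 = 1"
  and monom_value_single [simp]: "monom_value z (Poly_Mapping.single i e) = z i ^ e"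
  by (auto simp: monom_value_def)

lemma mpoly_expand:
  "P = (\<Sum>m \<in> Poly_Mapping.keys P. Poly_Mapping.single m (Poly_Mapping.lookup P m))"
proof (rule poly_mapping_eqI)
  fix m
  have "(\<Sum>a \<in> Poly_Mapping.keys P. Poly_Mapping.lookup (Poly_Mapping.single a (Poly_Mapping.lookup P a)) m)
      = (\<Sum>a \<in> Poly_Mapping.keys P. if a = m then Poly_Mapping.lookup P m else 0)"
    by (rule sum.cong) (auto simp: lookup_single)
  then show "Poly_Mapping.lookup P m = Poly_Mapping.lookup
      (\<Sum>m \<in> Poly_Mapping.keys P. Poly_Mapping.single m (Poly_Mapping.lookup P m)) m"
    by (auto simp: lookup_sum in_keys_iff)
qed

locale coeff_hom =
  fixes \<phi> :: "'k::field \<Rightarrow> 'a::comm_ring_1"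
  assumes hom_add: "\<phi> (a + b) = \<phi> a + \<phi> b" and hom_mult: "\<phi> (a * b) = \<phi> a * \<phi> b"
    and hom_1: "\<phi> 1 = 1"
begin

lemma hom_0: "\<phi> 0 = 0"
  using hom_add[of 0 0] by simp

lemma insertion_superset:
  assumes "finite S" "Poly_Mapping.keys P \<subseteq> S"
  shows "insertion \<phi> z P = (\<Sum>m \<in> S. \<phi> (Poly_Mapping.lookup P m) * monom_value z m)"
  unfolding insertion_def
  by (rule sum.mono_neutral_left) (use assms in \<open>auto simp: in_keys_iff hom_0\<close>)

lemma insertion_0 [simp]: "insertion \<phi> z 0 = 0"
  by (simp add: insertion_def)

lemma insertion_single: "insertion \<phi> z (Poly_Mapping.single m c) = \<phi> c * monom_value z m"
  by (simp add: insertion_def hom_0)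

lemma insertion_1 [simp]: "insertion \<phi> z 1 = 1"
  using insertion_single[of z 0 1] by (simp add: hom_1)

lemma insertion_const [simp]: "insertion \<phi> z (Poly_Mapping.single 0 c) = \<phi> c"
  and insertion_mvar [simp]: "insertion \<phi> z (mvar i) = z i"
  by (simp_all add: insertion_single mvar_def hom_1)

lemma insertion_add: "insertion \<phi> z (P + Q) = insertion \<phi> z P + insertion \<phi> z Q"
proof -
  let ?S = "Poly_Mapping.keys P \<union> Poly_Mapping.keys Q"
  have "insertion \<phi> z (P + Q) = (\<Sum>m \<in> ?S. \<phi> (Poly_Mapping.lookup (P + Q) m) * monom_value z m)"
    using Poly_Mapping.keys_add[of P Q] by (intro insertion_superset) auto
  also have "\<dots> = insertion \<phi> z P + insertion \<phi> z Q"
    by (simp add: insertion_superset[of ?S] lookup_add hom_add distrib_right sum.distrib)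
  finally show ?thesis .
qed

lemma insertion_sum: "insertion \<phi> z (sum f S) = (\<Sum>i\<in>S. insertion \<phi> z (f i))"
  by (induction S rule: infinite_finite_induct) (auto simp: insertion_add)

lemma insertion_uminus: "insertion \<phi> z (- P) = - insertion \<phi> z P"
  using insertion_add[of z P "- P"] by (simp add: eq_neg_iff_add_eq_0 add.commute)

lemma insertion_diff: "insertion \<phi> z (P - Q) = insertion \<phi> z P - insertion \<phi> z Q"
  using insertion_add[of z P "- Q"] by (simp add: insertion_uminus)

lemma insertion_mult: "insertion \<phi> z (P * Q) = insertion \<phi> z P * insertion \<phi> z Q"
proof -
  let ?s = "\<lambda>P m. Poly_Mapping.single m (Poly_Mapping.lookup P m)"
  let ?P = "Poly_Mapping.keys P" and ?Q = "Poly_Mapping.keys Q"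
  have "P * Q = (\<Sum>m\<in>?P. ?s P m) * (\<Sum>m\<in>?Q. ?s Q m)"
    using mpoly_expand[of P] mpoly_expand[of Q] by simp
  also have "\<dots> = (\<Sum>m\<in>?P. \<Sum>m'\<in>?Q. Poly_Mapping.single (m + m') (Poly_Mapping.lookup P m * Poly_Mapping.lookup Q m'))"
    by (simp add: sum_product mult_single)
  finally have "insertion \<phi> z (P * Q) = (\<Sum>m\<in>?P. \<Sum>m'\<in>?Q.
      (\<phi> (Poly_Mapping.lookup P m) * monom_value z m) * (\<phi> (Poly_Mapping.lookup Q m') * monom_value z m'))"
    by (simp add: insertion_sum insertion_single monom_value_add hom_mult ac_simps)
  also have "\<dots> = insertion \<phi> z P * insertion \<phi> z Q"
    by (simp add: insertion_def sum_product)
  finally show ?thesis .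
qed

lemma insertion_poly:
  "insertion \<phi> z (poly p X) = poly (map_poly (insertion \<phi> z) p) (insertion \<phi> z X)"
  by (rule map_poly_hom[where K = UNIV]) (auto simp: insertion_add insertion_mult)

end

lemma insertion_cong:
  assumes "P \<in> polys_in I" "\<And>i. i \<in> I \<Longrightarrow> z i = z' i"
  shows "insertion \<phi> z P = insertion \<phi> z' P"
  unfolding insertion_def
proof (rule sum.cong)
  fix m assume "m \<in> Poly_Mapping.keys P"
  then have "Poly_Mapping.keys m \<subseteq> I" using assms(1) by (auto simp: polys_in_def)
  then have "monom_value z m = monom_value z' m"
    unfolding monom_value_def using assms(2) by (intro prod.cong) (auto dest!: subsetD)
  then show "\<phi> (Poly_Mapping.lookup P m) * monom_value z m = \<phi> (Poly_Mapping.lookup P m) * monom_value z' m"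
    by simp
qed simp

interpretation eval: coeff_hom "\<lambda>c::'k::field. c"
  by unfold_locales auto

text \<open>
  This splits off one variable, so that facts about polynomials in several variables follow from
  those about one variable by induction on the set of variables.
\<close>

lemma polys_in_insert:
  assumes "P \<in> polys_in (insert j I)" "j \<notin> I"
  obtains p where "\<And>i. coeff p i \<in> polys_in I" "P = poly p (mvar j)"
proof
  \<comment> \<open>\<open>?r m\<close> is the monomial \<open>m\<close> with the variable \<open>j\<close> removed.\<close>
  let ?r = "\<lambda>m. Poly_Mapping.update j 0 m"
  let ?t = "\<lambda>m. Poly_Mapping.single (?r m) (Poly_Mapping.lookup P m)"
  define p where "p = (\<Sum>m\<in>Poly_Mapping.keys P. monom (?t m) (Poly_Mapping.lookup m j))"
  show "coeff p i \<in> polys_in I" for i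
    unfolding p_def coeff_sum
    using assms by (intro polys_in_sum)
      (auto simp: polys_in_def keys_update split: if_splits)
  have pow: "mvar j ^ e = Poly_Mapping.single (Poly_Mapping.single j e) (1::'a)" for e
    by (induction e) (simp_all add: mvar_def mult_single single_add[symmetric])
  have m: "?r m + Poly_Mapping.single j (Poly_Mapping.lookup m j) = m" for m
    by (rule poly_mapping_eqI) (auto simp: lookup_add lookup_update lookup_single when_def)
  have "poly p (mvar j) = (\<Sum>m\<in>Poly_Mapping.keys P. ?t m * mvar j ^ Poly_Mapping.lookup m j)"
    by (simp add: p_def poly_sum poly_monom)
  also have "\<dots> = (\<Sum>m\<in>Poly_Mapping.keys P. Poly_Mapping.single m (Poly_Mapping.lookup P m))"
    by (simp add: pow mult_single m)
  finally show "P = poly p (mvar j)" using mpoly_expand[of P] by simp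
qed

lemma polys_in_empty:
  assumes "P \<in> polys_in {}" obtains c where "P = Poly_Mapping.single 0 c"
proof
  have "Poly_Mapping.lookup P m = 0" if "m \<noteq> 0" for m
    using assms that by (auto simp: polys_in_def in_keys_iff)
  then show "P = Poly_Mapping.single 0 (Poly_Mapping.lookup P 0)"
    by (intro poly_mapping_eqI) (auto simp: lookup_single when_def)
qed

lemma poly_infinite_zero:
  fixes p :: "'a::idom poly"
  assumes "infinite {x. poly p x = 0}" shows "p = 0"
  using assms poly_roots_finite by blast

text \<open>
  With the other coordinates of \<open>x\<close> kept fixed, the polynomial in coordinate \<open>j\<close> has infinitely many
  zeros.
\<close>

lemma eval_coeff_zero:
  fixes p :: "'k::field mpoly poly"
  assumes inf: "infinite (UNIV :: 'k set)" and "j \<notin> I" "\<And>i. coeff p i \<in> polys_in I"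
    and zero: "\<And>x. insertion (\<lambda>c. c) x (poly p (mvar j)) = 0"
  shows "insertion (\<lambda>c. c) x (coeff p i) = 0"
proof -
  have "poly (map_poly (insertion (\<lambda>c. c) x) p) t = 0" for t
  proof -
    have "map_poly (insertion (\<lambda>c. c) (x(j := t))) p = map_poly (insertion (\<lambda>c. c) x) p"
      using assms(2,3) by (intro poly_eqI) (auto simp: coeff_map_poly intro!: insertion_cong)
    then show ?thesis
      using zero[of "x(j := t)"] unfolding eval.insertion_poly eval.insertion_mvar by simp
  qed
  then have "map_poly (insertion (\<lambda>c. c) x) p = 0"
    using inf by (intro poly_infinite_zero) simp
  then show ?thesis
    by (metis coeff_0 coeff_map_poly eval.insertion_0)
qed

lemma eval_mpoly_zero_imp:
  fixes P :: "'k::field mpoly"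
  assumes inf: "infinite (UNIV :: 'k set)" and "finite I" "P \<in> polys_in I"
    and "\<And>x. insertion (\<lambda>c. c) x P = 0"
  shows "P = 0"
  using assms(2-)
proof (induction I arbitrary: P rule: finite_induct)
  case empty
  then obtain c where "P = Poly_Mapping.single 0 c" by (elim polys_in_empty)
  then show ?case using empty.prems(2) by simp
next
  case (insert j I)
  obtain p where p: "\<And>i. coeff p i \<in> polys_in I" "P = poly p (mvar j)"
    by (rule polys_in_insert[OF insert.prems(1) insert.hyps(2)]) blast
  have "insertion (\<lambda>c. c) x (coeff p i) = 0" for x i
    by (rule eval_coeff_zero[OF inf insert.hyps(2) p(1)]) (use insert.prems(2) in \<open>simp add: p(2)\<close>)
  then have "coeff p i = 0" for i
    using p(1) by (intro insert.IH) auto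
  then have "p = 0" by (intro poly_eqI) simp
  then show ?case by (simp add: p(2))
qed

text \<open>
  The variable \<open>j\<close> is transcendental over the polynomials in other variables.
\<close>

lemma poly_mvar_zero_imp:
  fixes p :: "'k::field mpoly poly"
  assumes inf: "infinite (UNIV :: 'k set)" and "finite I" "j \<notin> I" "\<And>i. coeff p i \<in> polys_in I"
    and "poly p (mvar j) = 0"
  shows "p = 0"
proof -
  have "insertion (\<lambda>c. c) x (coeff p i) = 0" for x i
    by (rule eval_coeff_zero[OF inf assms(3,4)]) (simp add: assms(5))
  then have "coeff p i = 0" for i
    using assms by (intro eval_mpoly_zero_imp[OF inf assms(2)]) auto
  then show ?thesis by (intro poly_eqI) simp
qed

subsection \<open>Constants and coordinates in the field of rational functions\<close>

definition of_mpoly :: "'k::field mpoly \<Rightarrow> 'k ratfun" where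
  "of_mpoly P = Fract P 1"

lemma of_mpoly_add: "of_mpoly (P + Q) = of_mpoly P + of_mpoly Q"
  and of_mpoly_mult: "of_mpoly (P * Q) = of_mpoly P * of_mpoly Q"
  and of_mpoly_eq_0_iff [simp]: "of_mpoly P = 0 \<longleftrightarrow> P = 0"
  by (simp_all add: of_mpoly_def eq_fract Zero_fract_def)

lemma Fract_of_mpoly: "Q \<noteq> 0 \<Longrightarrow> Fract P Q = of_mpoly P / of_mpoly Q"
  by (simp add: of_mpoly_def)

lemma const_of_mpoly: "const c = of_mpoly (Poly_Mapping.single 0 c)"
  and var_of_mpoly: "var i = of_mpoly (mvar i)"
  by (simp_all add: const_def of_mpoly_def var_def mvar_def)

lemma const_add: "const (a + b) = const a + const b"
  and const_mult: "const (a * b) = const a * const b"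
  and const_0 [simp]: "const 0 = 0"
  and const_1 [simp]: "const 1 = 1"
  by (simp_all add: const_def single_add mult_single fract_collapse)

interpretation const: coeff_hom const
  by unfold_locales (auto simp: const_add const_mult)

lemma const_eq_0_iff [simp]: "const c = 0 \<longleftrightarrow> c = 0"
proof -
  have "Poly_Mapping.single (0::nat \<Rightarrow>\<^sub>0 nat) c = 0 \<longleftrightarrow> c = 0"
    by (metis lookup_single_eq lookup_zero single_zero)
  then show ?thesis by (simp add: const_of_mpoly)
qed

lemma const_uminus: "const (- a) = - const a"
  using const_add[of a "- a"] by (simp add: eq_neg_iff_add_eq_0 add.commute)

lemma const_diff: "const (a - b) = const a - const b"
  using const_add[of a "- b"] by (simp add: const_uminus)

lemma const_eq_iff [simp]: "const a = const b \<longleftrightarrow> a = b"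
  using const_eq_0_iff[of "a - b"] by (simp add: const_diff)

lemma const_inverse: "const (inverse a) = inverse (const a)"
proof (cases "a = 0")
  case False
  then have "const a * const (inverse a) = 1" by (simp flip: const_mult)
  then show ?thesis by (metis inverse_unique)
qed simp

lemma const_power: "const (a ^ e) = const a ^ e"
  by (induction e) (simp_all add: const_mult)

lemma const_power_int: "const (a powi e) = const a powi e"
  by (simp add: power_int_def const_power const_inverse)

lemma subfield_range_const: "is_subfield (range const)"
proof (rule is_subfieldI)
  show "0 \<in> range const" "1 \<in> range const"
    by (metis const_0 rangeI, metis const_1 rangeI)
qed (auto simp flip: const_add const_mult const_uminus const_inverse)

text \<open>
  This connects substitution with the fraction field: it makes the definition of \<open>ratfuns\<close> an
  instance of adjoining elements to the constants.
\<close>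

lemma insertion_var: "insertion const var P = of_mpoly P"
proof -
  have mv: "monom_value var m = of_mpoly (Poly_Mapping.single m 1)" for m :: "nat \<Rightarrow>\<^sub>0 nat"
  proof (induction m rule: update_induct)
    case const
    then show ?case by (simp add: of_mpoly_def fract_collapse)
  next
    case (update m i e)
    have *: "Poly_Mapping.update i e m = m + Poly_Mapping.single i e"
      using update(1) by (intro poly_mapping_eqI) (auto simp: lookup_update lookup_add lookup_single when_def in_keys_iff)
    have pow: "var i ^ e = of_mpoly (Poly_Mapping.single (Poly_Mapping.single i e) 1)" for e
      by (induction e) (simp_all add: var_of_mpoly mvar_def of_mpoly_mult[symmetric] mult_single single_add[symmetric],
        simp add: of_mpoly_def fract_collapse)
    show ?case
      by (simp add: * monom_value_add update.IH pow of_mpoly_mult[symmetric] mult_single)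
  qed
  have sum: "of_mpoly (sum f S) = (\<Sum>i\<in>S. of_mpoly (f i))" for f :: "_ \<Rightarrow> 'a mpoly" and S :: "(nat \<Rightarrow>\<^sub>0 nat) set"
    by (induction S rule: infinite_finite_induct) (auto simp: of_mpoly_add)
  have "insertion const var P = (\<Sum>m\<in>Poly_Mapping.keys P. of_mpoly (Poly_Mapping.single m (Poly_Mapping.lookup P m)))"
    by (simp add: insertion_def mv const_of_mpoly of_mpoly_mult[symmetric] mult_single)
  also have "\<dots> = of_mpoly P"
    by (simp flip: sum mpoly_expand)
  finally show ?thesis .
qed

section \<open>Free generators of the field of rational functions\<close>

lemma infinite_alg_closed: "infinite (UNIV :: 'k::alg_closed_field set)"
proof
  assume fin: "finite (UNIV :: 'k set)"
  \<comment> \<open>As in Euclid's proof that there are infinitely many primes, this polynomial has no zero.\<close>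
  define p :: "'k poly" where "p = 1 + (\<Prod>a\<in>UNIV. [:- a, 1:])"
  have deg: "Polynomial.degree (\<Prod>a\<in>(UNIV :: 'k set). [:- a, 1:]) = card (UNIV :: 'k set)"
    by (subst degree_prod_eq_sum_degree) auto
  have "card (UNIV :: 'k set) > 0" using fin by (simp add: card_gt_0_iff)
  then have "Polynomial.degree p > 0"
    unfolding p_def using deg by (subst degree_add_eq_right) auto
  then obtain x where x: "poly p x = 0" using alg_closed_imp_poly_has_root by blast
  have "poly (\<Prod>a\<in>(UNIV :: 'k set). [:- a, 1:]) x = 0"
    using fin by (simp add: poly_prod prod_zero_iff)
  then show False using x by (simp add: p_def)
qed

abbreviation const_adjoin :: "'k::field ratfun set \<Rightarrow> 'k ratfun set" where
  "const_adjoin S \<equiv> adjoin (range const) S"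

lemma insertion_in_subfield:
  assumes "is_subfield M" "range const \<subseteq> M" "\<And>i. i \<in> I \<Longrightarrow> z i \<in> M" "P \<in> polys_in I"
  shows "insertion const z P \<in> M"
  unfolding insertion_def monom_value_def
  using assms(2-4) by (intro subfield_intros[OF assms(1)]) (auto simp: polys_in_def)

lemma insertion_in_const_adjoin:
  "P \<in> polys_in I \<Longrightarrow> insertion const z P \<in> const_adjoin (z ` I)"
  using adjoin_superset[of "z ` I" "range const"]
  by (intro insertion_in_subfield[where I = I] subfield_adjoin) auto

text \<open>
  The fractions form a subfield, as in the case of one generator.
\<close>

lemma const_adjoin_image:
  "const_adjoin (z ` I) = {insertion const z P / insertion const z Q | P Q.
     P \<in> polys_in I \<and> Q \<in> polys_in I \<and> insertion const z Q \<noteq> 0}" (is "_ = ?M")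
proof
  let ?v = "insertion const z"
  note ins = const.insertion_add const.insertion_mult const.insertion_uminus const.insertion_1 const.insertion_0
  note closed = polys_in_0 polys_in_1 polys_in_add polys_in_mult polys_in_uminus
  have in_M: "?v P / ?v Q \<in> ?M"
    if "P \<in> polys_in I" "Q \<in> polys_in I" "?v Q \<noteq> 0" for P Q
    using that by blast
  have poly_M: "?v P \<in> ?M" if "P \<in> polys_in I" for P
    using in_M[OF that polys_in_1] by simp
  have "is_subfield ?M"
  proof (rule is_subfieldI)
    show "0 \<in> ?M" "1 \<in> ?M"
      using poly_M[OF polys_in_0] poly_M[OF polys_in_1] by simp_all
  next
    fix a b assume "a \<in> ?M" "b \<in> ?M"
    then obtain p q r s where *: "p \<in> polys_in I" "q \<in> polys_in I" "?v q \<noteq> 0"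
      "r \<in> polys_in I" "s \<in> polys_in I" "?v s \<noteq> 0"
      "a = ?v p / ?v q" "b = ?v r / ?v s"
      by blast
    have "a + b = ?v (p * s + r * q) / ?v (q * s)"
      using * by (simp add: add_frac_eq ins)
    also have "\<dots> \<in> ?M" using * by (intro in_M closed) (simp_all add: ins)
    finally show "a + b \<in> ?M" .
    have "a * b = ?v (p * r) / ?v (q * s)"
      using * by (simp add: times_divide_times_eq ins)
    also have "\<dots> \<in> ?M" using * by (intro in_M closed) (simp_all add: ins)
    finally show "a * b \<in> ?M" .
  next
    fix a assume "a \<in> ?M"
    then obtain p q where *: "p \<in> polys_in I" "q \<in> polys_in I" "?v q \<noteq> 0"
      "a = ?v p / ?v q" by blast
    have "- a = ?v (- p) / ?v q" using * by (simp add: ins)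
    also have "\<dots> \<in> ?M" using * by (intro in_M closed)
    finally show "- a \<in> ?M" .
    assume "a \<noteq> 0"
    then have "inverse a = ?v q / ?v p" "?v p \<noteq> 0" using * by simp_all
    then show "inverse a \<in> ?M" using in_M[OF *(2,1)] by simp
  qed
  moreover have "z i \<in> ?M" if "i \<in> I" for i
    using poly_M[OF polys_in_mvar[OF that]] by simp
  moreover have "const c \<in> ?M" for c
    using poly_M[OF polys_in_const[of c]] by simp
  ultimately show "const_adjoin (z ` I) \<subseteq> ?M" by (intro adjoin_least) blast+
next
  show "?M \<subseteq> const_adjoin (z ` I)"
    by (auto intro!: subfield_divide subfield_adjoin insertion_in_const_adjoin)
qed

lemma ratfuns_eq_const_adjoin: "ratfuns n = const_adjoin (var ` {..<n})"
  unfolding const_adjoin_image ratfuns_def insertion_var polys_eq_polys_in of_mpoly_eq_0_iff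
  by (metis (no_types, opaque_lifting) Fract_of_mpoly)

lemma subfield_ratfuns: "is_subfield (ratfuns n)"
  by (simp add: ratfuns_eq_const_adjoin subfield_adjoin)

lemma const_in_ratfuns [simp]: "const c \<in> ratfuns n"
  and var_in_ratfuns: "i < n \<Longrightarrow> var i \<in> ratfuns n"
  using adjoin_superset[of "var ` {..<n}" "range const"] by (auto simp: ratfuns_eq_const_adjoin)

lemma const_adjoin_simps:
  shows const_in_const_adjoin [simp]: "const c \<in> const_adjoin S"
    and in_const_adjoin: "a \<in> S \<Longrightarrow> a \<in> const_adjoin S"
  using adjoin_superset[of S "range const"] by auto

lemma const_adjoin_least:
  "is_subfield M \<Longrightarrow> range const \<subseteq> M \<Longrightarrow> S \<subseteq> M \<Longrightarrow> const_adjoin S \<subseteq> M"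
  by (rule adjoin_least)

lemma const_adjoin_empty: "const_adjoin {} = range const"
  using adjoin_least[OF subfield_range_const, of "{}" "range const"] adjoin_superset[of "{}" "range const"]
  by auto

lemma adjoin_const_adjoin: "adjoin (const_adjoin S) {a} = const_adjoin (insert a S)"
proof
  have "const_adjoin S \<subseteq> const_adjoin (insert a S)" by (rule adjoin_mono) auto
  then show "adjoin (const_adjoin S) {a} \<subseteq> const_adjoin (insert a S)"
    by (intro adjoin_least subfield_adjoin) (auto intro: in_const_adjoin)
  have "const_adjoin S \<subseteq> adjoin (const_adjoin S) {a}" "a \<in> adjoin (const_adjoin S) {a}"
    using adjoin_superset[of "{a}" "const_adjoin S"] by auto
  then show "const_adjoin (insert a S) \<subseteq> adjoin (const_adjoin S) {a}"
    by (intro const_adjoin_least subfield_adjoin) (auto intro: in_const_adjoin)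
qed

definition alg_indep :: "nat set \<Rightarrow> (nat \<Rightarrow> 'k::field ratfun) \<Rightarrow> bool" where
  "alg_indep I z \<longleftrightarrow> (\<forall>P \<in> polys_in I. insertion const z P = 0 \<longrightarrow> P = 0)"

lemma alg_indep_empty: "alg_indep {} z"
  unfolding alg_indep_def
proof (intro ballI impI)
  fix P :: "'a mpoly" assume "P \<in> polys_in {}" "insertion const z P = 0"
  then show "P = 0" by (auto elim!: polys_in_empty)
qed

text \<open>
  The coefficients of \<open>q\<close> are finitely many fractions and have a common denominator. It makes
  algebraic relations over the field generated by some elements accessible to polynomial
  relations between these elements.
\<close>

lemma clear_denominators:
  assumes "q \<in> polys_over (const_adjoin (z ` I))"
  shows "\<exists>B p. B \<in> polys_in I \<and> insertion const z B \<noteq> 0 \<and> (\<forall>i. coeff p i \<in> polys_in I) \<and>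
           map_poly (insertion const z) p = smult (insertion const z B) q"
  using assms
proof (induction q)
  case 0
  have "map_poly (insertion const z) 0 = smult (insertion const z 1) 0" by simp
  then show ?case using polys_in_0[of I] polys_in_1[of I] by (intro exI[of _ 1] exI[of _ 0]) simp
next
  case (pCons a q)
  then obtain B p where B: "B \<in> polys_in I" "insertion const z B \<noteq> 0" "\<And>i. coeff p i \<in> polys_in I"
    "map_poly (insertion const z) p = smult (insertion const z B) q" by auto
  obtain P Q where PQ: "P \<in> polys_in I" "Q \<in> polys_in I" "insertion const z Q \<noteq> 0"
    "a = insertion const z P / insertion const z Q"
    using pCons.prems unfolding const_adjoin_image by auto
  have c: "insertion const z (coeff p i) = insertion const z B * coeff q i" for i
    using arg_cong[OF B(4), of "\<lambda>r. coeff r i"] by (simp add: coeff_map_poly)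
  have "map_poly (insertion const z) (pCons (P * B) (smult Q p)) = smult (insertion const z (Q * B)) (pCons a q)"
    using PQ by (intro poly_eqI)
      (auto simp: coeff_map_poly coeff_pCons const.insertion_mult c split: nat.splits)
  moreover have "coeff (pCons (P * B) (smult Q p)) i \<in> polys_in I" for i
    using B PQ by (auto simp: coeff_pCons intro: polys_in_mult split: nat.splits)
  moreover have "Q * B \<in> polys_in I" "insertion const z (Q * B) \<noteq> 0"
    using B PQ by (auto simp: const.insertion_mult intro: polys_in_mult)
  ultimately show ?case by blast
qed

text \<open>
  A polynomial relation between the \<open>z i\<close> is a polynomial relation for \<open>z j\<close> over the field generated by
  the others, and conversely after clearing denominators. This makes algebraic independence of a set
  a matter of adding its elements in any order, which is what allows free generators to be
  changed or reordered.
\<close>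

lemma alg_indep_insert:
  fixes z :: "nat \<Rightarrow> 'k::alg_closed_field ratfun"
  assumes I: "finite I" "j \<notin> I"
  shows "alg_indep (insert j I) z \<longleftrightarrow>
    alg_indep I z \<and> transcendental_over (const_adjoin (z ` I)) (z j)" (is "?l \<longleftrightarrow> _ \<and> ?t")
proof (intro iffI conjI)
  assume l: ?l
  show "alg_indep I z"
    using l polys_in_mono[of I "insert j I"] by (auto simp: alg_indep_def)
  show ?t
    unfolding transcendental_over_def
  proof (intro allI impI)
    fix q assume q: "(\<forall>i. coeff q i \<in> const_adjoin (z ` I)) \<and> poly q (z j) = 0"
    obtain B p where B: "B \<in> polys_in I" "insertion const z B \<noteq> 0" "\<And>i. coeff p i \<in> polys_in I"
      "map_poly (insertion const z) p = smult (insertion const z B) q"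
      using clear_denominators[of q z I] q by (auto simp: polys_over_def)
    have "poly p (mvar j) \<in> polys_in (insert j I)"
      using B(3) polys_in_mono[of I "insert j I"] by (intro poly_in_polys_in polys_in_mvar) auto
    moreover have "insertion const z (poly p (mvar j)) = 0"
      using B(4) q by (simp add: const.insertion_poly)
    ultimately have "poly p (mvar j) = 0" using l by (auto simp: alg_indep_def)
    then have "p = 0"
      by (intro poly_mvar_zero_imp[OF infinite_alg_closed I B(3)])
    then show "q = 0" using B(2,4) by simp
  qed
next
  assume r: "alg_indep I z \<and> ?t"
  show ?l
    unfolding alg_indep_def
  proof (intro ballI impI)
    fix P assume P: "P \<in> polys_in (insert j I)" "insertion const z P = 0"
    obtain p where p: "\<And>i. coeff p i \<in> polys_in I" "P = poly p (mvar j)"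
      by (rule polys_in_insert[OF P(1) I(2)]) blast
    have "map_poly (insertion const z) p = 0"
    proof (rule transcendental_overD)
      show ?t using r ..
      show "map_poly (insertion const z) p \<in> polys_over (const_adjoin (z ` I))"
        using p(1) by (auto simp: polys_over_def coeff_map_poly intro: insertion_in_const_adjoin)
      show "poly (map_poly (insertion const z) p) (z j) = 0"
        using P(2) by (simp add: p(2) const.insertion_poly)
    qed
    then have "insertion const z (coeff p i) = 0" for i
      by (metis coeff_0 coeff_map_poly const.insertion_0)
    then have "coeff p i = 0" for i
      using r p(1) by (auto simp: alg_indep_def)
    then have "p = 0" by (intro poly_eqI) simp
    then show "P = 0" by (simp add: p(2))
  qed
qed

lemma alg_indep_cong:
  assumes "\<And>i. i \<in> I \<Longrightarrow> z i = z' i"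
  shows "alg_indep I z \<longleftrightarrow> alg_indep I z'"
proof -
  have "insertion const z P = insertion const z' P" if "P \<in> polys_in I" for P
    using that assms by (rule insertion_cong)
  then show ?thesis by (auto simp: alg_indep_def)
qed

lemma alg_indep_tower:
  fixes z :: "nat \<Rightarrow> 'k::alg_closed_field ratfun"
  shows "alg_indep {..<n} z \<longleftrightarrow> (\<forall>i<n. transcendental_over (const_adjoin (z ` {..<i})) (z i))"
  by (induction n) (simp_all add: alg_indep_empty lessThan_Suc alg_indep_insert less_Suc_eq, blast)

definition free_generators :: "nat \<Rightarrow> (nat \<Rightarrow> 'k::field ratfun) \<Rightarrow> bool" where
  "free_generators n z \<longleftrightarrow> alg_indep {..<n} z \<and> const_adjoin (z ` {..<n}) = ratfuns n"

lemma free_generators_in_ratfuns: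
  "free_generators n z \<Longrightarrow> i < n \<Longrightarrow> z i \<in> ratfuns n"
  unfolding free_generators_def by (metis imageI in_const_adjoin lessThan_iff)

text \<open>
  Since the other generators generate a field over which \<open>z j\<close> is transcendental, an invertible affine
  change of \<open>z j\<close> with coefficients in that field keeps it transcendental and can be undone. Both row
  operations on weights and changes of a linear basis are of this form.
\<close>

lemma free_generators_update:
  fixes z :: "nat \<Rightarrow> 'k::alg_closed_field ratfun"
  assumes z: "free_generators n z" and j: "j < n"
    and ab: "a \<in> const_adjoin (z ` ({..<n} - {j}))" "b \<in> const_adjoin (z ` ({..<n} - {j}))" "a \<noteq> 0"
  shows "free_generators n (z(j := a * z j + b))" (is "free_generators n ?z")
proof -
  let ?I = "{..<n} - {j}"
  have ins: "insert j ?I = {..<n}" using j by auto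
  have img: "?z ` ?I = z ` ?I" by (auto simp: image_iff)
  have ind: "alg_indep ?I z" "transcendental_over (const_adjoin (z ` ?I)) (z j)"
    using z alg_indep_insert[of ?I j z] unfolding ins by (simp_all add: free_generators_def)
  have "alg_indep ?I ?z" using ind(1) alg_indep_cong[of ?I ?z z] by auto
  moreover have "transcendental_over (const_adjoin (?z ` ?I)) (?z j)"
    unfolding img using ind(2) ab by (simp add: transcendental_over_affine subfield_adjoin)
  ultimately have "alg_indep {..<n} ?z"
    using alg_indep_insert[of ?I j ?z] unfolding ins by simp
  moreover have "const_adjoin (?z ` {..<n}) = const_adjoin (z ` {..<n})"
  proof
    have sub: "const_adjoin (z ` ?I) \<subseteq> const_adjoin (z ` {..<n})" by (rule adjoin_mono) auto
    have "?z i \<in> const_adjoin (z ` {..<n})" if "i < n" for i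
    proof -
      have "z l \<in> const_adjoin (z ` {..<n})" if "l < n" for l
        using that by (intro in_const_adjoin) simp
      moreover have "a * z j + b \<in> const_adjoin (z ` {..<n})"
        using sub ab calculation[OF j] by (intro subfield_intros[OF subfield_adjoin]) auto
      ultimately show ?thesis using that by simp
    qed
    then show "const_adjoin (?z ` {..<n}) \<subseteq> const_adjoin (z ` {..<n})"
      by (intro const_adjoin_least subfield_adjoin) (auto simp del: fun_upd_apply)
    have "const_adjoin (z ` ?I) \<subseteq> const_adjoin (?z ` {..<n})"
      unfolding img[symmetric] by (rule adjoin_mono) auto
    then have ab': "a \<in> const_adjoin (?z ` {..<n})" "b \<in> const_adjoin (?z ` {..<n})"
      using ab by auto
    have zj: "?z j \<in> const_adjoin (?z ` {..<n})" using j by (intro in_const_adjoin) blast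
    have "z j = (?z j - b) / a" using ab(3) by simp
    also have "\<dots> \<in> const_adjoin (?z ` {..<n})"
      by (intro subfield_intros[OF subfield_adjoin] ab' zj)
    finally have "z j \<in> const_adjoin (?z ` {..<n})" .
    moreover have "z i \<in> const_adjoin (?z ` {..<n})" if "i < n" "i \<noteq> j" for i
      using that in_const_adjoin[of "?z i" "?z ` {..<n}"] by simp
    ultimately show "const_adjoin (z ` {..<n}) \<subseteq> const_adjoin (?z ` {..<n})"
      by (intro const_adjoin_least subfield_adjoin) (auto simp del: fun_upd_apply)
  qed
  ultimately show ?thesis using z unfolding free_generators_def by simp
qed

section \<open>The Cremona group\<close>

lemma subgroup_cremona:
  "subgroup (carrier (cremona n)) (BijGroup (ratfuns n :: 'k::field ratfun set))"
proof -
  let ?F = "ratfuns n :: 'k ratfun set" and ?G = "BijGroup (ratfuns n :: 'k ratfun set)"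
  interpret G: group ?G by (rule group_BijGroup)
  note F = subfield_closed[OF subfield_ratfuns[of n]]
  have "subgroup (carrier (cremona n)) ?G"
  proof (rule G.subgroupI)
    show "carrier (cremona n) \<subseteq> carrier ?G"
      by (auto simp: cremona_def BijGroup_def)
    have "(\<lambda>x\<in>?F. x) \<in> carrier (cremona n)"
      using F by (auto simp: cremona_def id_Bij)
    then show "carrier (cremona n) \<noteq> ({} :: ('k ratfun \<Rightarrow> 'k ratfun) set)" by blast
  next
    fix s :: "'k ratfun \<Rightarrow> 'k ratfun" assume s: "s \<in> carrier (cremona n)"
    then have B: "s \<in> Bij ?F" by (simp add: cremona_def)
    then have bij: "bij_betw s ?F ?F" by (simp add: Bij_def)
    have "inv_into ?F s (f + g) = inv_into ?F s f + inv_into ?F s g"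
      if "f \<in> ?F" "g \<in> ?F" for f g
      using s that by (intro Bij_inv_into_lemma[where g = "(+)"] B) (auto simp: cremona_def F)
    moreover have "inv_into ?F s (f * g) = inv_into ?F s f * inv_into ?F s g"
      if "f \<in> ?F" "g \<in> ?F" for f g
      using s that by (intro Bij_inv_into_lemma[where g = "(*)"] B) (auto simp: cremona_def F)
    moreover have "inv_into ?F s (const c) = const c" for c
      using s bij inv_into_f_f[of s ?F "const c"] by (simp add: cremona_def bij_betw_def)
    ultimately show "inv\<^bsub>?G\<^esub> s \<in> carrier (cremona n)"
      using restrict_inv_into_Bij[OF B] by (auto simp: inv_BijGroup[OF B] cremona_def F)
  next
    fix s t :: "'k ratfun \<Rightarrow> 'k ratfun" assume "s \<in> carrier (cremona n)" "t \<in> carrier (cremona n)"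
    then show "s \<otimes>\<^bsub>?G\<^esub> t \<in> carrier (cremona n)"
      using compose_Bij[of s ?F t] Bij_imp_funcset[of t ?F]
      by (auto simp: cremona_def BijGroup_def compose_def F Pi_def)
  qed
  then show ?thesis .
qed

lemma cremona_eq: "cremona n = BijGroup (ratfuns n)\<lparr>carrier := carrier (cremona n)\<rparr>"
  by (simp add: cremona_def)

lemma group_cremona: "group (cremona n)"
  using subgroup.subgroup_is_group[OF subgroup_cremona group_BijGroup] cremona_eq by metis

lemma cremona_Bij: "s \<in> carrier (cremona n) \<Longrightarrow> s \<in> Bij (ratfuns n)"
  by (simp add: cremona_def)

lemma cremona_mem: "s \<in> carrier (cremona n) \<Longrightarrow> f \<in> ratfuns n \<Longrightarrow> s f \<in> ratfuns n"
  using Bij_imp_funcset[OF cremona_Bij] by auto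

lemma cremona_mult:
  "s \<in> carrier (cremona n) \<Longrightarrow> t \<in> carrier (cremona n) \<Longrightarrow> f \<in> ratfuns n \<Longrightarrow>
   (s \<otimes>\<^bsub>cremona n\<^esub> t) f = s (t f)"
  using cremona_Bij[of s n] cremona_Bij[of t n]
  by (subst cremona_eq) (simp add: BijGroup_def compose_def)

lemma cremona_one: "f \<in> ratfuns n \<Longrightarrow> \<one>\<^bsub>cremona n\<^esub> f = f"
  by (subst cremona_eq) (simp add: BijGroup_def)

lemma cremona_inv_closed: "s \<in> carrier (cremona n) \<Longrightarrow> inv\<^bsub>cremona n\<^esub> s \<in> carrier (cremona n)"
  by (rule group.inv_closed[OF group_cremona])

lemma cremona_inv_left:
  assumes "s \<in> carrier (cremona n)" "f \<in> ratfuns n" shows "(inv\<^bsub>cremona n\<^esub> s) (s f) = f"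
  using cremona_mult[OF cremona_inv_closed[OF assms(1)] assms]
  by (simp add: group.l_inv[OF group_cremona assms(1)] cremona_one assms)

lemma cremona_inv_right:
  assumes "s \<in> carrier (cremona n)" "f \<in> ratfuns n" shows "s ((inv\<^bsub>cremona n\<^esub> s) f) = f"
  using cremona_mult[OF assms(1) cremona_inv_closed[OF assms(1)] assms(2)]
  by (simp add: group.r_inv[OF group_cremona assms(1)] cremona_one assms)

lemma cremona_add: "s \<in> carrier (cremona n) \<Longrightarrow> f \<in> ratfuns n \<Longrightarrow> g \<in> ratfuns n \<Longrightarrow> s (f + g) = s f + s g"
  and cremona_times: "s \<in> carrier (cremona n) \<Longrightarrow> f \<in> ratfuns n \<Longrightarrow> g \<in> ratfuns n \<Longrightarrow> s (f * g) = s f * s g"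
  and cremona_const: "s \<in> carrier (cremona n) \<Longrightarrow> s (const c) = const c"
  by (auto simp: cremona_def)

lemma cremona_0: "s \<in> carrier (cremona n) \<Longrightarrow> s 0 = 0"
  and cremona_1: "s \<in> carrier (cremona n) \<Longrightarrow> s 1 = 1"
  using cremona_const[of s n 0] cremona_const[of s n 1] by simp_all

lemma cremona_uminus:
  assumes "s \<in> carrier (cremona n)" "f \<in> ratfuns n" shows "s (- f) = - s f"
  using cremona_add[OF assms subfield_minus[OF subfield_ratfuns assms(2)]]
  by (simp add: cremona_0[OF assms(1)] eq_neg_iff_add_eq_0 add.commute)

lemma cremona_inverse:
  assumes s: "s \<in> carrier (cremona n)" and f: "f \<in> ratfuns n" shows "s (inverse f) = inverse (s f)"
proof (cases "f = 0")
  case False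
  have "s f * s (inverse f) = 1"
    using cremona_times[OF s f subfield_inverse[OF subfield_ratfuns f]] False
    by (simp add: cremona_1[OF s])
  then show ?thesis by (metis inverse_unique)
qed (simp add: cremona_0[OF s])

lemma cremona_eq_0_iff:
  assumes s: "s \<in> carrier (cremona n)" and f: "f \<in> ratfuns n" shows "s f = 0 \<longleftrightarrow> f = 0"
  using cremona_inv_left[OF s f] cremona_0[OF cremona_inv_closed[OF s]] cremona_0[OF s] by metis

lemma ratfuns_induct:
  assumes "f \<in> ratfuns n" and "is_subfield {f \<in> ratfuns n. Q f}"
    and "\<And>c. Q (const c)" "\<And>i. i < n \<Longrightarrow> Q (var i)"
  shows "Q f"
proof -
  have "ratfuns n \<subseteq> {f \<in> ratfuns n. Q f}"
    using assms by (subst ratfuns_eq_const_adjoin, intro const_adjoin_least) (auto intro: var_in_ratfuns)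
  then show ?thesis using assms(1) by auto
qed

lemma cremona_eqI:
  assumes s: "s \<in> carrier (cremona n)" and t: "t \<in> carrier (cremona n)"
    and eq: "\<And>i. i < n \<Longrightarrow> s (var i) = t (var i)"
  shows "s = t"
proof (rule extensionalityI[of _ "ratfuns n"])
  show "s \<in> extensional (ratfuns n)" "t \<in> extensional (ratfuns n)"
    using s t by (auto dest: cremona_Bij Bij_imp_extensional)
  fix f :: "'a ratfun" assume "f \<in> ratfuns n"
  then show "s f = t f"
  proof (rule ratfuns_induct)
    show "is_subfield {f \<in> ratfuns n. s f = t f}"
      by (rule is_subfieldI) (auto simp: cremona_add[OF s] cremona_add[OF t] cremona_times[OF s]
          cremona_times[OF t] cremona_uminus[OF s] cremona_uminus[OF t] cremona_inverse[OF s]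
          cremona_inverse[OF t] cremona_0[OF s] cremona_0[OF t] cremona_1[OF s] cremona_1[OF t]
          intro: subfield_closed[OF subfield_ratfuns])
  qed (auto simp: cremona_const[OF s] cremona_const[OF t] eq)
qed

text \<open>
  The elements that \<open>s\<close> maps into \<open>M\<close> form a field, so it is enough to look at generators.
\<close>

lemma cremona_image_generators:
  assumes s: "s \<in> carrier (cremona n)" and S: "S \<subseteq> ratfuns n" and f: "f \<in> const_adjoin S"
    and M: "is_subfield M" "range const \<subseteq> M" "\<And>a. a \<in> S \<Longrightarrow> s a \<in> M"
  shows "s f \<in> M"
proof -
  have "const_adjoin S \<subseteq> {f \<in> ratfuns n. s f \<in> M}"
  proof (rule const_adjoin_least)
    show "is_subfield {f \<in> ratfuns n. s f \<in> M}"
      by (rule is_subfieldI) (auto simp: cremona_add[OF s] cremona_times[OF s] cremona_uminus[OF s]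
          cremona_inverse[OF s] cremona_0[OF s] cremona_1[OF s]
          intro: subfield_closed[OF subfield_ratfuns] subfield_closed[OF M(1)])
  qed (use S M(2,3) in \<open>auto simp: cremona_const[OF s]\<close>)
  then show ?thesis using f by auto
qed

text \<open>
  Substitution of the \<open>z i\<close> for the coordinates is well defined on fractions and injective because the
  \<open>z i\<close> are algebraically independent, and surjective because they generate.
\<close>

lemma exists_cremona:
  fixes z :: "nat \<Rightarrow> 'k::field ratfun"
  assumes z: "free_generators n z"
  obtains s where "s \<in> carrier (cremona n)" "\<And>i. i < n \<Longrightarrow> s (var i) = z i"
proof -
  let ?v = "insertion const z"
  \<comment> \<open>The graph of the substitution; \<open>inj\<close> below shows that it is one of an injective function.\<close>
  define R where "R f v \<longleftrightarrow> (\<exists>P\<in>polys n. \<exists>Q\<in>polys n. Q \<noteq> 0 \<and> f = Fract P Q \<and> v = ?v P / ?v Q)" for f v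
  define s where "s = (\<lambda>f\<in>ratfuns n. THE v. R f v)"
  have nz: "?v Q \<noteq> 0 \<longleftrightarrow> Q \<noteq> 0" if "Q \<in> polys n" for Q
    using z that by (auto simp: free_generators_def alg_indep_def polys_eq_polys_in)
  have inj: "?v P / ?v Q = ?v P' / ?v Q' \<longleftrightarrow> Fract P Q = Fract P' Q'"
    if "P \<in> polys n" "Q \<in> polys n" "Q \<noteq> 0" "P' \<in> polys n" "Q' \<in> polys n" "Q' \<noteq> 0" for P Q P' Q'
  proof -
    have "?v P / ?v Q = ?v P' / ?v Q' \<longleftrightarrow> ?v (P * Q' - P' * Q) = 0"
      using that by (simp add: nz frac_eq_eq const.insertion_diff const.insertion_mult)
    also have "\<dots> \<longleftrightarrow> P * Q' - P' * Q = 0"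
      using nz[of "P * Q' - P' * Q"] that by (auto simp: polys_eq_polys_in polys_in_diff polys_in_mult)
    also have "\<dots> \<longleftrightarrow> Fract P Q = Fract P' Q'"
      using that by (simp add: eq_fract)
    finally show ?thesis .
  qed
  have s_Fract: "s (Fract P Q) = ?v P / ?v Q" if PQ: "P \<in> polys n" "Q \<in> polys n" "Q \<noteq> 0" for P Q
  proof -
    have "R (Fract P Q) (?v P / ?v Q)" unfolding R_def using PQ by blast
    moreover have "v = ?v P / ?v Q" if "R (Fract P Q) v" for v
      using that inj PQ unfolding R_def by metis
    ultimately have "(THE v. R (Fract P Q) v) = ?v P / ?v Q" by (rule the_equality)
    moreover have "Fract P Q \<in> ratfuns n" using PQ by (auto simp: ratfuns_def)
    ultimately show ?thesis by (simp add: s_def)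
  qed
  have ex: "\<exists>P Q. P \<in> polys n \<and> Q \<in> polys n \<and> Q \<noteq> 0 \<and> f = Fract P Q" if "f \<in> ratfuns n" for f :: "'k ratfun"
    using that by (auto simp: ratfuns_def)
  note closed = polys_in_add polys_in_mult
  have "s \<in> carrier (cremona n)"
    unfolding cremona_def
  proof (simp, intro conjI ballI allI)
    have "inj_on s (ratfuns n)"
    proof (rule inj_onI)
      fix f g assume "f \<in> ratfuns n" "g \<in> ratfuns n" "s f = s g"
      then show "f = g" using ex[of f] ex[of g] inj by (auto simp: s_Fract)
    qed
    moreover have "s ` ratfuns n = ratfuns n"
    proof -
      have "s ` ratfuns n = {?v P / ?v Q | P Q. P \<in> polys n \<and> Q \<in> polys n \<and> Q \<noteq> 0}"
        unfolding ratfuns_def using s_Fract by (auto simp: image_iff) metis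
      also have "\<dots> = {?v P / ?v Q | P Q. P \<in> polys n \<and> Q \<in> polys n \<and> ?v Q \<noteq> 0}"
        using nz by blast
      also have "\<dots> = ratfuns n"
        using z unfolding free_generators_def const_adjoin_image polys_eq_polys_in by simp
      finally show ?thesis .
    qed
    ultimately show "s \<in> Bij (ratfuns n)"
      by (auto simp: Bij_def bij_betw_def s_def)
  next
    fix f g :: "'k ratfun" assume "f \<in> ratfuns n" "g \<in> ratfuns n"
    then obtain P Q P' Q' where PQ: "P \<in> polys n" "Q \<in> polys n" "Q \<noteq> 0" "f = Fract P Q"
      "P' \<in> polys n" "Q' \<in> polys n" "Q' \<noteq> 0" "g = Fract P' Q'"
      using ex[of f] ex[of g] by blast
    have "s (f + g) = ?v (P * Q' + P' * Q) / ?v (Q * Q')"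
      using PQ by (simp add: s_Fract polys_eq_polys_in closed)
    then show "s (f + g) = s f + s g"
      using PQ by (simp add: s_Fract const.insertion_add const.insertion_mult add_frac_eq nz)
    have "s (f * g) = ?v (P * P') / ?v (Q * Q')"
      using PQ by (simp add: s_Fract polys_eq_polys_in closed)
    then show "s (f * g) = s f * s g"
      using PQ by (simp add: s_Fract const.insertion_mult)
  next
    fix c show "s (const c) = const c"
      using s_Fract[of "Poly_Mapping.single 0 c" 1]
      by (simp add: polys_eq_polys_in polys_in_const polys_in_1 const_def)
  qed
  moreover have "s (var i) = z i" if "i < n" for i
    using s_Fract[of "mvar i" 1] that
    by (simp add: polys_eq_polys_in polys_in_mvar polys_in_1 var_of_mpoly of_mpoly_def)
  ultimately show thesis by (rule that)
qed

section \<open>Generators of a simple transcendental extension\<close>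

text \<open>
  Division with remainder has to stay inside \<open>polys_over L\<close>; since \<open>L\<close> is a set and not a type, the
  Euclidean algorithm is carried out by hand here and in the next lemma.
\<close>

lemma polys_over_division:
  assumes L: "is_subfield L" and d: "d \<in> polys_over L" "d \<noteq> 0" and p: "p \<in> polys_over L"
  shows "\<exists>q r. q \<in> polys_over L \<and> r \<in> polys_over L \<and> p = q * d + r \<and>
    (r = 0 \<or> Polynomial.degree r < Polynomial.degree d)"
  using p
\<comment> \<open>The zero polynomial has to be smaller than the non-zero constants for the measure to decrease.\<close>
proof (induction "if p = 0 then 0 else Suc (Polynomial.degree p)" arbitrary: p rule: less_induct)
  case less
  show ?case
  proof (cases "p = 0 \<or> Polynomial.degree p < Polynomial.degree d")
    case True
    then show ?thesis
      using less.prems polys_over_0[OF L] by (intro exI[of _ 0] exI[of _ p]) auto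
  next
    case False
    define m where "m = monom (lead_coeff p / lead_coeff d) (Polynomial.degree p - Polynomial.degree d)"
    define p' where "p' = p - m * d"
    have m: "m \<in> polys_over L"
      unfolding m_def using less.prems d
      by (intro polys_over_monom[OF L] subfield_divide[OF L]) (simp_all add: polys_over_def)
    have p': "p' \<in> polys_over L"
      unfolding p'_def by (intro polys_over_intros[OF L] less.prems m d)
    have deg_m: "Polynomial.degree (m * d) = Polynomial.degree p"
      using False d by (simp add: m_def degree_mult_eq degree_monom_eq)
    have "coeff p' (Polynomial.degree p) = 0"
      using False d coeff_degree_mult[of m d]
      by (simp add: p'_def deg_m) (simp add: m_def degree_monom_eq)
    moreover have "Polynomial.degree p' \<le> Polynomial.degree p"
      unfolding p'_def by (rule degree_diff_le) (simp_all add: deg_m)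
    ultimately have "p' = 0 \<or> Polynomial.degree p' < Polynomial.degree p"
      by (metis leading_coeff_0_iff order_le_less)
    then have "(if p' = 0 then 0 else Suc (Polynomial.degree p')) < (if p = 0 then 0 else Suc (Polynomial.degree p))"
      using False by auto
    from less.hyps[OF this p'] obtain q r where "q \<in> polys_over L" "r \<in> polys_over L" "p' = q * d + r"
      "r = 0 \<or> Polynomial.degree r < Polynomial.degree d"
      by blast
    moreover from this have "p = (q + m) * d + r"
      by (simp add: p'_def algebra_simps)
    ultimately show ?thesis using m polys_over_add[OF L] by blast
  qed
qed

lemma polys_over_bezout:
  assumes L: "is_subfield L" and "C \<in> polys_over L" "D \<in> polys_over L" "C \<noteq> 0 \<or> D \<noteq> 0"
  shows "\<exists>h C' D' U V. C' \<in> polys_over L \<and> D' \<in> polys_over L \<and> U \<in> polys_over L \<and> V \<in> polys_over L \<and>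
     h \<noteq> 0 \<and> h = U * C + V * D \<and> C = C' * h \<and> D = D' * h"
  using assms(2-4)
proof (induction "if D = 0 then 0 else Suc (Polynomial.degree D)" arbitrary: C D rule: less_induct)
  case less
  show ?case
  proof (cases "D = 0")
    case True
    then show ?thesis
      using less.prems polys_over_0[OF L] polys_over_1[OF L]
      by (intro exI[of _ C] exI[of _ 1] exI[of _ 0] exI[of _ 1] exI[of _ 0]) simp
  next
    case False
    obtain q r where qr: "q \<in> polys_over L" "r \<in> polys_over L" "C = q * D + r"
      "r = 0 \<or> Polynomial.degree r < Polynomial.degree D"
      using polys_over_division[OF L less.prems(2) False less.prems(1)] by blast
    then have "(if r = 0 then 0 else Suc (Polynomial.degree r)) < (if D = 0 then 0 else Suc (Polynomial.degree D))"
      using False by auto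
    from less.hyps[OF this less.prems(2) qr(2) disjI1[OF False]]
    obtain h D' r' U V where *: "D' \<in> polys_over L" "r' \<in> polys_over L" "U \<in> polys_over L"
      "V \<in> polys_over L" "h \<noteq> 0" "h = U * D + V * r" "D = D' * h" "r = r' * h"
      by blast
    have "h = V * C + (U - V * q) * D"
      using *(6) qr(3) by (simp add: algebra_simps)
    moreover have "C = (q * D' + r') * h"
      using *(7,8) qr(3) by (simp add: algebra_simps)
    moreover have "q * D' + r' \<in> polys_over L" "U - V * q \<in> polys_over L"
      using *(1-4) qr(1) by (auto intro!: polys_over_intros[OF L])
    ultimately show ?thesis using *(1,4,5,7)
      by (intro exI[of _ h] exI[of _ "q * D' + r'"] exI[of _ D'] exI[of _ V] exI[of _ "U - V * q"] conjI)
  qed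
qed

lemma bezout_dvd_cancel:
  fixes C D :: "'a::comm_ring_1"
  assumes "U * C + V * D = 1" "C dvd G * D ^ k" shows "C dvd G"
  using assms(2)
proof (induction k)
  case (Suc k)
  have "G * D ^ k = (G * D ^ k) * (U * C + V * D)" by (simp add: assms(1))
  also have "\<dots> = C * (G * D ^ k * U) + (G * D ^ Suc k) * V" by (simp add: algebra_simps)
  also have "C dvd \<dots>" by (rule dvd_add[OF dvd_triv_left dvd_mult2[OF Suc.prems]])
  finally show ?case by (rule Suc.IH)
qed simp

text \<open>
  If coprime \<open>C\<close>, \<open>D\<close> satisfy a homogeneous relation, then \<open>C\<close> divides the coefficient \<open>G 0\<close>, whose
  degree is too small unless it vanishes; after division by \<open>C\<close> the degree of the relation drops.
\<close>

lemma homogeneous_combination_eq_0: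
  fixes C D :: "'a::field poly"
  assumes CD: "U * C + V * D = 1" "Polynomial.degree C \<ge> 2"
    and "\<And>j. j \<le> m \<Longrightarrow> Polynomial.degree (G j) \<le> 1"
    and "(\<Sum>j\<le>m. G j * C ^ j * D ^ (m - j)) = 0"
  shows "\<forall>j\<le>m. G j = 0"
  using assms(3,4)
proof (induction m arbitrary: G)
  case (Suc m)
  let ?S = "\<Sum>j\<le>m. G (Suc j) * C ^ j * D ^ (m - j)"
  have *: "G 0 * D ^ Suc m + C * ?S = 0"
    using Suc.prems(2) by (simp add: sum.atMost_Suc_shift sum_distrib_left algebra_simps del: sum.atMost_Suc)
  have "G 0 * D ^ Suc m = C * (- ?S)"
    using * by (simp only: mult_minus_right eq_neg_iff_add_eq_0)
  then have "C dvd G 0 * D ^ Suc m" by (simp only: dvd_triv_left)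
  then have "C dvd G 0" by (rule bezout_dvd_cancel[OF CD(1)])
  then have G0: "G 0 = 0"
    using dvd_imp_degree_le[of C "G 0"] CD(2) Suc.prems(1)[of 0] by (cases "G 0 = 0") auto
  have "C \<noteq> 0" using CD(2) by auto
  with G0 * have "?S = 0" by simp
  then have "\<forall>j\<le>m. G (Suc j) = 0"
    using Suc.IH[of "\<lambda>j. G (Suc j)"] Suc.prems(1) by auto
  then show ?case using G0 by (metis Suc_le_mono not0_implies_Suc)
qed simp

lemma poly_eq_sum_atMost:
  fixes p :: "'a::comm_semiring_1 poly"
  assumes "Polynomial.degree p \<le> m" shows "poly p x = (\<Sum>i\<le>m. coeff p i * x ^ i)"
  unfolding poly_altdef
  by (rule sum.mono_neutral_left) (use assms in \<open>auto simp: coeff_eq_0\<close>)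

text \<open>
  This is the description of the automorphisms of \<open>L(z)\<close> over \<open>L\<close>, for a single generator. Write
  \<open>t = C(z) / D(z)\<close> with \<open>C\<close>, \<open>D\<close> coprime and \<open>z = A(t) / B(t)\<close>. The second equation, in the form
  \<open>z B(t) - A(t) = 0\<close> and multiplied by a power of \<open>D(z)\<close>, becomes a homogeneous relation between \<open>C\<close>
  and \<open>D\<close> with coefficients of degree at most one in \<open>z\<close>. As \<open>z\<close> is transcendental, it holds for polynomials, which forces \<open>C\<close> and \<open>D\<close> to have degree at most one.
\<close>

lemma generator_is_moebius:
  fixes L :: "'a::field set"
  assumes L: "is_subfield L" and z: "transcendental_over L z"
    and t: "t \<in> adjoin L {z}" "z \<in> adjoin L {t}"
  obtains a b c d where "a \<in> L" "b \<in> L" "c \<in> L" "d \<in> L" "c * z + d \<noteq> 0" "t * (c * z + d) = a * z + b"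
proof -
  obtain C0 D0 where CD0: "C0 \<in> polys_over L" "D0 \<in> polys_over L" "poly D0 z \<noteq> 0" "t = poly C0 z / poly D0 z"
    using t(1) unfolding adjoin_single[OF L] by blast
  obtain h C D U V where CD: "C \<in> polys_over L" "D \<in> polys_over L" "U \<in> polys_over L" "V \<in> polys_over L"
    "h \<noteq> 0" "h = U * C0 + V * D0" "C0 = C * h" "D0 = D * h"
  proof -
    have "C0 \<noteq> 0 \<or> D0 \<noteq> 0" using CD0(3) by auto
    from polys_over_bezout[OF L CD0(1,2) this] show thesis
      by (elim exE conjE) (rule that)
  qed
  have "h * (U * C + V * D) = h * 1"
    using CD(6) unfolding CD(7,8) by (simp add: algebra_simps)
  then have bez: "U * C + V * D = 1" using CD(5) by simp
  have tD: "poly D z \<noteq> 0" "t * poly D z = poly C z" using CD0(3,4) CD(7,8) by auto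
  obtain A B where AB: "A \<in> polys_over L" "B \<in> polys_over L" "poly B t \<noteq> 0" "z = poly A t / poly B t"
    using t(2) unfolding adjoin_single[OF L] by blast
  define m where "m = max (Polynomial.degree A) (Polynomial.degree B)"
  \<comment> \<open>The coefficients of \<open>z B(t) - A(t)\<close> as a polynomial in \<open>t\<close>.\<close>
  define G where "G j = [:- coeff A j, coeff B j:]" for j
  have "(\<Sum>j\<le>m. poly (G j) z * t ^ j) = z * poly B t - poly A t"
  proof -
    have "poly A t = (\<Sum>j\<le>m. coeff A j * t ^ j)" "poly B t = (\<Sum>j\<le>m. coeff B j * t ^ j)"
      by (rule poly_eq_sum_atMost, simp add: m_def)+
    then show ?thesis
      by (simp add: G_def sum_distrib_left sum_subtractf[symmetric] algebra_simps)
  qed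
  also have "\<dots> = 0" using AB(3,4) by simp
  finally have rel: "(\<Sum>j\<le>m. poly (G j) z * t ^ j) = 0" .
  have "poly (\<Sum>j\<le>m. G j * C ^ j * D ^ (m - j)) z = (\<Sum>j\<le>m. poly D z ^ m * (poly (G j) z * t ^ j))"
    unfolding poly_sum
  proof (rule sum.cong)
    fix j assume "j \<in> {..m}"
    then have "poly D z ^ m = poly D z ^ j * poly D z ^ (m - j)" by (simp flip: power_add)
    then show "poly (G j * C ^ j * D ^ (m - j)) z = poly D z ^ m * (poly (G j) z * t ^ j)"
      by (simp add: tD(2)[symmetric] power_mult_distrib ac_simps)
  qed simp
  also have "\<dots> = 0" using rel by (simp flip: sum_distrib_left)
  finally have "(\<Sum>j\<le>m. G j * C ^ j * D ^ (m - j)) = 0"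
  proof (rule transcendental_overD[OF z, rotated])
    have "G j \<in> polys_over L" for j
      using AB(1,2) L by (auto simp: G_def polys_over_def coeff_pCons subfield_0 subfield_minus split: nat.splits)
    then show "(\<Sum>j\<le>m. G j * C ^ j * D ^ (m - j)) \<in> polys_over L"
      using CD by (intro polys_over_sum polys_over_mult polys_over_power L)
  qed
  moreover have dG: "Polynomial.degree (G j) \<le> 1" for j by (simp add: G_def)
  moreover have nz: "\<not> (\<forall>j\<le>m. G j = 0)"
  proof
    assume "\<forall>j\<le>m. G j = 0"
    then have "\<forall>j\<le>m. coeff B j = 0" by (simp add: G_def)
    then have "poly B t = 0" by (simp add: poly_eq_sum_atMost[of B m] m_def)
    then show False using AB(3) by simp
  qed
  ultimately have "\<not> Polynomial.degree C \<ge> 2"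
    using homogeneous_combination_eq_0[OF bez, of m G] by blast
  moreover have "\<not> Polynomial.degree D \<ge> 2"
  proof
    assume "Polynomial.degree D \<ge> 2"
    \<comment> \<open>The relation is symmetric in \<open>C\<close> and \<open>D\<close>.\<close>
    moreover have "(\<Sum>j\<le>m. G (m - j) * D ^ j * C ^ (m - j)) = (\<Sum>j\<le>m. G j * C ^ j * D ^ (m - j))"
      by (rule sum.reindex_bij_witness[where i = "\<lambda>j. m - j" and j = "\<lambda>j. m - j"]) (auto simp: ac_simps)
    moreover have "V * D + U * C = 1" using bez by (simp add: add.commute)
    ultimately have "\<forall>j\<le>m. G (m - j) = 0"
      using homogeneous_combination_eq_0[of V D U C m "\<lambda>j. G (m - j)"] dG
        \<open>(\<Sum>j\<le>m. G j * C ^ j * D ^ (m - j)) = 0\<close> by simp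
    then show False using nz by (metis diff_diff_cancel diff_le_self)
  qed
  ultimately have deg: "Polynomial.degree C \<le> 1" "Polynomial.degree D \<le> 1" by simp_all
  have "poly C z = coeff C 1 * z + coeff C 0" "poly D z = coeff D 1 * z + coeff D 0"
    using poly_eq_sum_atMost[OF deg(1), of z] poly_eq_sum_atMost[OF deg(2), of z] by simp_all
  then have "coeff D 1 * z + coeff D 0 \<noteq> 0"
    "t * (coeff D 1 * z + coeff D 0) = coeff C 1 * z + coeff C 0"
    using tD by simp_all
  moreover have "coeff C i \<in> L" "coeff D i \<in> L" for i
    using CD(1,2) by (simp_all add: polys_over_def)
  ultimately show thesis using that by blast
qed

section \<open>Linear relations depending polynomially on a parameter\<close>

text \<open>
  With a basis of the \<open>K\<close>-span of the \<open>c i\<close>, a linear relation over \<open>K\<close> between these elements is a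
  linear relation between their coordinate vectors; \<open>C i r\<close> is coordinate \<open>r\<close> of \<open>c i\<close>. The point is
  that the new system of equations has coefficients in \<open>K\<close>. The basis is built up element by element:
  \<open>c j\<close> is either a combination of the earlier ones or a new basis vector.
\<close>

lemma coordinates_over_subfield:
  fixes K :: "'a::field set" and c :: "'i \<Rightarrow> 'a"
  assumes K: "is_subfield K" and "finite I"
  shows "\<exists>(m::nat) C. (\<forall>i\<in>I. \<forall>r<m. C i r \<in> K) \<and>
    (\<forall>l. (\<forall>i\<in>I. l i \<in> K) \<longrightarrow> ((\<Sum>i\<in>I. l i * c i) = 0 \<longleftrightarrow> (\<forall>r<m. (\<Sum>i\<in>I. l i * C i r) = 0)))"
  using assms(2)
proof (induction I rule: finite_induct)
  case empty
  then show ?case by auto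
next
  case (insert j I)
  from insert.IH obtain m :: nat and C where C_ball: "\<forall>i\<in>I. \<forall>r<m. C i r \<in> K"
    and rel_all: "\<forall>l. (\<forall>i\<in>I. l i \<in> K) \<longrightarrow> ((\<Sum>i\<in>I. l i * c i) = 0 \<longleftrightarrow> (\<forall>r<m. (\<Sum>i\<in>I. l i * C i r) = 0))"
    by (elim exE conjE) (rule that)
  note C = C_ball[rule_format] and rel = rel_all[THEN spec, THEN mp]
  show ?case
  proof (cases "\<exists>u. (\<forall>i\<in>I. u i \<in> K) \<and> c j = (\<Sum>i\<in>I. u i * c i)")
    case True
    then obtain u where u: "\<And>i. i \<in> I \<Longrightarrow> u i \<in> K" "c j = (\<Sum>i\<in>I. u i * c i)" by blast
    define C' where "C' = C(j := \<lambda>r. \<Sum>i\<in>I. u i * C i r)"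
    have C'I: "C' i = C i" if "i \<in> I" for i using that insert.hyps by (auto simp: C'_def)
    have "C' i r \<in> K" if "i \<in> insert j I" "r < m" for i r
    proof (cases "i = j")
      case True
      have "(\<Sum>i\<in>I. u i * C i r) \<in> K"
        by (rule subfield_sum[OF K], rule subfield_mult[OF K u(1) C]) (use that in simp_all)
      then show ?thesis by (simp add: C'_def True)
    next
      case False
      then show ?thesis using that C[of i r] by (simp add: C'_def)
    qed
    moreover have "(\<Sum>i\<in>insert j I. l i * c i) = 0 \<longleftrightarrow> (\<forall>r<m. (\<Sum>i\<in>insert j I. l i * C' i r) = 0)"
      if l: "\<forall>i\<in>insert j I. l i \<in> K" for l
    proof -
      have comb: "(\<Sum>i\<in>insert j I. l i * f i) = (\<Sum>i\<in>I. (l i + l j * u i) * f i)"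
        if "f j = (\<Sum>i\<in>I. u i * f i)" for f
        using insert.hyps that by (simp add: distrib_right sum.distrib sum_distrib_left mult.assoc)
      have 1: "(\<Sum>i\<in>insert j I. l i * c i) = (\<Sum>i\<in>I. (l i + l j * u i) * c i)"
        by (rule comb[of c]) (rule u(2))
      have "(\<Sum>i\<in>insert j I. l i * C' i r) = (\<Sum>i\<in>I. (l i + l j * u i) * C' i r)" for r
        by (rule comb[of "\<lambda>i. C' i r"]) (simp add: C'I cong: sum.cong, simp add: C'_def)
      then have 2: "(\<Sum>i\<in>insert j I. l i * C' i r) = (\<Sum>i\<in>I. (l i + l j * u i) * C i r)" for r
        by (simp add: C'I cong: sum.cong)
      show ?thesis
        unfolding 1 2
      proof (intro rel ballI)
        fix i assume "i \<in> I"
        then show "l i + l j * u i \<in> K"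
          using l u(1) by (intro subfield_add[OF K] subfield_mult[OF K]) simp_all
      qed
    qed
    ultimately show ?thesis by blast
  next
    case False
    define C' where "C' i r = (if i = j then if r = m then 1 else 0 else if r = m then 0 else C i r)" for i r
    have "C' i r \<in> K" if "i \<in> insert j I" "r < Suc m" for i r
      using that C[of i r] by (auto simp: C'_def subfield_0[OF K] subfield_1[OF K] less_Suc_eq)
    moreover have "(\<Sum>i\<in>insert j I. l i * c i) = 0 \<longleftrightarrow> (\<forall>r<Suc m. (\<Sum>i\<in>insert j I. l i * C' i r) = 0)"
      if l: "\<forall>i\<in>insert j I. l i \<in> K" for l
    proof -
      have nj: "i \<noteq> j" if "i \<in> I" for i using that insert.hyps by auto
      have "(\<forall>r<Suc m. (\<Sum>i\<in>insert j I. l i * C' i r) = 0) \<longleftrightarrow>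
          l j = 0 \<and> (\<forall>r<m. (\<Sum>i\<in>I. l i * C i r) = 0)"
      proof -
        have "(\<Sum>i\<in>insert j I. l i * C' i m) = l j"
          using insert.hyps by (simp add: C'_def nj cong: sum.cong)
        moreover have "(\<Sum>i\<in>insert j I. l i * C' i r) = (\<Sum>i\<in>I. l i * C i r)" if "r < m" for r
          using insert.hyps that by (simp add: C'_def nj cong: sum.cong)
        ultimately show ?thesis by (auto simp: less_Suc_eq)
      qed
      also have "\<dots> \<longleftrightarrow> l j = 0 \<and> (\<Sum>i\<in>I. l i * c i) = 0"
        using rel[of l] l by auto
      also have "\<dots> \<longleftrightarrow> (\<Sum>i\<in>insert j I. l i * c i) = 0"
      proof
        assume 0: "(\<Sum>i\<in>insert j I. l i * c i) = 0"
        then have s: "l j * c j + (\<Sum>i\<in>I. l i * c i) = 0" using insert.hyps by simp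
        have "l j = 0"
        proof (rule ccontr)
          assume nz: "l j \<noteq> 0"
          have "c j = - (\<Sum>i\<in>I. l i * c i) / l j"
          proof -
            have "l j * c j = - (\<Sum>i\<in>I. l i * c i)"
              using s by (simp only: eq_neg_iff_add_eq_0)
            then show ?thesis using nz by (metis nonzero_mult_div_cancel_left)
          qed
          also have "\<dots> = (\<Sum>i\<in>I. (- l i / l j) * c i)"
            by (simp add: sum_negf sum_divide_distrib)
          finally have "c j = (\<Sum>i\<in>I. (- l i / l j) * c i)" .
          moreover have "- l i / l j \<in> K" if "i \<in> I" for i
            using l that by (intro subfield_intros[OF K]) auto
          ultimately have "\<exists>u. (\<forall>i\<in>I. u i \<in> K) \<and> c j = (\<Sum>i\<in>I. u i * c i)"
            by (intro exI[of _ "\<lambda>i. - l i / l j"]) simp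
          then show False using False by simp
        qed
        then show "l j = 0 \<and> (\<Sum>i\<in>I. l i * c i) = 0" using s by simp
      qed (use insert.hyps in simp)
      finally show ?thesis by simp
    qed
    ultimately show ?thesis by (intro exI[of _ "Suc m"] exI[of _ C']) blast
  qed
qed

text \<open>
  Elimination over the polynomial ring: a row with a non-zero entry in the last column is used to
  clear that column in all other rows, without division. For all but finitely many parameters this
  entry stays non-zero after specialization, so the hypothesis is inherited by the smaller system.
  In the end a specialized system with no unknowns left would have no non-trivial solution.
\<close>

lemma polynomial_kernel:
  fixes L :: "'a::field set" and Rows :: "(nat \<Rightarrow> 'a poly) set"
  assumes L: "is_subfield L"
    and "\<And>\<rho> l. \<rho> \<in> Rows \<Longrightarrow> l < N \<Longrightarrow> \<rho> l \<in> polys_over L"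
    and "infinite S"
    and "\<And>s. s \<in> S \<Longrightarrow> \<exists>x. (\<exists>l<N. x l \<noteq> 0) \<and> (\<forall>\<rho>\<in>Rows. (\<Sum>l<N. poly (\<rho> l) s * x l) = 0)"
  shows "\<exists>X. (\<forall>l<N. X l \<in> polys_over L) \<and> (\<exists>l<N. X l \<noteq> 0) \<and> (\<forall>\<rho>\<in>Rows. (\<Sum>l<N. \<rho> l * X l) = 0)"
  using assms(2-4)
proof (induction N arbitrary: Rows S)
  case 0
  then have "S = {}" by auto
  then show ?case using 0 by simp
next
  case (Suc N)
  show ?case
  proof (cases "\<forall>\<rho>\<in>Rows. \<rho> N = 0")
    case True
    then show ?thesis
      using polys_over_0[OF L] polys_over_1[OF L] by (intro exI[of _ "\<lambda>l. if l = N then 1 else 0"]) auto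
  next
    case False
    then obtain \<rho>0 where \<rho>0: "\<rho>0 \<in> Rows" "\<rho>0 N \<noteq> 0" by blast
    \<comment> \<open>Cross multiplication with the pivot row \<open>\<rho>0\<close> cancels column \<open>N\<close>.\<close>
    define red where "red \<rho> = (\<lambda>l. \<rho>0 N * \<rho> l - \<rho> N * \<rho>0 l)" for \<rho> :: "nat \<Rightarrow> 'a poly"
    define S' where "S' = S - {s. poly (\<rho>0 N) s = 0}"
    have inf: "infinite S'"
      unfolding S'_def using Suc.prems(2) poly_roots_finite[OF \<rho>0(2)] by (rule Diff_infinite_finite[rotated])
    have entries: "\<rho> l \<in> polys_over L" if "\<rho> \<in> red ` Rows" "l < N" for \<rho> l
      using that Suc.prems(1) \<rho>0(1) by (auto simp: red_def intro!: polys_over_intros[OF L])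
    have special: "\<exists>x. (\<exists>l<N. x l \<noteq> 0) \<and> (\<forall>\<rho>\<in>red ` Rows. (\<Sum>l<N. poly (\<rho> l) s * x l) = 0)"
      if s: "s \<in> S'" for s
    proof -
      obtain x where x: "\<exists>l<Suc N. x l \<noteq> 0" "\<And>\<rho>. \<rho> \<in> Rows \<Longrightarrow> (\<Sum>l<N. poly (\<rho> l) s * x l) + poly (\<rho> N) s * x N = 0"
        using Suc.prems(3)[of s] s by (auto simp: S'_def)
      have nz: "poly (\<rho>0 N) s \<noteq> 0" using s by (simp add: S'_def)
      have "\<exists>l<N. x l \<noteq> 0"
      proof (rule ccontr)
        assume z: "\<not> (\<exists>l<N. x l \<noteq> 0)"
        then have "x N = 0" using x(2)[OF \<rho>0(1)] nz by simp
        then show False using x(1) z by (auto simp: less_Suc_eq)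
      qed
      moreover have "(\<Sum>l<N. poly (red \<rho> l) s * x l) = 0" if "\<rho> \<in> Rows" for \<rho>
      proof -
        have "(\<Sum>l<N. poly (red \<rho> l) s * x l) =
          poly (\<rho>0 N) s * (\<Sum>l<N. poly (\<rho> l) s * x l) - poly (\<rho> N) s * (\<Sum>l<N. poly (\<rho>0 l) s * x l)"
          by (simp add: red_def sum_distrib_left sum_subtractf left_diff_distrib mult.assoc)
        also have "(\<Sum>l<N. poly (\<rho> l) s * x l) = - (poly (\<rho> N) s * x N)"
          using x(2)[OF that] by (simp add: eq_neg_iff_add_eq_0)
        also have "(\<Sum>l<N. poly (\<rho>0 l) s * x l) = - (poly (\<rho>0 N) s * x N)"
          using x(2)[OF \<rho>0(1)] by (simp add: eq_neg_iff_add_eq_0)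
        finally show ?thesis by simp
      qed
      ultimately show ?thesis by blast
    qed
    have "\<exists>X. (\<forall>l<N. X l \<in> polys_over L) \<and> (\<exists>l<N. X l \<noteq> 0) \<and>
        (\<forall>\<rho>\<in>red ` Rows. (\<Sum>l<N. \<rho> l * X l) = 0)"
    proof (rule Suc.IH[where S = S'])
      show "\<rho> l \<in> polys_over L" if "\<rho> \<in> red ` Rows" "l < N" for \<rho> l
        using that by (rule entries)
      show "\<exists>x. (\<exists>l<N. x l \<noteq> 0) \<and> (\<forall>\<rho>\<in>red ` Rows. (\<Sum>l<N. poly (\<rho> l) s * x l) = 0)"
        if "s \<in> S'" for s using that by (rule special)
    qed (rule inf)
    then obtain Y where Y0: "\<forall>l<N. Y l \<in> polys_over L" "\<exists>l<N. Y l \<noteq> 0"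
      "\<forall>\<rho>\<in>red ` Rows. (\<Sum>l<N. \<rho> l * Y l) = 0"
      by blast
    then have Y: "\<And>l. l < N \<Longrightarrow> Y l \<in> polys_over L" "\<exists>l<N. Y l \<noteq> 0"
      "\<And>\<rho>. \<rho> \<in> Rows \<Longrightarrow> (\<Sum>l<N. red \<rho> l * Y l) = 0"
      by simp_all
    \<comment> \<open>Back substitution for the last unknown, with everything multiplied by the pivot.\<close>
    define X where "X l = (if l < N then \<rho>0 N * Y l else - (\<Sum>l<N. \<rho>0 l * Y l))" for l
    have "X l \<in> polys_over L" if "l < Suc N" for l
      using that Suc.prems(1) \<rho>0(1) Y(1) polys_over_sum[OF L]
      by (auto simp: X_def intro!: polys_over_intros[OF L] polys_over_sum[OF L])
    moreover have "\<exists>l<Suc N. X l \<noteq> 0"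
      using Y(2) \<rho>0(2) by (metis X_def less_SucI mult_eq_0_iff)
    moreover have "(\<Sum>l<Suc N. \<rho> l * X l) = 0" if "\<rho> \<in> Rows" for \<rho>
    proof -
      have "(\<Sum>l<Suc N. \<rho> l * X l) = (\<Sum>l<N. red \<rho> l * Y l)"
        by (simp add: X_def red_def sum_distrib_left sum_subtractf[symmetric] algebra_simps)
      then show ?thesis using Y(3)[OF that] by simp
    qed
    ultimately show ?thesis by blast
  qed
qed

text \<open>
  Taking coordinates over \<open>L\<close> of the coefficients of the \<open>e l\<close> turns the relation at \<open>s\<close> into a homogeneous
  linear system whose entries lie in \<open>L[s]\<close>, to which \<open>polynomial_kernel\<close> applies. The relation obtained
  holds at infinitely many parameters and is therefore an identity of polynomials.
\<close>

lemma polynomial_relation: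
  fixes L :: "'a::field set" and e :: "nat \<Rightarrow> 'a poly"
  assumes L: "is_subfield L" and S: "infinite S" "S \<subseteq> L"
    and x: "\<And>s. s \<in> S \<Longrightarrow> \<exists>x. (\<forall>l<N. x l \<in> L) \<and> (\<exists>l<N. x l \<noteq> 0) \<and> (\<Sum>l<N. x l * poly (e l) s) = 0"
  shows "\<exists>X. (\<forall>l<N. X l \<in> polys_over L) \<and> (\<exists>l<N. X l \<noteq> 0) \<and> (\<Sum>l<N. X l * e l) = 0"
proof -
  obtain D where D: "\<And>l. l < N \<Longrightarrow> Polynomial.degree (e l) \<le> D"
  proof
    show "Polynomial.degree (e l) \<le> (\<Sum>l<N. Polynomial.degree (e l))" if "l < N" for l
      using that by (intro member_le_sum) auto
  qed
  let ?I = "{..<N} \<times> {..D}"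
  have "finite ?I" by simp
  from coordinates_over_subfield[OF L this, of "\<lambda>i. coeff (e (fst i)) (snd i)"]
  obtain m :: nat and C where C_ball: "\<forall>i\<in>?I. \<forall>r<m. C i r \<in> L"
    and rel_all: "\<forall>u. (\<forall>i\<in>?I. u i \<in> L) \<longrightarrow>
      ((\<Sum>i\<in>?I. u i * coeff (e (fst i)) (snd i)) = 0 \<longleftrightarrow> (\<forall>r<m. (\<Sum>i\<in>?I. u i * C i r) = 0))"
    by blast
  note C = C_ball[rule_format] and rel = rel_all[THEN spec, THEN mp]
  \<comment> \<open>The part of \<open>e l\<close> in direction \<open>r\<close> of a basis over \<open>L\<close>, a polynomial over \<open>L\<close>.\<close>
  define \<rho> where "\<rho> r l = (\<Sum>i\<le>D. monom (C (l, i) r) i)" for r l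
  have poly_e: "(\<Sum>i\<in>?I. (x (fst i) * s ^ snd i) * coeff (e (fst i)) (snd i)) = (\<Sum>l<N. x l * poly (e l) s)" for x s
  proof -
    have "(\<Sum>l<N. x l * poly (e l) s) = (\<Sum>l<N. \<Sum>i\<le>D. (x l * s ^ i) * coeff (e l) i)"
    proof (rule sum.cong)
      fix l assume "l \<in> {..<N}"
      then have "poly (e l) s = (\<Sum>i\<le>D. coeff (e l) i * s ^ i)"
        by (intro poly_eq_sum_atMost D) simp
      then show "x l * poly (e l) s = (\<Sum>i\<le>D. (x l * s ^ i) * coeff (e l) i)"
        by (simp add: sum_distrib_left ac_simps)
    qed simp
    then show ?thesis by (simp add: sum.cartesian_product case_prod_unfold)
  qed
  have poly_\<rho>: "(\<Sum>i\<in>?I. (x (fst i) * s ^ snd i) * C i r) = (\<Sum>l<N. poly (\<rho> r l) s * x l)" for x s r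
  proof -
    have "(\<Sum>l<N. poly (\<rho> r l) s * x l) = (\<Sum>l<N. \<Sum>i\<le>D. (x l * s ^ i) * C (l, i) r)"
      by (simp add: \<rho>_def poly_sum poly_monom sum_distrib_left ac_simps)
    then show ?thesis by (simp add: sum.cartesian_product case_prod_unfold)
  qed
  have equiv: "(\<Sum>l<N. x l * poly (e l) s) = 0 \<longleftrightarrow> (\<forall>r<m. (\<Sum>l<N. poly (\<rho> r l) s * x l) = 0)"
    if "\<forall>l<N. x l \<in> L" "s \<in> S" for x s
    unfolding poly_e[symmetric] poly_\<rho>[symmetric]
    using that S(2) by (intro rel) (auto intro!: subfield_intros[OF L])
  have "\<exists>X. (\<forall>l<N. X l \<in> polys_over L) \<and> (\<exists>l<N. X l \<noteq> 0) \<and> (\<forall>\<rho>'\<in>\<rho> ` {..<m}. (\<Sum>l<N. \<rho>' l * X l) = 0)"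
  proof (rule polynomial_kernel[OF L _ S(1)])
    show "\<rho>' l \<in> polys_over L" if "\<rho>' \<in> \<rho> ` {..<m}" "l < N" for \<rho>' l
      using that C by (auto simp: \<rho>_def intro!: polys_over_sum[OF L] polys_over_monom[OF L])
    show "\<exists>x. (\<exists>l<N. x l \<noteq> 0) \<and> (\<forall>\<rho>'\<in>\<rho> ` {..<m}. (\<Sum>l<N. poly (\<rho>' l) s * x l) = 0)" if "s \<in> S" for s
      using x[OF that] equiv[OF _ that] by auto
  qed
  then obtain X where X: "\<And>l. l < N \<Longrightarrow> X l \<in> polys_over L" "\<exists>l<N. X l \<noteq> 0"
    "\<And>r. r < m \<Longrightarrow> (\<Sum>l<N. \<rho> r l * X l) = 0" by auto
  have "poly (\<Sum>l<N. X l * e l) s = 0" if s: "s \<in> S" for s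
  proof -
    have "(\<Sum>l<N. poly (X l) s * poly (e l) s) = 0"
    proof (subst equiv[OF _ s])
      show "\<forall>l<N. poly (X l) s \<in> L" using X(1) s S(2) by (auto intro!: poly_in_subfield[OF L])
      show "\<forall>r<m. (\<Sum>l<N. poly (\<rho> r l) s * poly (X l) s) = 0"
        using X(3) by (simp flip: poly_mult poly_sum)
    qed
    then show ?thesis by (simp add: poly_sum)
  qed
  then have "S \<subseteq> {s. poly (\<Sum>l<N. X l * e l) s = 0}" by blast
  then have "(\<Sum>l<N. X l * e l) = 0"
    using S(1) by (intro poly_infinite_zero) (rule infinite_super)
  then show ?thesis using X by blast
qed

section \<open>Automorphisms of a simple transcendental extension\<close>

text \<open>
  Reversing the coefficients of a polynomial that vanishes at \<open>inverse z\<close> gives one that vanishes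
  at \<open>z\<close>.
\<close>

lemma transcendental_over_inverse:
  assumes z: "transcendental_over L z" and L: "is_subfield L"
  shows "transcendental_over L (inverse z)"
  unfolding transcendental_over_def
proof (intro allI impI)
  fix p assume p: "(\<forall>i. coeff p i \<in> L) \<and> poly p (inverse z) = 0"
  have "z \<noteq> 0"
    using transcendental_overD[OF z, of "[:0, 1:]"] subfield_closed[OF L] polys_over_0[OF L] by auto
  then have "poly (reflect_poly p) z = 0"
    using p by (simp add: poly_reflect_poly_nz)
  moreover have "reflect_poly p \<in> polys_over L"
    using p subfield_0[OF L] by (simp add: polys_over_def coeff_reflect_poly)
  ultimately have "reflect_poly p = 0" by (intro transcendental_overD[OF z])
  then show "p = 0" by simp
qed

lemma transcendental_over_linear:
  assumes z: "transcendental_over L z" and L: "is_subfield L" and ab: "a \<in> L" "b \<in> L" "a * z + b = 0"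
  shows "a = 0 \<and> b = 0"
proof -
  have "[:b, a:] = 0"
    using ab by (intro transcendental_overD[OF z]) (simp_all add: polys_over_0[OF L] add.commute mult.commute)
  then show ?thesis by simp
qed

lemma transcendental_over_notin:
  assumes z: "transcendental_over L z" and L: "is_subfield L" shows "z \<notin> L"
proof
  assume "z \<in> L"
  then show False
    using transcendental_over_linear[OF z L subfield_1[OF L] subfield_minus[OF L]] by force
qed

text \<open>
  If \<open>c \<noteq> 0\<close>, then \<open>y\<close> arises from \<open>z\<close> by affine maps and one inversion, all of which preserve
  transcendence. The fraction can be solved for \<open>z\<close>, since a singular coefficient matrix would make
  \<open>y\<close> an element of \<open>L\<close>.
\<close>

lemma moebius_generator:
  assumes L: "is_subfield L" and z: "transcendental_over L z"
    and mem: "a \<in> L" "b \<in> L" "c \<in> L" "d \<in> L" and nz: "c * z + d \<noteq> 0"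
    and y: "y = (a * z + b) / (c * z + d)" "y \<notin> L"
  shows "transcendental_over L y \<and> adjoin L {y} = adjoin L {z}"
proof
  have yz: "y * (c * z + d) = a * z + b" using nz y(1) by simp
  show "transcendental_over L y"
  proof (cases "c = 0")
    case True
    have "d \<noteq> 0" using nz True by simp
    have "y = (a / d) * z + b / d" using y(1) True by (simp add: add_divide_distrib)
    moreover have "a / d \<noteq> 0"
    proof
      assume "a / d = 0"
      then have "a = 0" using \<open>d \<noteq> 0\<close> by simp
      then have "y = b / d" using y(1) True by simp
      then show False using y(2) subfield_divide[OF L mem(2,4)] by simp
    qed
    ultimately show ?thesis
      using transcendental_over_affine[OF L z subfield_divide[OF L mem(1,4)] subfield_divide[OF L mem(2,4)]]
      by simp
  next
    case False
    \<comment> \<open>\<open>a z + b = (a / c) (c z + d) + e\<close>, so that \<open>y = a / c + e / (c z + d)\<close>.\<close>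
    define e where "e = b - a * d / c"
    have e: "e \<in> L" unfolding e_def using mem by (intro subfield_intros[OF L])
    have "(a / c) * (c * z + d) = a * z + a * d / c" using False by (simp add: distrib_left)
    then have "a * z + b = (a / c) * (c * z + d) + e" by (simp add: e_def)
    then have "y = ((a / c) * (c * z + d) + e) / (c * z + d)" using y(1) by simp
    also have "\<dots> = e / (c * z + d) + a / c" using nz by (simp add: add_divide_distrib)
    finally have eq: "y = e * inverse (c * z + d) + a / c" by (simp add: divide_inverse[of e])
    have "e \<noteq> 0"
    proof
      assume "e = 0"
      then have "y = a / c" using eq by simp
      then show False using y(2) subfield_divide[OF L mem(1,3)] by simp
    qed
    moreover have "transcendental_over L (inverse (c * z + d))"
      by (intro transcendental_over_inverse transcendental_over_affine L z mem False)
    ultimately show ?thesis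
      unfolding eq using e subfield_divide[OF L mem(1,3)] by (intro transcendental_over_affine L)
  qed
  have z_in: "z \<in> adjoin L {z}" and y_in: "y \<in> adjoin L {y}" and
    Lz: "l \<in> L \<Longrightarrow> l \<in> adjoin L {z}" and Ly: "l \<in> L \<Longrightarrow> l \<in> adjoin L {y}" for l
    using adjoin_superset[of "{z}" L] adjoin_superset[of "{y}" L] by auto
  have "y \<in> adjoin L {z}"
    unfolding y(1) using mem by (intro subfield_intros[OF subfield_adjoin] z_in Lz)
  then have 1: "adjoin L {y} \<subseteq> adjoin L {z}"
    by (intro adjoin_least subfield_adjoin) (use Lz in auto)
  have "a - y * c \<noteq> 0"
  proof
    assume 0: "a - y * c = 0"
    show False
    proof (cases "c = 0")
      case True
      then have "y = b / d" using 0 y(1) by simp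
      then show False using y(2) subfield_divide[OF L mem(2,4)] by simp
    next
      case False
      then have "y = a / c" using 0 by (simp add: eq_divide_eq)
      then show False using y(2) subfield_divide[OF L mem(1,3)] by simp
    qed
  qed
  moreover have "z * (a - y * c) = y * d - b" using yz by (simp add: algebra_simps)
  ultimately have "z = (y * d - b) / (a - y * c)" by (simp add: eq_divide_eq)
  also have "\<dots> \<in> adjoin L {y}"
    using mem by (intro subfield_intros[OF subfield_adjoin] y_in Ly)
  finally have "z \<in> adjoin L {y}" .
  then have "adjoin L {z} \<subseteq> adjoin L {y}"
    by (intro adjoin_least subfield_adjoin) (use Ly in auto)
  then show "adjoin L {y} = adjoin L {z}" using 1 by simp
qed

text \<open>
  Elements of the Cremona group are determined only on rational functions in \<open>n\<close> variables, so the
  homomorphism laws are assumed on \<open>K\<close> alone.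
\<close>

locale tower_automorphism =
  fixes K L :: "'k::field ratfun set" and \<rho> :: "'k ratfun \<Rightarrow> 'k ratfun"
  assumes K: "is_subfield K" and L: "is_subfield L" and LK: "L \<subseteq> K" and const_L: "const c \<in> L"
    and add: "a \<in> K \<Longrightarrow> b \<in> K \<Longrightarrow> \<rho> (a + b) = \<rho> a + \<rho> b"
    and mult: "a \<in> K \<Longrightarrow> b \<in> K \<Longrightarrow> \<rho> (a * b) = \<rho> a * \<rho> b"
    and const: "\<rho> (const c) = const c"
    and image_K: "\<rho> ` K = K" and image_L: "\<rho> ` L = L"
begin

lemma mem_K: "a \<in> K \<Longrightarrow> \<rho> a \<in> K" and mem_L: "a \<in> L \<Longrightarrow> \<rho> a \<in> L"
  using image_K image_L by blast+

lemma zero: "\<rho> 0 = 0" and one: "\<rho> 1 = 1"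
  using const[of 0] const[of 1] by simp_all

lemma uminus: "a \<in> K \<Longrightarrow> \<rho> (- a) = - \<rho> a"
  using add[of a "- a"] subfield_minus[OF K] by (simp add: zero eq_neg_iff_add_eq_0 add.commute)

lemma inverse: "a \<in> K \<Longrightarrow> \<rho> (inverse a) = inverse (\<rho> a)"
proof (cases "a = 0")
  case False
  assume a: "a \<in> K"
  have "\<rho> a * \<rho> (inverse a) = 1"
    using mult[OF a subfield_inverse[OF K a]] False by (simp add: one)
  then show ?thesis by (metis inverse_unique)
qed (simp add: zero)

lemma divide: "a \<in> K \<Longrightarrow> b \<in> K \<Longrightarrow> \<rho> (a / b) = \<rho> a / \<rho> b"
  by (simp add: divide_inverse mult inverse subfield_inverse[OF K])

lemma eq_0_iff: "a \<in> K \<Longrightarrow> \<rho> a = 0 \<longleftrightarrow> a = 0"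
proof
  assume a: "a \<in> K" "\<rho> a = 0"
  show "a = 0"
  proof (rule ccontr)
    assume "a \<noteq> 0"
    then have "\<rho> (a * inverse a) = 1" by (simp add: one)
    then show False using a mult[OF a(1) subfield_inverse[OF K a(1)]] by simp
  qed
qed (simp add: zero)

lemma notin_L: assumes "a \<in> K" "a \<notin> L" shows "\<rho> a \<notin> L"
proof
  assume "\<rho> a \<in> L"
  then obtain l where l: "l \<in> L" "\<rho> a = \<rho> l" using image_L by blast
  have "\<rho> (a + - l) = 0"
    using l LK assms(1) subfield_minus[OF K] by (subst add) (auto simp: uminus)
  then have "a + - l = 0"
    using l LK assms(1) subfield_diff[OF K] by (subst (asm) eq_0_iff) auto
  then show False using l assms(2) by simp
qed

lemma poly: "p \<in> polys_over K \<Longrightarrow> x \<in> K \<Longrightarrow> \<rho> (poly p x) = poly (map_poly \<rho> p) (\<rho> x)"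
  by (rule map_poly_hom[where K = K])
    (auto simp: zero add mult polys_over_def subfield_closed[OF K])

lemma map_poly_over: "p \<in> polys_over L \<Longrightarrow> map_poly \<rho> p \<in> polys_over L"
  by (simp add: polys_over_def coeff_map_poly zero mem_L)

lemma moebius:
  assumes z: "transcendental_over L z" "K = adjoin L {z}"
  obtains a b c d where "a \<in> L" "b \<in> L" "c \<in> L" "d \<in> L" "c * z + d \<noteq> 0" "\<rho> z * (c * z + d) = a * z + b"
proof (rule generator_is_moebius[OF L z(1)])
  have zK: "z \<in> K" using adjoin_superset[of "{z}" L] z(2) by simp
  show "\<rho> z \<in> adjoin L {z}" using mem_K[OF zK] z(2) by simp
  obtain y where y: "y \<in> K" "z = \<rho> y" using image_K zK by blast
  obtain A B where AB: "A \<in> polys_over L" "B \<in> polys_over L" "y = poly A z / poly B z" "poly B z \<noteq> 0"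
    using y(1) unfolding z(2) adjoin_single[OF L] by blast
  have K_over: "A \<in> polys_over K" "B \<in> polys_over K"
    by (rule polys_over_mono[OF LK AB(1)], rule polys_over_mono[OF LK AB(2)])
  have "z = poly (map_poly \<rho> A) (\<rho> z) / poly (map_poly \<rho> B) (\<rho> z)"
  proof -
    have "z = \<rho> (poly A z / poly B z)" by (rule trans[OF y(2) arg_cong[OF AB(3), of \<rho>]])
    also have "\<dots> = \<rho> (poly A z) / \<rho> (poly B z)"
      by (rule divide[OF poly_in_subfield[OF K K_over(1) zK] poly_in_subfield[OF K K_over(2) zK]])
    finally show ?thesis by (simp only: poly[OF K_over(1) zK] poly[OF K_over(2) zK])
  qed
  moreover have "poly (map_poly \<rho> B) (\<rho> z) \<noteq> 0"
    using eq_0_iff[OF poly_in_subfield[OF K K_over(2) zK]] AB(4) poly[OF K_over(2) zK] by simp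
  ultimately show "z \<in> adjoin L {\<rho> z}"
    unfolding adjoin_single[OF L] using map_poly_over[OF AB(1)] map_poly_over[OF AB(2)] by blast
qed

end

lemma MOST_poly_nonzero_inj:
  fixes p :: "'a::idom poly"
  assumes "p \<noteq> 0" "inj f" shows "MOST s. poly p (f s) \<noteq> 0"
proof -
  have "finite (f -` {x. poly p x = 0})"
    using poly_roots_finite[OF assms(1)] assms(2) by (rule finite_vimageI)
  then show ?thesis by (simp add: MOST_iff_cofinite vimage_def)
qed

lemma MOST_poly_nonzero:
  fixes p :: "'k::field ratfun poly"
  assumes "p \<noteq> 0" shows "MOST s. poly p (const s) \<noteq> 0"
  using assms by (rule MOST_poly_nonzero_inj) (simp add: inj_def)

lemma MOST_False: "\<not> (MOST s::'k::alg_closed_field. False)"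
  using infinite_alg_closed by (simp add: MOST_iff_cofinite)

lemma poly_MOST_eqI:
  fixes p q :: "'k::alg_closed_field ratfun poly"
  assumes "MOST s. poly p (const s) = poly q (const s)" shows "p = q"
proof (rule ccontr)
  assume "p \<noteq> q"
  then have "MOST s. poly (p - q) (const s) \<noteq> 0" by (intro MOST_poly_nonzero) simp
  with assms have "MOST s::'k. False" by eventually_elim simp
  then show False using MOST_False by blast
qed

lemma poly_MOST_0I:
  fixes p :: "'k::alg_closed_field ratfun poly"
  assumes "MOST s. poly p (const s) = 0" shows "p = 0"
  by (rule poly_MOST_eqI) (use assms in simp)

text \<open>
  If the two denominators were not proportional over \<open>L\<close>, the two equations could be solved for \<open>t\<close>
  and for \<open>t * z\<close> as linear polynomials in \<open>z\<close>. Comparing them gives a quadratic relation for \<open>z\<close>, whose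
  leading coefficient must vanish, so \<open>t\<close> would lie in \<open>L\<close>.
\<close>

lemma moebius_unique:
  assumes z: "transcendental_over L z" and L: "is_subfield L" and t: "t \<notin> L"
    and mem: "a \<in> L" "b \<in> L" "c \<in> L" "d \<in> L" "a' \<in> L" "b' \<in> L" "c' \<in> L" "d' \<in> L"
    and eq: "t * (c * z + d) = a * z + b" "t * (c' * z + d') = a' * z + b'"
  shows "c * d' = c' * d"
proof (rule ccontr)
  assume ne: "c * d' \<noteq> c' * d"
  define e where "e = c * d' - c' * d"
  define f where "f = a * c' - a' * c"
  define g where "g = b * c' - b' * c"
  define f' where "f' = a * d' - a' * d"
  define g' where "g' = b * d' - b' * d"
  have memb: "e \<in> L" "f \<in> L" "g \<in> L" "f' \<in> L" "g' \<in> L"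
    unfolding e_def f_def g_def f'_def g'_def using mem by (intro subfield_intros[OF L]; simp)+
  have "- e * t = c' * (t * (c * z + d)) - c * (t * (c' * z + d'))"
    by (simp add: e_def algebra_simps)
  also have "\<dots> = f * z + g" unfolding eq by (simp add: f_def g_def algebra_simps)
  finally have 1: "- e * t = f * z + g" .
  have "e * t * z = d' * (t * (c * z + d)) - d * (t * (c' * z + d'))"
    by (simp add: e_def algebra_simps)
  also have "\<dots> = f' * z + g'" unfolding eq by (simp add: f'_def g'_def algebra_simps)
  finally have 2: "e * t * z = f' * z + g'" .
  have "poly [:g', f' + g, f:] z = (f * z + g) * z + (f' * z + g')"
    by (simp add: algebra_simps)
  also have "\<dots> = 0" using 2 unfolding 1[symmetric] by simp
  finally have "[:g', f' + g, f:] = 0"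
    using memb by (intro transcendental_overD[OF z]) (simp_all add: polys_over_0[OF L] subfield_add[OF L])
  then have "f = 0" by simp
  then have "g = - (e * t)" using 1 by simp
  moreover have "e \<noteq> 0" using ne by (simp add: e_def)
  ultimately have "t = - g / e" by simp
  also have "\<dots> \<in> L" using memb by (intro subfield_intros[OF L])
  finally show False using t by simp
qed

section \<open>Rational one-parameter groups have semi-invariant generators\<close>

text \<open>
  The least number of coefficients that suffices to write down the polynomial: unlike the degree it
  separates zero from the constants.
\<close>

definition poly_length :: "'a::zero poly \<Rightarrow> nat" where
  "poly_length p = (if p = 0 then 0 else Suc (Polynomial.degree p))"

lemma poly_length_le_iff: "poly_length p \<le> m \<longleftrightarrow> (\<forall>i\<ge>m. coeff p i = 0)"
proof (cases "p = 0")
  case False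
  show ?thesis
  proof
    assume "poly_length p \<le> m"
    then show "\<forall>i\<ge>m. coeff p i = 0"
      using False by (auto simp: poly_length_def intro!: coeff_eq_0)
  next
    assume "\<forall>i\<ge>m. coeff p i = 0"
    then show "poly_length p \<le> m"
      using False by (simp add: poly_length_def Suc_le_eq) (metis leading_coeff_0_iff not_less)
  qed
qed (simp add: poly_length_def)

lemma coeff_mult_degree_bound:
  fixes p q :: "'a::comm_semiring_0 poly"
  assumes "Polynomial.degree p \<le> m" "Polynomial.degree q \<le> n"
  shows "coeff (p * q) (m + n) = coeff p m * coeff q n"
proof -
  have "coeff (p * q) (m + n) = (\<Sum>i\<le>m + n. if i = m then coeff p m * coeff q n else 0)"
    unfolding coeff_mult
  proof (rule sum.cong)
    fix i
    consider "i < m" | "i = m" | "i > m" by linarith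
    then show "coeff p i * coeff q (m + n - i) = (if i = m then coeff p m * coeff q n else 0)"
      using assms by cases (simp_all add: coeff_eq_0)
  qed simp
  then show ?thesis by simp
qed

text \<open>
  A family \<open>\<sigma>\<close> of automorphisms of \<open>L(z)\<close> such that \<open>\<sigma> s z\<close> is a rational function of \<open>s\<close>. The family of
  interest is a one-parameter group; its group law enters through the relation between \<open>\<rho> (\<sigma> s z)\<close> and
  \<open>\<sigma> (\<kappa> * s) z\<close> for automorphisms \<open>\<rho>\<close>, on which the theorem at the end of the section rests.
\<close>

locale one_parameter_extension =
  fixes L :: "'k::alg_closed_field ratfun set" and z :: "'k ratfun"
    and \<sigma> :: "'k \<Rightarrow> 'k ratfun \<Rightarrow> 'k ratfun"
  assumes L: "is_subfield L" and const_L: "range const \<subseteq> L"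
    and z: "transcendental_over L z"
    and aut: "s \<noteq> 0 \<Longrightarrow> tower_automorphism (adjoin L {z}) L (\<sigma> s)"
    and rational: "\<exists>p q. q \<noteq> 0 \<and> (MOST s. \<sigma> s z * poly q (const s) = poly p (const s))"
begin

abbreviation K where "K \<equiv> adjoin L {z}"

lemma K: "is_subfield K" and LK: "L \<subseteq> K" and z_K: "z \<in> K"
  using adjoin_superset[of "{z}" L] subfield_adjoin by auto

lemma z_notin: "z \<notin> L"
  by (rule transcendental_over_notin[OF z L])

text \<open>
  \<open>rel a b c d\<close> expresses \<open>\<sigma> s z\<close> as the fraction \<open>(a z + b) / (c z + d)\<close> with coefficients in \<open>L[s]\<close>.
  The denominator is multiplied out, so that such relations can be subtracted from each other.
\<close>

definition rel where
  "rel a b c d \<longleftrightarrow> a \<in> polys_over L \<and> b \<in> polys_over L \<and> c \<in> polys_over L \<and> d \<in> polys_over L \<and>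
    (MOST s. \<sigma> s z * (poly c (const s) * z + poly d (const s)) = poly a (const s) * z + poly b (const s))"

lemma poly_const_in_L: "p \<in> polys_over L \<Longrightarrow> poly p (const s) \<in> L"
  using const_L by (intro poly_in_subfield[OF L]) auto

lemma rel_smult_diff:
  assumes "rel a b c d" "rel a' b' c' d'" "e \<in> L"
  shows "rel (a' - smult e a) (b' - smult e b) (c' - smult e c) (d' - smult e d)"
proof -
  have "MOST s. \<sigma> s z * (poly c (const s) * z + poly d (const s)) = poly a (const s) * z + poly b (const s)"
    "MOST s. \<sigma> s z * (poly c' (const s) * z + poly d' (const s)) = poly a' (const s) * z + poly b' (const s)"
    using assms(1,2) by (auto simp: rel_def)
  then have "MOST s. \<sigma> s z * (poly (c' - smult e c) (const s) * z + poly (d' - smult e d) (const s)) =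
      poly (a' - smult e a) (const s) * z + poly (b' - smult e b) (const s)"
  proof eventually_elim
    case (elim s)
    have "\<sigma> s z * (poly (c' - smult e c) (const s) * z + poly (d' - smult e d) (const s)) =
      \<sigma> s z * (poly c' (const s) * z + poly d' (const s)) - e * (\<sigma> s z * (poly c (const s) * z + poly d (const s)))"
      by (simp add: algebra_simps)
    then show ?case unfolding elim by (simp add: algebra_simps)
  qed
  moreover have "p' - smult e p \<in> polys_over L" if "p \<in> polys_over L" "p' \<in> polys_over L" for p p'
    using that assms(3) by (intro polys_over_diff[OF L] polys_over_smult[OF L])
  ultimately show ?thesis
    using assms(1,2) unfolding rel_def by (intro conjI) simp_all
qed

lemma rel_denominator_0:
  assumes "rel a b 0 0" shows "a = 0 \<and> b = 0"
proof -
  have ab: "a \<in> polys_over L" "b \<in> polys_over L"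
    and rel: "MOST s. \<sigma> s z * (poly 0 (const s) * z + poly 0 (const s)) = poly a (const s) * z + poly b (const s)"
    using assms by (simp_all only: rel_def)
  from rel have "MOST s. poly a (const s) * z + poly b (const s) = 0"
    by eventually_elim simp
  then have "MOST s. poly a (const s) = 0 \<and> poly b (const s) = 0"
    by (elim eventually_mono)
      (rule transcendental_over_linear[OF z L poly_const_in_L[OF ab(1)] poly_const_in_L[OF ab(2)]])
  then show ?thesis
    using poly_MOST_0I[of a] poly_MOST_0I[of b] by (simp add: eventually_conj_iff)
qed

text \<open>
  For each parameter \<open>s\<close> there are coefficients in \<open>L\<close>, and they satisfy a linear equation whose own
  coefficients depend polynomially on \<open>s\<close>, because \<open>\<sigma> s z\<close> does up to a denominator. Hence they can be
  chosen to depend polynomially on \<open>s\<close> as well.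
\<close>

lemma rel_exists: "\<exists>a b c d. rel a b c d \<and> (c \<noteq> 0 \<or> d \<noteq> 0)"
proof -
  obtain p q where q: "q \<noteq> 0" and pq: "MOST s. \<sigma> s z * poly q (const s) = poly p (const s)"
    using rational by blast
  \<comment> \<open>With \<open>\<sigma> s z = p(s) / q(s)\<close>, the coefficients satisfy
    \<open>- a z q(s) - b q(s) + c z p(s) + d p(s) = 0\<close>.\<close>
  define e where "e = (\<lambda>l::nat. [- smult z q, - q, smult z p, p] ! l)"
  define S where "S = const ` {s. s \<noteq> 0 \<and> \<sigma> s z * poly q (const s) = poly p (const s)}"
  have sum4: "(\<Sum>l<4::nat. f l) = f 0 + f 1 + f 2 + f 3" for f :: "nat \<Rightarrow> 'x::comm_monoid_add"
    by (simp add: eval_nat_numeral ac_simps)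
  have "\<exists>X. (\<forall>l<4. X l \<in> polys_over L) \<and> (\<exists>l<4. X l \<noteq> 0) \<and> (\<Sum>l<4. X l * e l) = 0"
  proof (rule polynomial_relation[OF L])
    have "finite {s. \<not> (s \<noteq> 0 \<and> \<sigma> s z * poly q (const s) = poly p (const s))}"
    proof -
      have "MOST s. s \<noteq> 0 \<and> \<sigma> s z * poly q (const s) = poly p (const s)"
        using pq by (intro eventually_conj) simp_all
      then show ?thesis by (simp only: MOST_iff_cofinite)
    qed
    then have "infinite {s. s \<noteq> 0 \<and> \<sigma> s z * poly q (const s) = poly p (const s)}"
      using infinite_alg_closed finite_Collect_not by blast
    then show "infinite S"
      unfolding S_def by (subst finite_image_iff) (auto simp: inj_on_def)
    show "S \<subseteq> L" using const_L by (auto simp: S_def)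
    fix x assume "x \<in> S"
    then obtain s where s: "x = const s" "s \<noteq> 0" "\<sigma> s z * poly q (const s) = poly p (const s)"
      by (auto simp: S_def)
    interpret tower_automorphism K L "\<sigma> s" by (rule aut[OF s(2)])
    obtain a b c d where m: "a \<in> L" "b \<in> L" "c \<in> L" "d \<in> L" "c * z + d \<noteq> 0"
      "\<sigma> s z * (c * z + d) = a * z + b"
      by (rule moebius[OF z refl]) blast
    let ?X = "\<lambda>l::nat. [a, b, c, d] ! l"
    have "(\<Sum>l<4. ?X l * poly (e l) x) =
        (\<sigma> s z * poly q x) * (c * z + d) - poly q x * (a * z + b)"
      unfolding sum4 by (simp add: e_def s(1) s(3)[symmetric] algebra_simps)
    also have "\<dots> = 0" unfolding m(6)[symmetric] by simp
    finally have "(\<Sum>l<4. ?X l * poly (e l) x) = 0" .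
    moreover have "\<forall>l<4. ?X l \<in> L" using m(1-4) by (simp add: eval_nat_numeral less_Suc_eq)
    moreover have "\<exists>l<4. ?X l \<noteq> 0"
    proof (cases "c = 0")
      case True
      then have "?X 3 \<noteq> 0" using m(5) by simp
      then show ?thesis by (intro exI[of _ 3]) simp
    next
      case False
      then have "?X 2 \<noteq> 0" by simp
      then show ?thesis by (intro exI[of _ 2]) simp
    qed
    ultimately show "\<exists>X. (\<forall>l<4. X l \<in> L) \<and> (\<exists>l<4. X l \<noteq> 0) \<and> (\<Sum>l<4. X l * poly (e l) x) = 0"
      by blast
  qed
  then obtain X where X: "\<forall>l<4. X l \<in> polys_over L" "\<exists>l<4. X l \<noteq> 0" "(\<Sum>l<4. X l * e l) = 0" by blast
  have Xi: "X 0 \<in> polys_over L" "X 1 \<in> polys_over L" "X 2 \<in> polys_over L" "X 3 \<in> polys_over L"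
    using X(1) by simp_all
  have E: "smult z (X 2 * p) + X 3 * p = smult z (X 0 * q) + X 1 * q"
    using X(3) unfolding sum4 by (simp add: e_def algebra_simps eq_neg_iff_add_eq_0)
  have "MOST s. poly q (const s) \<noteq> 0" by (rule MOST_poly_nonzero[OF q])
  with pq have "MOST s. \<sigma> s z * (poly (X 2) (const s) * z + poly (X 3) (const s)) =
      poly (X 0) (const s) * z + poly (X 1) (const s)"
  proof eventually_elim
    case (elim s)
    have "poly q (const s) * (\<sigma> s z * (poly (X 2) (const s) * z + poly (X 3) (const s))) =
        poly (smult z (X 2 * p) + X 3 * p) (const s)"
      by (simp add: elim(1)[symmetric] algebra_simps)
    also have "\<dots> = poly q (const s) * (poly (X 0) (const s) * z + poly (X 1) (const s))"
      unfolding E by (simp add: algebra_simps)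
    finally show ?case using elim(2) by simp
  qed
  then have rel: "rel (X 0) (X 1) (X 2) (X 3)" using Xi by (simp add: rel_def)
  moreover have "X 2 \<noteq> 0 \<or> X 3 \<noteq> 0"
  proof (rule ccontr)
    assume 0: "\<not> (X 2 \<noteq> 0 \<or> X 3 \<noteq> 0)"
    then have "X 0 = 0 \<and> X 1 = 0" using rel_denominator_0[of "X 0" "X 1"] rel by simp
    then show False using X(2) 0 by (auto simp: eval_nat_numeral less_Suc_eq)
  qed
  ultimately show ?thesis by blast
qed

text \<open>
  By \<open>moebius_unique\<close> the denominators of two relations are proportional for almost all \<open>s\<close>, so their
  coefficients of index \<open>N\<close> are proportional over \<open>L\<close>. Subtracting a multiple of the first relation from
  the second then removes these coefficients, and minimality leaves nothing of the difference.
\<close>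

lemma rel_unique:
  assumes rel: "rel a b c d" and nz: "c \<noteq> 0 \<or> d \<noteq> 0"
    and len: "poly_length c \<le> Suc N" "poly_length d \<le> Suc N"
    and minimal: "\<And>a' b' c' d'. rel a' b' c' d' \<Longrightarrow> c' \<noteq> 0 \<or> d' \<noteq> 0 \<Longrightarrow>
        \<not> (poly_length c' \<le> N \<and> poly_length d' \<le> N)"
    and rel': "rel a' b' c' d'" "poly_length c' \<le> Suc N" "poly_length d' \<le> Suc N"
  obtains e where "e \<in> L" "a' = smult e a" "b' = smult e b" "c' = smult e c" "d' = smult e d"
proof -
  have in_L: "a \<in> polys_over L" "b \<in> polys_over L" "c \<in> polys_over L" "d \<in> polys_over L"
    "a' \<in> polys_over L" "b' \<in> polys_over L" "c' \<in> polys_over L" "d' \<in> polys_over L"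
    using rel rel'(1) by (simp_all add: rel_def)
  have "MOST s. s \<noteq> 0 \<and> \<sigma> s z * (poly c (const s) * z + poly d (const s)) = poly a (const s) * z + poly b (const s) \<and>
     \<sigma> s z * (poly c' (const s) * z + poly d' (const s)) = poly a' (const s) * z + poly b' (const s)"
    using rel rel'(1) by (auto simp: rel_def eventually_conj_iff)
  then have "MOST s. poly (c * d') (const s) = poly (c' * d) (const s)"
  proof (rule eventually_mono)
    fix s
    assume s: "s \<noteq> 0 \<and> \<sigma> s z * (poly c (const s) * z + poly d (const s)) = poly a (const s) * z + poly b (const s) \<and>
     \<sigma> s z * (poly c' (const s) * z + poly d' (const s)) = poly a' (const s) * z + poly b' (const s)"
    then interpret tower_automorphism K L "\<sigma> s" by (intro aut) simp
    have "\<sigma> s z \<notin> L" by (rule notin_L[OF z_K z_notin])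
    then have "poly c (const s) * poly d' (const s) = poly c' (const s) * poly d (const s)"
      using s by (intro moebius_unique[OF z L, of "\<sigma> s z" "poly a (const s)" "poly b (const s)" _ _ "poly a' (const s)" "poly b' (const s)"]
          poly_const_in_L in_L) simp_all
    then show "poly (c * d') (const s) = poly (c' * d) (const s)" by simp
  qed
  then have proportional: "c * d' = c' * d" by (rule poly_MOST_eqI)
  have top: "coeff c N \<noteq> 0 \<or> coeff d N \<noteq> 0"
  proof (rule ccontr)
    assume "\<not> (coeff c N \<noteq> 0 \<or> coeff d N \<noteq> 0)"
    then have "poly_length c \<le> N" "poly_length d \<le> N"
      using len unfolding poly_length_le_iff by (auto simp: not_less_eq_eq[symmetric] le_less_Suc_eq) (metis le_antisym not_less_eq_eq)+
    then show False using minimal[OF rel nz] by simp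
  qed
  have short: "poly_length (p' - smult e p) \<le> N"
    if "poly_length p \<le> Suc N" "poly_length p' \<le> Suc N" "coeff p' N = e * coeff p N"
    for e and p p' :: "'k ratfun poly"
    unfolding poly_length_le_iff
  proof (intro allI impI)
    fix i assume "N \<le> i"
    then consider "i = N" | "Suc N \<le> i" by linarith
    then show "coeff (p' - smult e p) i = 0"
      using that unfolding poly_length_le_iff by cases simp_all
  qed
  obtain e where e: "e \<in> L" "coeff c' N = e * coeff c N" "coeff d' N = e * coeff d N"
  proof -
    have mem: "coeff c N \<in> L" "coeff d N \<in> L" "coeff c' N \<in> L" "coeff d' N \<in> L"
      using in_L by (simp_all add: polys_over_def)
    have deg: "Polynomial.degree p \<le> N" if "poly_length p \<le> Suc N" for p :: "'k ratfun poly"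
      using that by (auto simp: poly_length_def split: if_splits)
    \<comment> \<open>Index \<open>N + N\<close> is the highest at which \<open>c * d'\<close> and \<open>c' * d\<close> can have a coefficient.\<close>
    have "coeff (c * d') (N + N) = coeff c N * coeff d' N" "coeff (c' * d) (N + N) = coeff c' N * coeff d N"
      using coeff_mult_degree_bound[of c N d' N] coeff_mult_degree_bound[of c' N d N] deg len rel' by simp_all
    then have cross: "coeff c N * coeff d' N = coeff c' N * coeff d N" using proportional by simp
    show thesis
    proof (cases "coeff c N = 0")
      case False
      then show thesis
        using cross mem by (intro that[of "coeff c' N / coeff c N"] subfield_divide[OF L]) (simp_all add: field_simps)
    next
      case True
      then have "coeff d N \<noteq> 0" using top by simp
      then show thesis
        using cross mem True by (intro that[of "coeff d' N / coeff d N"] subfield_divide[OF L]) simp_all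
    qed
  qed
  have rel'': "rel (a' - smult e a) (b' - smult e b) (c' - smult e c) (d' - smult e d)"
    by (rule rel_smult_diff[OF rel rel'(1) e(1)])
  then have 0: "c' - smult e c = 0 \<and> d' - smult e d = 0"
    using minimal[OF rel''] short[OF len(1) rel'(2) e(2)] short[OF len(2) rel'(3) e(3)] by blast
  then have "a' - smult e a = 0 \<and> b' - smult e b = 0"
    using rel_denominator_0[of "a' - smult e a" "b' - smult e b"] rel'' by simp
  with 0 show thesis using that[OF e(1)] by simp
qed

end

context one_parameter_extension
begin

text \<open>
  Apply \<open>\<rho>\<close> to the equation \<open>\<sigma> s z * (c z + d) = a z + b\<close>. On the left \<open>\<rho> (\<sigma> s z)\<close> is
  \<open>\<epsilon> * \<sigma> (\<kappa> * s) z\<close>, and \<open>\<rho> z\<close> is a fraction \<open>(\<alpha> z + \<beta>) / (\<gamma> z + \<delta>)\<close>. Multiplying by its denominator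
  \<open>w = \<gamma> z + \<delta>\<close> and replacing \<open>s\<close> by \<open>s / \<kappa>\<close> results in a relation again, with coefficients of no higher
  degree.
\<close>

lemma rel_transform:
  assumes rel: "rel a b c d" and \<rho>: "tower_automorphism K L \<rho>" and nz: "\<epsilon> \<noteq> 0" "\<kappa> \<noteq> 0"
    and comm: "MOST s. \<rho> (\<sigma> s z) = const \<epsilon> * \<sigma> (\<kappa> * s) z"
  obtains w a' b' c' d' where "w \<noteq> 0" "rel a' b' c' d'"
    "\<And>i. w * \<rho> (coeff a i * z + coeff b i) = const \<kappa> ^ i * (coeff a' i * z + coeff b' i)"
    "\<And>i. const \<epsilon> * (w * \<rho> (coeff c i * z + coeff d i)) = const \<kappa> ^ i * (coeff c' i * z + coeff d' i)"
    "\<And>i. coeff c i = 0 \<Longrightarrow> coeff d i = 0 \<Longrightarrow> coeff c' i = 0 \<and> coeff d' i = 0"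
proof -
  interpret \<rho>: tower_automorphism K L \<rho> by (rule \<rho>)
  obtain \<alpha> \<beta> \<gamma> \<delta> where m: "\<alpha> \<in> L" "\<beta> \<in> L" "\<gamma> \<in> L" "\<delta> \<in> L" "\<gamma> * z + \<delta> \<noteq> 0"
    "\<rho> z * (\<gamma> * z + \<delta>) = \<alpha> * z + \<beta>"
    by (rule \<rho>.moebius[OF z refl]) blast
  define w where "w = \<gamma> * z + \<delta>"
  have w: "w \<noteq> 0" "\<rho> z * w = \<alpha> * z + \<beta>" using m by (simp_all add: w_def)
  define R where "R = map_poly \<rho>"
  \<comment> \<open>The substitution of \<open>s / \<kappa>\<close> for \<open>s\<close>.\<close>
  define sc where "sc p = pcompose p [:0, const (inverse \<kappa>):]" for p
  have in_L: "a \<in> polys_over L" "b \<in> polys_over L" "c \<in> polys_over L" "d \<in> polys_over L"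
    using rel by (simp_all add: rel_def)
  have coeff_L: "coeff p i \<in> L" if "p \<in> polys_over L" for p i using that by (simp add: polys_over_def)
  have coeff_K: "coeff p i \<in> K" if "p \<in> polys_over L" for p i using coeff_L[OF that] LK by blast
  have R_L: "R p \<in> polys_over L" if "p \<in> polys_over L" for p
    unfolding R_def by (rule \<rho>.map_poly_over[OF that])
  have sc_L: "sc p \<in> polys_over L" if "p \<in> polys_over L" for p
    unfolding sc_def using that const_L
    by (intro polys_over_pcompose[OF L]) (auto simp: subfield_0[OF L] polys_over_0[OF L])
  have coeff_R: "coeff (R p) i = \<rho> (coeff p i)" for p i
    by (simp add: R_def coeff_map_poly \<rho>.zero)
  have coeff_sc: "coeff (sc p) i = const (inverse \<kappa>) ^ i * coeff p i" for p i
    by (simp add: sc_def coeff_pcompose_linear)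
  have poly_R: "\<rho> (poly p (const s)) = poly (R p) (const s)" if "p \<in> polys_over L" for p s
  proof -
    have "p \<in> polys_over K" "const s \<in> K"
      using polys_over_mono[OF LK that] const_L LK by auto
    from \<rho>.poly[OF this] show ?thesis by (simp add: R_def \<rho>.const)
  qed
  have poly_sc: "poly (sc p) (const (\<kappa> * s)) = poly p (const s)" for p s
  proof -
    have "inverse \<kappa> * (\<kappa> * s) = s" using nz by simp
    then have "const (\<kappa> * s) * const (inverse \<kappa>) = const s"
      by (simp only: const_mult[symmetric] mult.commute)
    then show ?thesis by (simp add: sc_def poly_pcompose)
  qed
  define a' where "a' = sc (smult \<alpha> (R a) + smult \<gamma> (R b))"
  define b' where "b' = sc (smult \<beta> (R a) + smult \<delta> (R b))"
  define c' where "c' = smult (const \<epsilon>) (sc (smult \<alpha> (R c) + smult \<gamma> (R d)))"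
  define d' where "d' = smult (const \<epsilon>) (sc (smult \<beta> (R c) + smult \<delta> (R d)))"
  have in_L': "a' \<in> polys_over L" "b' \<in> polys_over L" "c' \<in> polys_over L" "d' \<in> polys_over L"
    unfolding a'_def b'_def c'_def d'_def
    by (intro polys_over_smult[OF L] polys_over_add[OF L] sc_L R_L in_L m(1-4) subsetD[OF const_L] rangeI)+
  let ?Q = "\<lambda>t. \<sigma> t z * (poly c' (const t) * z + poly d' (const t)) = poly a' (const t) * z + poly b' (const t)"
  have "MOST s. \<sigma> s z * (poly c (const s) * z + poly d (const s)) = poly a (const s) * z + poly b (const s)"
    using rel by (simp add: rel_def)
  moreover have "MOST s::'k. s \<noteq> 0" by simp
  ultimately have "MOST s. ?Q (\<kappa> * s)"
    using comm
  proof eventually_elim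
    case (elim s)
    have mem: "poly p (const s) \<in> K" if "p \<in> polys_over L" for p
      using poly_const_in_L[OF that] LK by blast
    have lin: "\<rho> (poly p (const s) * z + poly q (const s)) = poly (R p) (const s) * \<rho> z + poly (R q) (const s)"
      if "p \<in> polys_over L" "q \<in> polys_over L" for p q
      using that mem z_K subfield_mult[OF K]
      by (subst \<rho>.add) (auto simp: \<rho>.mult poly_R)
    have \<sigma>K: "\<sigma> s z \<in> K"
      by (rule tower_automorphism.mem_K[OF aut[OF elim(2)] z_K])
    have "const \<epsilon> * \<sigma> (\<kappa> * s) z * (poly (R c) (const s) * \<rho> z + poly (R d) (const s)) =
        \<rho> (\<sigma> s z * (poly c (const s) * z + poly d (const s)))"
      using \<sigma>K mem in_L z_K by (subst \<rho>.mult) (auto simp: lin elim(3) intro!: subfield_add[OF K] subfield_mult[OF K])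
    also have "\<dots> = poly (R a) (const s) * \<rho> z + poly (R b) (const s)"
      unfolding elim(1) by (rule lin[OF in_L(1,2)])
    finally have E: "const \<epsilon> * \<sigma> (\<kappa> * s) z * (poly (R c) (const s) * \<rho> z + poly (R d) (const s)) =
        poly (R a) (const s) * \<rho> z + poly (R b) (const s)" .
    have swap: "(x * \<rho> z + y) * w = x * (\<alpha> * z + \<beta>) + y * (\<gamma> * z + \<delta>)" for x y
      by (simp add: distrib_right mult.assoc w(2)) (simp add: w_def)
    have "const \<epsilon> * \<sigma> (\<kappa> * s) z * ((poly (R c) (const s) * \<rho> z + poly (R d) (const s)) * w) =
        (poly (R a) (const s) * \<rho> z + poly (R b) (const s)) * w"
      using E by (simp only: mult.assoc[symmetric])
    then show ?case
      unfolding swap a'_def b'_def c'_def d'_def by (simp add: poly_sc algebra_simps)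
  qed
  then have "MOST t. ?Q (\<kappa> * (inverse \<kappa> * t))"
    by (rule MOST_inj) (use nz in \<open>auto simp: inj_def\<close>)
  then have "MOST t. ?Q t"
    using nz by (simp add: mult.assoc[symmetric])
  then have "rel a' b' c' d'" using in_L' by (simp add: rel_def)
  moreover have "w * \<rho> (coeff a i * z + coeff b i) = const \<kappa> ^ i * (coeff a' i * z + coeff b' i)"
    and "const \<epsilon> * (w * \<rho> (coeff c i * z + coeff d i)) = const \<kappa> ^ i * (coeff c' i * z + coeff d' i)" for i
  proof -
    have lin: "w * \<rho> (coeff p i * z + coeff q i) =
        \<rho> (coeff p i) * (\<alpha> * z + \<beta>) + \<rho> (coeff q i) * (\<gamma> * z + \<delta>)"
      if "p \<in> polys_over L" "q \<in> polys_over L" for p q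
    proof -
      have "\<rho> (coeff p i * z + coeff q i) = \<rho> (coeff p i) * \<rho> z + \<rho> (coeff q i)"
        using coeff_K[OF that(1)] coeff_K[OF that(2)] z_K subfield_mult[OF K]
        by (subst \<rho>.add) (auto simp: \<rho>.mult)
      then have "w * \<rho> (coeff p i * z + coeff q i) = \<rho> (coeff p i) * (\<rho> z * w) + \<rho> (coeff q i) * w"
        by (simp add: algebra_simps)
      then show ?thesis unfolding w(2) by (simp add: w_def)
    qed
    have k: "const \<kappa> ^ i * const (inverse \<kappa>) ^ i = 1"
      using nz by (simp flip: power_mult_distrib const_mult)
    have k': "const \<kappa> ^ i * (const (inverse \<kappa>) ^ i * x) = x" for x
      using k by (simp flip: mult.assoc)
    have "const \<kappa> ^ i * (coeff a' i * z + coeff b' i) =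
        const \<kappa> ^ i * (const (inverse \<kappa>) ^ i * (\<rho> (coeff a i) * (\<alpha> * z + \<beta>) + \<rho> (coeff b i) * (\<gamma> * z + \<delta>)))"
      by (simp add: a'_def b'_def coeff_sc coeff_R algebra_simps)
    then show "w * \<rho> (coeff a i * z + coeff b i) = const \<kappa> ^ i * (coeff a' i * z + coeff b' i)"
      unfolding k' lin[OF in_L(1,2)] by simp
    have "const \<kappa> ^ i * (coeff c' i * z + coeff d' i) =
        const \<kappa> ^ i * (const (inverse \<kappa>) ^ i * (const \<epsilon> *
          (\<rho> (coeff c i) * (\<alpha> * z + \<beta>) + \<rho> (coeff d i) * (\<gamma> * z + \<delta>))))"
      by (simp add: c'_def d'_def coeff_sc coeff_R algebra_simps)
    then show "const \<epsilon> * (w * \<rho> (coeff c i * z + coeff d i)) = const \<kappa> ^ i * (coeff c' i * z + coeff d' i)"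
      unfolding k' lin[OF in_L(3,4)] by simp
  qed
  moreover have "coeff c' i = 0 \<and> coeff d' i = 0" if "coeff c i = 0" "coeff d i = 0" for i
    using that by (simp add: c'_def d'_def coeff_sc coeff_R \<rho>.zero)
  ultimately show thesis using w(1) by (rule that[rotated])
qed

text \<open>
  Take a relation whose denominator has least length. By \<open>rel_transform\<close> and \<open>rel_unique\<close>, \<open>\<rho>\<close> multiplies
  all coefficients of the polynomials \<open>a z + b\<close> and \<open>c z + d\<close> in \<open>s\<close> by the same element of \<open>K\<close>, apart
  from powers of \<open>\<kappa>\<close> and a factor \<open>\<epsilon>\<close> between numerator and denominator. So their quotients by a fixed
  one of them, \<open>v\<close>, are multiplied by scalars. If all quotients were in \<open>L\<close>, then so would be
  \<open>\<sigma> s z\<close>, hence \<open>z\<close>; one outside \<open>L\<close> is the generator. Its weight does not depend on \<open>\<rho>\<close>: the exponent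
  \<open>e\<close> comes from its position in the polynomial, and \<open>j\<close> tells numerator from denominator.
\<close>

theorem semi_invariant_generator:
  obtains y e j where "transcendental_over L y" "adjoin L {y} = K"
    "\<And>\<rho> \<epsilon> \<kappa>. tower_automorphism K L \<rho> \<Longrightarrow> \<epsilon> \<noteq> 0 \<Longrightarrow> \<kappa> \<noteq> 0 \<Longrightarrow>
       (MOST s. \<rho> (\<sigma> s z) = const \<epsilon> * \<sigma> (\<kappa> * s) z) \<Longrightarrow> \<rho> y = const (\<kappa> powi e * \<epsilon> ^ j) * y"
proof -
  define Q where "Q m \<longleftrightarrow> (\<exists>a b c d. rel a b c d \<and> (c \<noteq> 0 \<or> d \<noteq> 0) \<and>
    poly_length c \<le> m \<and> poly_length d \<le> m)" for m
  obtain a0 b0 c0 d0 where "rel a0 b0 c0 d0" "c0 \<noteq> 0 \<or> d0 \<noteq> 0" using rel_exists by blast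
  then have "Q (max (poly_length c0) (poly_length d0))" unfolding Q_def by (metis max.cobounded1 max.cobounded2)
  then have least: "Q (LEAST m. Q m)" by (rule LeastI)
  moreover have "\<not> Q 0"
  proof
    assume "Q 0"
    then obtain c d :: "'k ratfun poly" where "c \<noteq> 0 \<or> d \<noteq> 0" "poly_length c \<le> 0" "poly_length d \<le> 0"
      unfolding Q_def by blast
    then show False by (auto simp: poly_length_def split: if_splits)
  qed
  ultimately obtain N where N: "(LEAST m. Q m) = Suc N" by (metis not0_implies_Suc)
  have "\<not> Q N" by (rule not_less_Least) (simp add: N)
  then have minimal: "\<not> (poly_length c' \<le> N \<and> poly_length d' \<le> N)"
    if "rel a' b' c' d'" "c' \<noteq> 0 \<or> d' \<noteq> 0" for a' b' c' d'
    using that unfolding Q_def by blast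
  have "Q (Suc N)" using least by (simp only: N)
  then obtain a b c d where rel: "rel a b c d" and nz: "c \<noteq> 0 \<or> d \<noteq> 0"
    and len: "poly_length c \<le> Suc N" "poly_length d \<le> Suc N"
    unfolding Q_def by blast
  have in_L: "a \<in> polys_over L" "b \<in> polys_over L" "c \<in> polys_over L" "d \<in> polys_over L"
    using rel by (simp_all add: rel_def)
  have coeff_L: "coeff p i \<in> L" if "p \<in> polys_over L" for p i using that by (simp add: polys_over_def)
  have coeff_K: "coeff p i \<in> K" if "p \<in> polys_over L" for p i using coeff_L[OF that] LK by blast
  have lin_K: "coeff p i * z + coeff q j \<in> K" if "p \<in> polys_over L" "q \<in> polys_over L" for p q i j
    using coeff_K[OF that(1)] coeff_K[OF that(2)] z_K by (intro subfield_add[OF K] subfield_mult[OF K])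
  define v where "v = coeff c N * z + coeff d N"
  have v: "v \<noteq> 0"
  proof
    assume "v = 0"
    then have 0: "coeff c N = 0" "coeff d N = 0"
      using transcendental_over_linear[OF z L coeff_L[OF in_L(3)] coeff_L[OF in_L(4)]] by (auto simp: v_def)
    have "poly_length p \<le> N" if "poly_length p \<le> Suc N" "coeff p N = 0" for p :: "'k ratfun poly"
      using that unfolding poly_length_le_iff by (metis le_antisym not_less_eq_eq)
    then show False using minimal[OF rel nz] len 0 by blast
  qed
  define P where "P = smult (inverse v) (smult z a + b)"
  define P' where "P' = smult (inverse v) (smult z c + d)"
  have coeff_P: "coeff P i = (coeff a i * z + coeff b i) / v"
    and coeff_P': "coeff P' i = (coeff c i * z + coeff d i) / v" for i
    by (simp_all add: P_def P'_def divide_inverse mult.commute)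
  have transform: "\<rho> (coeff P i) = const (\<kappa> powi (int i - int N) * \<epsilon> ^ 1) * coeff P i"
    "\<rho> (coeff P' i) = const (\<kappa> powi (int i - int N) * \<epsilon> ^ 0) * coeff P' i"
    if \<rho>: "tower_automorphism K L \<rho>" and ek: "\<epsilon> \<noteq> 0" "\<kappa> \<noteq> 0"
      and comm: "MOST s. \<rho> (\<sigma> s z) = const \<epsilon> * \<sigma> (\<kappa> * s) z" for \<rho> \<epsilon> \<kappa> i
  proof -
    interpret \<rho>: tower_automorphism K L \<rho> by (rule \<rho>)
    obtain w a' b' c' d' where w: "w \<noteq> 0" "rel a' b' c' d'"
      and num: "\<And>i. w * \<rho> (coeff a i * z + coeff b i) = const \<kappa> ^ i * (coeff a' i * z + coeff b' i)"
      and den: "\<And>i. const \<epsilon> * (w * \<rho> (coeff c i * z + coeff d i)) = const \<kappa> ^ i * (coeff c' i * z + coeff d' i)"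
      and deg: "\<And>i. coeff c i = 0 \<Longrightarrow> coeff d i = 0 \<Longrightarrow> coeff c' i = 0 \<and> coeff d' i = 0"
      by (rule rel_transform[OF rel \<rho> ek comm]) blast
    have len': "poly_length c' \<le> Suc N" "poly_length d' \<le> Suc N"
      using len deg unfolding poly_length_le_iff by blast+
    obtain h where h: "a' = smult h a" "b' = smult h b" "c' = smult h c" "d' = smult h d"
    proof (rule rel_unique[OF rel nz len _ w(2) len'])
      show "\<not> (poly_length c' \<le> N \<and> poly_length d' \<le> N)"
        if "rel a' b' c' d'" "c' \<noteq> 0 \<or> d' \<noteq> 0" for a' b' c' d'
        using that by (rule minimal)
    qed (rule that)
    let ?k = "const \<kappa>" and ?e = "const \<epsilon>"
    have nz': "?k \<noteq> 0" "?e \<noteq> 0" using ek by simp_all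
    have num': "w * \<rho> (coeff a i * z + coeff b i) = ?k ^ i * h * (coeff a i * z + coeff b i)"
      and den': "?e * (w * \<rho> (coeff c i * z + coeff d i)) = ?k ^ i * h * (coeff c i * z + coeff d i)" for i
      unfolding num den h by (simp_all add: algebra_simps)
    have vN: "?e * (w * \<rho> v) = ?k ^ N * h * v" unfolding v_def by (rule den')
    have vK: "v \<in> K" unfolding v_def by (rule lin_K[OF in_L(3,4)])
    have \<rho>v: "\<rho> v \<noteq> 0" using v \<rho>.eq_0_iff[OF vK] by simp
    then have h0: "h \<noteq> 0" using vN w(1) nz' by auto
    have quot: "\<rho> (x / v) = ?k powi (int i - int N) * c' * (x / v)"
      if "x \<in> K" "w * \<rho> x = ?k ^ i * h * c' * x / ?e" for x c'
    proof -
      have "w * \<rho> v = ?k ^ N * h * v / ?e" using vN nz' by (simp add: eq_divide_eq mult.commute)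
      moreover have "\<rho> (x / v) = (w * \<rho> x) / (w * \<rho> v)"
        using \<rho>.divide[OF that(1) vK] w(1) by simp
      ultimately have "\<rho> (x / v) = (?k ^ i / ?k ^ N) * c' * (x / v)"
        using that(2) h0 nz' v by (simp add: field_simps)
      then show ?thesis using nz' by (simp add: power_int_diff)
    qed
    show "\<rho> (coeff P i) = const (\<kappa> powi (int i - int N) * \<epsilon> ^ 1) * coeff P i"
      unfolding coeff_P
      using quot[of "coeff a i * z + coeff b i" ?e] num'[of i] nz' lin_K[OF in_L(1,2)]
      by (simp add: const_mult const_power_int)
    have "w * \<rho> (coeff c i * z + coeff d i) = ?k ^ i * h * 1 * (coeff c i * z + coeff d i) / ?e"
      using den'[of i] nz' by (simp add: eq_divide_eq mult.commute)
    then show "\<rho> (coeff P' i) = const (\<kappa> powi (int i - int N) * \<epsilon> ^ 0) * coeff P' i"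
      unfolding coeff_P'
      using quot[of "coeff c i * z + coeff d i" 1] lin_K[OF in_L(3,4)]
      by (simp add: const_mult const_power_int)
  qed
  have "\<not> (P \<in> polys_over L \<and> P' \<in> polys_over L)"
  proof
    assume PL: "P \<in> polys_over L \<and> P' \<in> polys_over L"
    have "coeff P' N = 1" using v by (simp add: coeff_P' v_def)
    then have "P' \<noteq> 0" by auto
    then have "MOST s. poly P' (const s) \<noteq> 0" by (rule MOST_poly_nonzero)
    moreover have "MOST s. \<sigma> s z * (poly c (const s) * z + poly d (const s)) = poly a (const s) * z + poly b (const s)"
      using rel by (simp add: rel_def)
    moreover have "MOST s::'k. s \<noteq> 0" by simp
    ultimately have "MOST s::'k. False"
    proof eventually_elim
      case (elim s)
      interpret s: tower_automorphism K L "\<sigma> s" by (rule aut[OF elim(3)])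
      have "poly P (const s) = inverse v * (poly a (const s) * z + poly b (const s))"
        "poly P' (const s) = inverse v * (poly c (const s) * z + poly d (const s))"
        by (simp_all add: P_def P'_def mult.commute)
      then have "\<sigma> s z * poly P' (const s) = poly P (const s)"
        by (simp only: elim(2)[symmetric] mult.left_commute)
      then have "\<sigma> s z = poly P (const s) / poly P' (const s)" using elim(1) by (simp add: eq_divide_eq)
      also have "\<dots> \<in> L" using PL by (intro subfield_divide[OF L] poly_const_in_L) simp_all
      finally show ?case using s.notin_L[OF z_K z_notin] by simp
    qed
    then show False using MOST_False by blast
  qed
  then consider i where "coeff P i \<notin> L" | i where "coeff P' i \<notin> L"
    by (auto simp: polys_over_def)
  then show thesis
  proof cases
    case 1
    have "transcendental_over L (coeff P i) \<and> adjoin L {coeff P i} = K"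
      by (rule moebius_generator[OF L z coeff_L[OF in_L(1)] coeff_L[OF in_L(2)] coeff_L[OF in_L(3)] coeff_L[OF in_L(4)]])
        (use v 1 in \<open>simp_all add: coeff_P v_def\<close>)
    then show thesis using transform(1) by (intro that[of "coeff P i"]) blast+
  next
    case 2
    have "transcendental_over L (coeff P' i) \<and> adjoin L {coeff P' i} = K"
      by (rule moebius_generator[OF L z coeff_L[OF in_L(3)] coeff_L[OF in_L(4)] coeff_L[OF in_L(3)] coeff_L[OF in_L(4)]])
        (use v 2 in \<open>simp_all add: coeff_P' v_def\<close>)
    then show thesis using transform(2) by (intro that[of "coeff P' i"]) blast+
  qed
qed

end

section \<open>Rational actions of tori restrict to rational one-parameter groups\<close>

lemma carrier_torus: "carrier (torus d) = {..<d} \<rightarrow>\<^sub>E {c. c \<noteq> 0}"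
  by (simp add: torus_def Gm_def)

lemma mult_torus: "t \<otimes>\<^bsub>torus d\<^esub> u = (\<lambda>i\<in>{..<d}. t i * u i)"
  by (simp add: torus_def Gm_def)

definition cocharacter :: "nat \<Rightarrow> nat \<Rightarrow> 'k::field \<Rightarrow> nat \<Rightarrow> 'k" where
  "cocharacter d j s = (\<lambda>i\<in>{..<d}. if i = j then s else 1)"

lemma cocharacter_in_torus: "s \<noteq> 0 \<Longrightarrow> cocharacter d j s \<in> carrier (torus d)"
  by (auto simp: cocharacter_def carrier_torus)

lemma function_algebra_generated:
  assumes "S \<subseteq> X \<rightarrow>\<^sub>E UNIV" shows "function_algebra X (generated_algebra X S)"
proof -
  have "function_algebra X (X \<rightarrow>\<^sub>E UNIV)" by (auto simp: function_algebra_def)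
  then have "generated_algebra X S \<subseteq> X \<rightarrow>\<^sub>E UNIV"
    using assms by (auto simp: generated_algebra_def)
  then show ?thesis
    unfolding function_algebra_def generated_algebra_def by blast
qed

text \<open>
  The functions satisfying \<open>Q\<close> form a function algebra that contains the generators.
\<close>

lemma generated_algebra_induct:
  assumes "f \<in> generated_algebra X S" "S \<subseteq> X \<rightarrow>\<^sub>E UNIV"
    and "\<And>f. f \<in> S \<Longrightarrow> Q f" "\<And>c. Q (\<lambda>x\<in>X. c)"
    and "\<And>f g. Q f \<Longrightarrow> Q g \<Longrightarrow> Q (\<lambda>x\<in>X. f x + g x)"
    and "\<And>f g. Q f \<Longrightarrow> Q g \<Longrightarrow> Q (\<lambda>x\<in>X. f x * g x)"
  shows "Q f"
proof -
  have "function_algebra X {f \<in> X \<rightarrow>\<^sub>E UNIV. Q f}"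
    using assms(4-6) by (auto simp: function_algebra_def)
  then have "generated_algebra X S \<subseteq> {f \<in> X \<rightarrow>\<^sub>E UNIV. Q f}"
    using assms(2,3) unfolding generated_algebra_def by (intro Inter_lower) blast
  then show ?thesis using assms(1) by blast
qed

text \<open>
  The non-vanishing sets are a base and not only a subbase, since the intersection of two of them
  is the non-vanishing set of a product.
\<close>

lemma zariski_open_contains_basic:
  assumes R: "function_algebra X R" and U: "openin (zariski X R) U" and x: "x \<in> U"
  shows "\<exists>h\<in>R. x \<in> X \<and> h x \<noteq> 0 \<and> {x \<in> X. h x \<noteq> 0} \<subseteq> U"
proof -
  have "generate_topology_on ((\<lambda>f. {x \<in> X. f x \<noteq> 0}) ` R) U"
    using U unfolding zariski_def by (rule openin_topology_generated_by)
  then show ?thesis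
    using x
  proof (induction arbitrary: x)
    case (Int a b)
    obtain g h where gh: "g \<in> R" "x \<in> X" "g x \<noteq> 0" "{x \<in> X. g x \<noteq> 0} \<subseteq> a"
      "h \<in> R" "h x \<noteq> 0" "{x \<in> X. h x \<noteq> 0} \<subseteq> b"
      using Int.IH(1)[of x] Int.IH(2)[of x] Int.prems by blast
    then have "(\<lambda>x\<in>X. g x * h x) \<in> R" using R by (auto simp: function_algebra_def)
    moreover have "{y \<in> X. (\<lambda>x\<in>X. g x * h x) y \<noteq> 0} \<subseteq> a \<inter> b" using gh by auto
    ultimately show ?case using gh by (intro bexI[of _ "\<lambda>x\<in>X. g x * h x"]) auto
  next
    case (UN K)
    then show ?case by blast
  next
    case (Basis s)
    then show ?case by blast
  qed simp
qed

lemma dense_open_contains_basic: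
  assumes R: "function_algebra X R" and U: "dense_open (zariski X R) U" and X: "X \<noteq> {}"
  obtains h x where "h \<in> R" "x \<in> X" "h x \<noteq> 0" "{x \<in> X. h x \<noteq> 0} \<subseteq> U"
proof -
  have one: "(\<lambda>x\<in>X. 1) \<in> R" using R by (simp add: function_algebra_def)
  have "X \<subseteq> topspace (zariski X R)"
    unfolding zariski_def topology_generated_by_topspace
    by (rule Union_upper) (rule image_eqI[OF _ one], simp)
  then have "U \<noteq> {}" using U X by (auto simp: dense_open_def)
  then obtain x where "x \<in> U" by blast
  then show thesis
    using zariski_open_contains_basic[OF R, of U x] U that by (auto simp: dense_open_def)
qed

lemma add_common_power:
  fixes a b s :: "'k::comm_semiring_1"
  shows "(a + b) * s ^ (N + M) = (a * s ^ N) * s ^ M + (b * s ^ M) * s ^ N"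
  and mult_common_power: "(a * b) * s ^ (N + M) = (a * s ^ N) * (b * s ^ M)"
  by (simp_all add: power_add algebra_simps)

text \<open>
  Coordinates and their inverses restrict to \<open>c * s\<close>, \<open>c / s\<close> or constants along a translate of a
  one-parameter subgroup, so regular functions restrict to Laurent polynomials.
\<close>

lemma torus_function_on_line:
  fixes f :: "(nat \<Rightarrow> 'k::field) \<Rightarrow> 'k"
  assumes f: "f \<in> torus_functions d" and t: "t \<in> carrier (torus d)" and j: "j < d"
  shows "\<exists>N p. \<forall>s. s \<noteq> 0 \<longrightarrow> f (t(j := t j * s)) * s ^ N = poly p s"
  using f unfolding torus_functions_def
proof (rule generated_algebra_induct[where Q = "\<lambda>f. \<exists>N p. \<forall>s. s \<noteq> 0 \<longrightarrow> f (t(j := t j * s)) * s ^ N = poly p s"])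
  let ?X = "carrier (torus d) :: (nat \<Rightarrow> 'k) set"
  have mem: "t(j := t j * s) \<in> ?X" if "s \<noteq> 0" for s
    using t j that by (auto simp: carrier_torus PiE_iff extensional_def)
  have t0: "t i \<noteq> 0" if "i < d" for i using t that by (auto simp: carrier_torus)
  show "\<exists>N p. \<forall>s. s \<noteq> 0 \<longrightarrow> (\<lambda>x\<in>?X. c) (t(j := t j * s)) * s ^ N = poly p s" for c
    by (intro exI[of _ 0] exI[of _ "[:c:]"]) (simp add: mem)
  fix f g assume "\<exists>N p. \<forall>s. s \<noteq> 0 \<longrightarrow> f (t(j := t j * s)) * s ^ N = poly p s"
    "\<exists>N p. \<forall>s. s \<noteq> 0 \<longrightarrow> g (t(j := t j * s)) * s ^ N = poly p s"
  then obtain N p M q where 1: "\<And>s. s \<noteq> 0 \<Longrightarrow> f (t(j := t j * s)) * s ^ N = poly p s"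
    and 2: "\<And>s. s \<noteq> 0 \<Longrightarrow> g (t(j := t j * s)) * s ^ M = poly q s" by blast
  show "\<exists>N p. \<forall>s. s \<noteq> 0 \<longrightarrow> (\<lambda>x\<in>?X. f x + g x) (t(j := t j * s)) * s ^ N = poly p s"
    by (intro exI[of _ "N + M"] exI[of _ "p * monom 1 M + q * monom 1 N"])
      (auto simp: mem poly_monom 1[symmetric] 2[symmetric] add_common_power)
  show "\<exists>N p. \<forall>s. s \<noteq> 0 \<longrightarrow> (\<lambda>x\<in>?X. f x * g x) (t(j := t j * s)) * s ^ N = poly p s"
    by (intro exI[of _ "N + M"] exI[of _ "p * q"])
      (auto simp: mem 1[symmetric] 2[symmetric] mult_common_power)
next
  let ?X = "carrier (torus d) :: (nat \<Rightarrow> 'k) set"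
  fix f assume "f \<in> (\<lambda>i. \<lambda>t\<in>?X. t i) ` {..<d} \<union> (\<lambda>i. \<lambda>t\<in>?X. inverse (t i)) ` {..<d}"
  then obtain i where i: "i < d" "f = (\<lambda>t\<in>?X. t i) \<or> f = (\<lambda>t\<in>?X. inverse (t i))" by auto
  have mem: "t(j := t j * s) \<in> ?X" if "s \<noteq> 0" for s
    using t j that by (auto simp: carrier_torus PiE_iff extensional_def)
  from i(2) show "\<exists>N p. \<forall>s. s \<noteq> 0 \<longrightarrow> f (t(j := t j * s)) * s ^ N = poly p s"
  proof
    assume f: "f = (\<lambda>t\<in>?X. t i)"
    show ?thesis
      by (intro exI[of _ 0] exI[of _ "if i = j then [:0, t j:] else [:t i:]"]) (auto simp: f mem)
  next
    assume f: "f = (\<lambda>t\<in>?X. inverse (t i))"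
    show ?thesis
      by (intro exI[of _ "if i = j then 1 else 0"] exI[of _ "[:inverse (t i):]"]) (auto simp: f mem)
  qed
qed auto

lemma affine_function_is_polynomial:
  fixes f :: "(nat \<Rightarrow> 'k::field) \<Rightarrow> 'k"
  assumes "f \<in> affine_functions n"
  shows "\<exists>P\<in>polys n. \<forall>x\<in>affine_space n. f x = eval_mpoly P x"
  using assms unfolding affine_functions_def polys_eq_polys_in eval_mpoly_eq_insertion
proof (rule generated_algebra_induct[where Q = "\<lambda>f. \<exists>P\<in>polys_in {..<n}. \<forall>x\<in>affine_space n. f x = insertion (\<lambda>c. c) x P"])
  fix f :: "(nat \<Rightarrow> 'k) \<Rightarrow> 'k" assume "f \<in> (\<lambda>i. \<lambda>x\<in>affine_space n. x i) ` {..<n}"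
  then obtain i where i: "i < n" "f = (\<lambda>x\<in>affine_space n. x i)" by blast
  show "\<exists>P\<in>polys_in {..<n}. \<forall>x\<in>affine_space n. f x = insertion (\<lambda>c. c) x P"
    using i by (intro bexI[of _ "mvar i"]) (auto intro: polys_in_mvar)
next
  fix c :: 'k
  show "\<exists>P\<in>polys_in {..<n}. \<forall>x\<in>affine_space n. (\<lambda>x\<in>affine_space n. c) x = insertion (\<lambda>c. c) x P"
    by (intro bexI[of _ "Poly_Mapping.single 0 c"]) (auto intro: polys_in_const)
next
  fix f g :: "(nat \<Rightarrow> 'k) \<Rightarrow> 'k"
  assume "\<exists>P\<in>polys_in {..<n}. \<forall>x\<in>affine_space n. f x = insertion (\<lambda>c. c) x P"
    "\<exists>P\<in>polys_in {..<n}. \<forall>x\<in>affine_space n. g x = insertion (\<lambda>c. c) x P"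
  then obtain P Q where PQ: "P \<in> polys_in {..<n}" "Q \<in> polys_in {..<n}"
    "\<And>x. x \<in> affine_space n \<Longrightarrow> f x = insertion (\<lambda>c. c) x P"
    "\<And>x. x \<in> affine_space n \<Longrightarrow> g x = insertion (\<lambda>c. c) x Q" by blast
  show "\<exists>P\<in>polys_in {..<n}. \<forall>x\<in>affine_space n. (\<lambda>x\<in>affine_space n. f x + g x) x = insertion (\<lambda>c. c) x P"
    using PQ by (intro bexI[of _ "P + Q"]) (auto simp: eval.insertion_add intro: polys_in_add)
  show "\<exists>P\<in>polys_in {..<n}. \<forall>x\<in>affine_space n. (\<lambda>x\<in>affine_space n. f x * g x) x = insertion (\<lambda>c. c) x P"
    using PQ by (intro bexI[of _ "P * Q"]) (auto simp: eval.insertion_mult intro: polys_in_mult)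
qed auto

abbreviation mconst :: "'k::field \<Rightarrow> 'k mpoly" where
  "mconst c \<equiv> Poly_Mapping.single 0 c"

lemma mconst_add: "mconst (a + b) = mconst a + mconst b"
  and mconst_mult: "mconst (a * b) = mconst a * mconst b"
  by (simp_all add: single_add mult_single)

lemma mconst_power: "mconst (a ^ e) = mconst a ^ e"
  by (induction e) (simp_all add: mconst_mult)

text \<open>
  Along the curve \<open>line\<close> the functions on the first factor become Laurent polynomials in the parameter
  by assumption, and those on affine space are polynomials in the coordinates. Hence the algebra
  they generate consists of Laurent polynomials \<open>B(s) / s\<^sup>N\<close> with coefficients in the polynomial ring.
\<close>

lemma product_function_on_line:
  fixes line :: "'k::field \<Rightarrow> 'g"
  assumes f: "f \<in> product_functions T A (affine_space n) (affine_functions n)"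
    and line: "\<And>s. s \<noteq> 0 \<Longrightarrow> line s \<in> T"
    and regular: "\<And>f. f \<in> A \<Longrightarrow> \<exists>N p. \<forall>s. s \<noteq> 0 \<longrightarrow> f (line s) * s ^ N = poly p s"
  shows "\<exists>N B. (\<forall>i. coeff B i \<in> polys n) \<and> (\<forall>s x. s \<noteq> 0 \<longrightarrow> x \<in> affine_space n \<longrightarrow>
     f (line s, x) * s ^ N = eval_mpoly (poly B (mconst s)) x)"
  using f unfolding product_functions_def polys_eq_polys_in eval_mpoly_eq_insertion
proof (rule generated_algebra_induct[where Q = "\<lambda>f. \<exists>N B. (\<forall>i. coeff B i \<in> polys_in {..<n}) \<and> (\<forall>s x. s \<noteq> 0 \<longrightarrow> x \<in> affine_space n \<longrightarrow>
     f (line s, x) * s ^ N = insertion (\<lambda>c. c) x (poly B (mconst s)))"])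
  let ?X = "T \<times> (affine_space n :: (nat \<Rightarrow> 'k) set)"
  let ?Q = "\<lambda>f N B. (\<forall>i. coeff B i \<in> polys_in {..<n}) \<and> (\<forall>s x. s \<noteq> 0 \<longrightarrow> x \<in> affine_space n \<longrightarrow>
     f (line s, x) * s ^ N = insertion (\<lambda>c. c) x (poly B (mconst s)))"
  note ins = eval.insertion_add eval.insertion_mult
  show "\<exists>N B. ?Q (\<lambda>x\<in>?X. c) N B" for c
    by (intro exI[of _ 0] exI[of _ "[:mconst c:]"])
      (auto simp: line coeff_pCons polys_in_const polys_in_0 split: nat.splits)
  have monom1: "coeff (monom 1 N :: 'k mpoly poly) i \<in> polys_in {..<n}" for N i
    by (simp add: polys_in_0 polys_in_1)
  have mult_in: "coeff (B * C) i \<in> polys_in {..<n}"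
    if "\<forall>i. coeff B i \<in> polys_in {..<n}" "\<forall>i. coeff C i \<in> polys_in {..<n}" for B C :: "'k mpoly poly" and i
    using that unfolding coeff_mult by (intro polys_in_sum polys_in_mult) auto
  fix f g assume "\<exists>N B. ?Q f N B" "\<exists>N B. ?Q g N B"
  then obtain N B M C where 1: "?Q f N B" and 2: "?Q g M C" by blast
  have "?Q (\<lambda>x\<in>?X. f x + g x) (N + M) (B * monom 1 M + C * monom 1 N)"
  proof (intro conjI allI impI)
    show "coeff (B * monom 1 M + C * monom 1 N) i \<in> polys_in {..<n}" for i
      unfolding coeff_add using 1 2 monom1 by (intro polys_in_add mult_in) auto
    fix s :: 'k and x assume "s \<noteq> 0" "x \<in> (affine_space n :: (nat \<Rightarrow> 'k) set)"
    then show "(\<lambda>x\<in>?X. f x + g x) (line s, x) * s ^ (N + M) =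
        insertion (\<lambda>c. c) x (poly (B * monom 1 M + C * monom 1 N) (mconst s))"
      using 1 2 by (simp add: line ins poly_monom mconst_power[symmetric] power_add algebra_simps)
  qed
  then show "\<exists>N B. ?Q (\<lambda>x\<in>?X. f x + g x) N B" by blast
  have "?Q (\<lambda>x\<in>?X. f x * g x) (N + M) (B * C)"
  proof (intro conjI allI impI)
    show "coeff (B * C) i \<in> polys_in {..<n}" for i
      using 1 2 by (intro mult_in) auto
    fix s :: 'k and x assume sx: "s \<noteq> 0" "x \<in> (affine_space n :: (nat \<Rightarrow> 'k) set)"
    have "(\<lambda>x\<in>?X. f x * g x) (line s, x) * s ^ (N + M) = (f (line s, x) * s ^ N) * (g (line s, x) * s ^ M)"
      using sx by (simp add: line power_add)
    then show "(\<lambda>x\<in>?X. f x * g x) (line s, x) * s ^ (N + M) = insertion (\<lambda>c. c) x (poly (B * C) (mconst s))"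
      using 1 2 sx by (simp add: ins)
  qed
  then show "\<exists>N B. ?Q (\<lambda>x\<in>?X. f x * g x) N B" by blast
next
  let ?X = "T \<times> (affine_space n :: (nat \<Rightarrow> 'k) set)"
  let ?Q = "\<lambda>f N B. (\<forall>i. coeff B i \<in> polys_in {..<n}) \<and> (\<forall>s x. s \<noteq> 0 \<longrightarrow> x \<in> affine_space n \<longrightarrow>
     f (line s, x) * s ^ N = insertion (\<lambda>c. c) x (poly B (mconst s)))"
  fix f assume "f \<in> (\<lambda>f. \<lambda>p\<in>?X. f (fst p)) ` A \<union> (\<lambda>g. \<lambda>p\<in>?X. g (snd p)) ` affine_functions n"
  then consider g where "g \<in> A" "f = (\<lambda>p\<in>?X. g (fst p))"
    | g where "g \<in> affine_functions n" "f = (\<lambda>p\<in>?X. g (snd p))" by blast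
  then show "\<exists>N B. ?Q f N B"
  proof cases
    case 1
    obtain N p where p: "\<And>s. s \<noteq> 0 \<Longrightarrow> g (line s) * s ^ N = poly p s" using regular[OF 1(1)] by blast
    have eval_p: "poly (map_poly mconst p) (mconst s) = mconst (poly p s)" for s
      by (rule map_poly_hom[where K = UNIV, symmetric]) (simp_all add: mconst_add mconst_mult)
    have "?Q f N (map_poly mconst p)"
      using p by (simp add: coeff_map_poly polys_in_const eval_p 1(2) line)
    then show ?thesis by blast
  next
    case 2
    obtain P where P: "P \<in> polys_in {..<n}" "\<And>x. x \<in> affine_space n \<Longrightarrow> g x = insertion (\<lambda>c. c) x P"
      using affine_function_is_polynomial[OF 2(1)]
      unfolding polys_eq_polys_in eval_mpoly_eq_insertion by blast
    have "?Q f 0 [:P:]"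
      using P by (auto simp: 2(2) line coeff_pCons polys_in_0 split: nat.splits)
    then show ?thesis by blast
  qed
qed (auto split: if_splits)

text \<open>
  The functions on which \<open>\<sigma> s\<close> depends rationally on \<open>s\<close> form a subfield, so generators decide. The
  action is known to be rational only on a translate of the one-parameter group, that is, for the
  generators \<open>g (var i)\<close> in place of the coordinates.
\<close>

lemma rational_orbit_from_coordinates:
  fixes \<sigma> :: "'k::alg_closed_field \<Rightarrow> 'k ratfun \<Rightarrow> 'k ratfun"
  assumes \<sigma>: "\<And>s. s \<noteq> 0 \<Longrightarrow> \<sigma> s \<in> carrier (cremona n)" and g: "g \<in> carrier (cremona n)"
    and gen: "\<And>i. i < n \<Longrightarrow> \<exists>p q. q \<noteq> 0 \<and> (MOST s. \<sigma> s (g (var i)) * poly q (const s) = poly p (const s))"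
    and f: "f \<in> ratfuns n"
  shows "\<exists>p q. q \<noteq> 0 \<and> (MOST s. \<sigma> s f * poly q (const s) = poly p (const s))"
proof -
  define Q where "Q f \<longleftrightarrow> (\<exists>p q. q \<noteq> 0 \<and> (MOST s. \<sigma> s f * poly q (const s) = poly p (const s)))" for f
  have nz: "MOST s::'k. s \<noteq> 0" by simp
  note F = subfield_closed[OF subfield_ratfuns[of n]]
  have Q_const: "Q (const c)" for c
    unfolding Q_def
    by (intro exI[of _ "[:const c:]"] exI[of _ 1]) (auto intro!: eventually_mono[OF nz] simp: cremona_const[OF \<sigma>])
  have Q_add: "Q (f + h)" if Qf: "Q f" and Qh: "Q h" and mem: "f \<in> ratfuns n" "h \<in> ratfuns n" for f h
  proof -
    obtain p q where pq: "q \<noteq> 0" "MOST s. \<sigma> s f * poly q (const s) = poly p (const s)"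
      using Qf unfolding Q_def by blast
    obtain p' q' where pq': "q' \<noteq> 0" "MOST s. \<sigma> s h * poly q' (const s) = poly p' (const s)"
      using Qh unfolding Q_def by blast
    have "MOST s. \<sigma> s (f + h) * poly (q * q') (const s) = poly (p * q' + p' * q) (const s)"
      using nz pq(2) pq'(2)
    proof eventually_elim
      case (elim s)
      show ?case
        by (simp add: cremona_add[OF \<sigma>[OF elim(1)] mem] elim(2)[symmetric] elim(3)[symmetric] algebra_simps)
    qed
    then show ?thesis unfolding Q_def using pq(1) pq'(1) by (intro exI[of _ "p * q' + p' * q"] exI[of _ "q * q'"]) simp
  qed
  have Q_mult: "Q (f * h)" if Qf: "Q f" and Qh: "Q h" and mem: "f \<in> ratfuns n" "h \<in> ratfuns n" for f h
  proof -
    obtain p q where pq: "q \<noteq> 0" "MOST s. \<sigma> s f * poly q (const s) = poly p (const s)"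
      using Qf unfolding Q_def by blast
    obtain p' q' where pq': "q' \<noteq> 0" "MOST s. \<sigma> s h * poly q' (const s) = poly p' (const s)"
      using Qh unfolding Q_def by blast
    have "MOST s. \<sigma> s (f * h) * poly (q * q') (const s) = poly (p * p') (const s)"
      using nz pq(2) pq'(2)
    proof eventually_elim
      case (elim s)
      show ?case
        by (simp add: cremona_times[OF \<sigma>[OF elim(1)] mem] elim(2)[symmetric] elim(3)[symmetric] ac_simps)
    qed
    then show ?thesis unfolding Q_def using pq(1) pq'(1) by (intro exI[of _ "p * p'"] exI[of _ "q * q'"]) simp
  qed
  have Q_inverse: "Q (inverse f)" if Qf: "Q f" and mem: "f \<in> ratfuns n" "f \<noteq> 0" for f
  proof -
    obtain p q where pq: "q \<noteq> 0" "MOST s. \<sigma> s f * poly q (const s) = poly p (const s)"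
      using Qf unfolding Q_def by blast
    have "p \<noteq> 0"
    proof
      assume "p = 0"
      have "MOST s::'k. False"
        using nz pq(2) MOST_poly_nonzero[OF pq(1)]
      proof eventually_elim
        case (elim s)
        then show ?case using cremona_eq_0_iff[OF \<sigma>[OF elim(1)] mem(1)] mem(2) \<open>p = 0\<close> by simp
      qed
      then show False using MOST_False by blast
    qed
    moreover have "MOST s. \<sigma> s (inverse f) * poly p (const s) = poly q (const s)"
      using nz pq(2)
    proof eventually_elim
      case (elim s)
      have "\<sigma> s f \<noteq> 0" using cremona_eq_0_iff[OF \<sigma>[OF elim(1)] mem(1)] mem(2) by simp
      then show ?case
        by (simp add: cremona_inverse[OF \<sigma>[OF elim(1)] mem(1)] elim(2)[symmetric])
    qed
    ultimately show ?thesis unfolding Q_def by blast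
  qed
  have Q_uminus: "Q (- f)" if "Q f" "f \<in> ratfuns n" for f
    using Q_mult[OF Q_const[of "- 1"] that(1) const_in_ratfuns that(2)] by (simp add: const_uminus)
  have "Q (g f)" if f: "f \<in> ratfuns n" for f
    using f
  proof (rule ratfuns_induct)
    show "is_subfield {f \<in> ratfuns n. Q (g f)}"
    proof (rule is_subfieldI)
      show "0 \<in> {f \<in> ratfuns n. Q (g f)}" "1 \<in> {f \<in> ratfuns n. Q (g f)}"
        using Q_const[of 0] Q_const[of 1] by (simp_all add: F cremona_0[OF g] cremona_1[OF g])
    qed (auto simp: F cremona_add[OF g] cremona_times[OF g] cremona_uminus[OF g] cremona_inverse[OF g]
        cremona_mem[OF g] cremona_eq_0_iff[OF g] intro!: Q_add Q_mult Q_uminus Q_inverse)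
    show "Q (g (const c))" for c using Q_const by (simp add: cremona_const[OF g])
    show "Q (g (var i))" if "i < n" for i using gen[OF that] by (simp add: Q_def)
  qed
  from this[OF cremona_mem[OF cremona_inv_closed[OF g] f]] have "Q f"
    by (simp add: cremona_inv_right[OF g f])
  then show ?thesis by (simp add: Q_def)
qed

text \<open>
  Points of affine space are extensional, whereas polynomials can be evaluated at any sequence; the
  values at indices from \<open>n\<close> on do not matter.
\<close>

lemma eval_eq_on_affine_space:
  fixes P Q :: "'k::alg_closed_field mpoly"
  assumes "P \<in> polys n" "Q \<in> polys n" "\<And>x. x \<in> affine_space n \<Longrightarrow> eval_mpoly P x = eval_mpoly Q x"
  shows "P = Q"
proof -
  have "insertion (\<lambda>c. c) x (P - Q) = 0" for x
  proof -
    let ?x = "\<lambda>i\<in>{..<n}. x i"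
    have "?x \<in> affine_space n" by (simp add: affine_space_def)
    then have "insertion (\<lambda>c. c) ?x P = insertion (\<lambda>c. c) ?x Q"
      using assms(3)[of ?x] by (simp add: eval_mpoly_eq_insertion)
    moreover have "insertion (\<lambda>c. c) ?x R = insertion (\<lambda>c. c) x R" if "R \<in> polys n" for R :: "'k mpoly"
      using that unfolding polys_eq_polys_in by (rule insertion_cong) simp
    ultimately show ?thesis using assms(1,2) by (simp add: eval.insertion_diff)
  qed
  then have "P - Q = 0"
    using assms(1,2) unfolding polys_eq_polys_in
    by (intro eval_mpoly_zero_imp[OF infinite_alg_closed, of "{..<n}"] polys_in_diff) auto
  then show ?thesis by simp
qed

lemma cross_multiply_cancel:
  fixes a b c d e f :: "'a::idom"
  assumes "a * b = c * d" "e * b = c * f" "b \<noteq> 0" shows "f * a = e * d"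
proof -
  have "b * (f * a) = f * (a * b)" by (simp only: ac_simps)
  also have "\<dots> = (c * f) * d" by (simp only: assms(1) ac_simps)
  also have "\<dots> = b * (e * d)" by (simp only: assms(2)[symmetric] ac_simps)
  finally show ?thesis using assms(3) by simp
qed

text \<open>
  On \<open>U\<close> the component \<open>i\<close> of the action is a quotient \<open>p / q\<close> of regular functions, and along the
  curve both are polynomials in \<open>s\<close> and the coordinates, up to powers of \<open>s\<close>. The rational function
  attached to the parameter \<open>s\<close> has the same values wherever \<open>h\<close> does not vanish. Multiplied by \<open>h\<close>, the
  resulting equation of polynomials holds at all points, so it is an identity, and \<open>h\<close> can be
  cancelled for almost all \<open>s\<close> because the curve passes through a point where \<open>h \<noteq> 0\<close>.
\<close>

lemma action_rational_on_line:
  fixes line :: "'k::alg_closed_field \<Rightarrow> 'k ratfun \<Rightarrow> 'k ratfun" and n :: nat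
    and T :: "('k ratfun \<Rightarrow> 'k ratfun) set" and A :: "(('k ratfun \<Rightarrow> 'k ratfun) \<Rightarrow> 'k) set"
  defines "X \<equiv> T \<times> affine_space n" and "R \<equiv> product_functions T A (affine_space n) (affine_functions n)"
  assumes T: "T \<subseteq> carrier (cremona n)"
    and line: "\<And>s. s \<noteq> 0 \<Longrightarrow> line s \<in> T"
    and regular: "\<And>f. f \<in> A \<Longrightarrow> \<exists>N p. \<forall>s. s \<noteq> 0 \<longrightarrow> f (line s) * s ^ N = poly p s"
    and h: "h \<in> R" "x0 \<in> affine_space n" "h (line 1, x0) \<noteq> 0" "{x \<in> X. h x \<noteq> 0} \<subseteq> U"
    and p: "p \<in> R" and q: "q \<in> R"
    and U: "\<And>g x. (g, x) \<in> U \<Longrightarrow> q (g, x) \<noteq> 0 \<and>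
        has_value n ((inv\<^bsub>cremona n\<^esub> g) (var i)) x (p (g, x) / q (g, x))"
    and i: "i < n"
  shows "\<exists>p q. q \<noteq> 0 \<and> (MOST s. (inv\<^bsub>cremona n\<^esub> (line s)) (var i) * poly q (const s) = poly p (const s))"
proof -
  have on_line: "\<exists>N B. (\<forall>i. coeff B i \<in> polys n) \<and> (\<forall>s x. s \<noteq> 0 \<longrightarrow> x \<in> affine_space n \<longrightarrow>
      f (line s, x) * s ^ N = eval_mpoly (poly B (mconst s)) x)" if "f \<in> R" for f
    using that[unfolded R_def] line
  proof (rule product_function_on_line)
    show "\<exists>N p. \<forall>s. s \<noteq> 0 \<longrightarrow> f (line s) * s ^ N = poly p s" if "f \<in> A" for f
      using that by (rule regular)
  qed
  obtain Nh Bh where Bh: "\<And>i. coeff Bh i \<in> polys n" "\<And>s x. s \<noteq> 0 \<Longrightarrow> x \<in> affine_space n \<Longrightarrow>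
      h (line s, x) * s ^ Nh = eval_mpoly (poly Bh (mconst s)) x"
    using on_line[OF h(1)] by blast
  obtain Np Bp where Bp: "\<And>i. coeff Bp i \<in> polys n" "\<And>s x. s \<noteq> 0 \<Longrightarrow> x \<in> affine_space n \<Longrightarrow>
      p (line s, x) * s ^ Np = eval_mpoly (poly Bp (mconst s)) x"
    using on_line[OF p] by blast
  obtain Nq Bq where Bq: "\<And>i. coeff Bq i \<in> polys n" "\<And>s x. s \<noteq> 0 \<Longrightarrow> x \<in> affine_space n \<Longrightarrow>
      q (line s, x) * s ^ Nq = eval_mpoly (poly Bq (mconst s)) x"
    using on_line[OF q] by blast
  have poly_in: "poly B (mconst s) \<in> polys n" if "\<And>i. coeff B i \<in> polys n" for B and s :: 'k
    using that unfolding polys_eq_polys_in by (intro poly_in_polys_in polys_in_const) auto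
  have nz: "Bh \<noteq> 0" "Bq \<noteq> 0"
  proof -
    have one: "(line 1, x0) \<in> U" using h line[of 1] by (auto simp: X_def)
    show "Bh \<noteq> 0" using Bh(2)[of 1 x0] h(2,3) by (auto simp: eval_mpoly_eq_insertion)
    show "Bq \<noteq> 0" using Bq(2)[of 1 x0] h(2) U[OF one] by (auto simp: eval_mpoly_eq_insertion)
  qed
  define q' where "q' = map_poly of_mpoly (Bq * monom 1 Np)"
  define p' where "p' = map_poly of_mpoly (Bp * monom 1 Nq)"
  have poly_of_mpoly: "poly (map_poly of_mpoly B) (const s) = of_mpoly (poly B (mconst s))"
    for B :: "'k mpoly poly" and s :: 'k
    unfolding const_of_mpoly
    by (rule map_poly_hom[where K = UNIV, symmetric]) (simp_all add: of_mpoly_add of_mpoly_mult)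
  have "q' \<noteq> 0"
  proof
    assume "q' = 0"
    then have "of_mpoly (coeff (Bq * monom 1 Np) l) = 0" for l
      by (metis q'_def coeff_0 coeff_map_poly of_mpoly_eq_0_iff)
    then have "Bq * monom 1 Np = 0" by (intro poly_eqI) simp
    then show False using nz by simp
  qed
  moreover have "MOST s. (inv\<^bsub>cremona n\<^esub> (line s)) (var i) * poly q' (const s) = poly p' (const s)"
  proof -
    have "MOST s. poly Bh (mconst s) \<noteq> 0"
      by (rule MOST_poly_nonzero_inj[OF nz(1) inj_single])
    moreover have "MOST s::'k. s \<noteq> 0" by simp
    ultimately show ?thesis
    proof eventually_elim
      case (elim s)
      let ?f = "(inv\<^bsub>cremona n\<^esub> (line s)) (var i)"
      have "line s \<in> carrier (cremona n)" using line[OF elim(2)] T by blast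
      then have "?f \<in> ratfuns n" by (rule cremona_mem[OF cremona_inv_closed var_in_ratfuns[OF i]])
      then obtain P Q where PQ: "P \<in> polys n" "Q \<in> polys n" "Q \<noteq> 0" "?f = Fract P Q"
        unfolding ratfuns_def by blast
      \<comment> \<open>The equation \<open>h * q * f = h * p\<close> along the curve, where \<open>f = P / Q\<close>, without denominators.\<close>
      let ?l = "poly Bh (mconst s) * (poly Bq (mconst s) * mconst (s ^ Np) * P)"
      let ?r = "poly Bh (mconst s) * (poly Bp (mconst s) * mconst (s ^ Nq) * Q)"
      have "?l = ?r"
      proof (rule eval_eq_on_affine_space)
        show "?l \<in> polys n" "?r \<in> polys n"
          using poly_in[OF Bh(1)] poly_in[OF Bp(1)] poly_in[OF Bq(1)] PQ(1,2)
          unfolding polys_eq_polys_in by (simp_all add: polys_in_mult polys_in_const)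
        fix x :: "nat \<Rightarrow> 'k" assume x: "x \<in> affine_space n"
        show "eval_mpoly ?l x = eval_mpoly ?r x"
        proof (cases "h (line s, x) = 0")
          case True
          then have "insertion (\<lambda>c. c) x (poly Bh (mconst s)) = 0"
            using Bh(2)[OF elim(2) x] by (simp add: eval_mpoly_eq_insertion)
          then show ?thesis by (simp add: eval_mpoly_eq_insertion eval.insertion_mult)
        next
          case False
          then have "(line s, x) \<in> U" using h(4) line[OF elim(2)] x by (auto simp: X_def)
          note val = U[OF this]
          then obtain P1 Q1 where PQ1: "P1 \<in> polys n" "Q1 \<in> polys n" "?f = Fract P1 Q1"
            "eval_mpoly Q1 x \<noteq> 0" "p (line s, x) / q (line s, x) = eval_mpoly P1 x / eval_mpoly Q1 x"
            unfolding has_value_def by blast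
          have "Q1 \<noteq> 0" using PQ1(4) by (auto simp: eval_mpoly_eq_insertion)
          then have "P * Q1 = P1 * Q" using PQ(3,4) PQ1(3) by (simp add: eq_fract)
          then have "eval_mpoly P x * eval_mpoly Q1 x = eval_mpoly P1 x * eval_mpoly Q x"
            unfolding eval_mpoly_eq_insertion eval.insertion_mult[symmetric] by simp
          moreover have "p (line s, x) * eval_mpoly Q1 x = eval_mpoly P1 x * q (line s, x)"
            using PQ1(4,5) val by (simp add: frac_eq_eq)
          ultimately have eq: "q (line s, x) * eval_mpoly P x = p (line s, x) * eval_mpoly Q x"
            using PQ1(4) by (rule cross_multiply_cancel)
          have "eval_mpoly (poly Bq (mconst s)) x * s ^ Np * eval_mpoly P x =
              (q (line s, x) * eval_mpoly P x) * (s ^ Np * s ^ Nq)"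
            by (simp add: Bq(2)[OF elim(2) x, symmetric] ac_simps)
          also have "\<dots> = eval_mpoly (poly Bp (mconst s)) x * s ^ Nq * eval_mpoly Q x"
            unfolding eq by (simp add: Bp(2)[OF elim(2) x, symmetric] ac_simps)
          finally show ?thesis
            by (simp add: eval_mpoly_eq_insertion eval.insertion_mult)
        qed
      qed
      then have "poly Bq (mconst s) * mconst (s ^ Np) * P = poly Bp (mconst s) * mconst (s ^ Nq) * Q"
        using elim(1) by simp
      then have E: "of_mpoly (poly (Bq * monom 1 Np) (mconst s)) * of_mpoly P =
          of_mpoly (poly (Bp * monom 1 Nq) (mconst s)) * of_mpoly Q"
        by (simp add: poly_monom mconst_power of_mpoly_mult[symmetric])
      have "?f = of_mpoly P / of_mpoly Q" unfolding PQ(4) by (rule Fract_of_mpoly[OF PQ(3)])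
      then show ?case
        unfolding q'_def p'_def poly_of_mpoly using E PQ(3) by (simp add: divide_eq_eq mult.commute)
    qed
  qed
  ultimately show ?thesis by blast
qed

text \<open>
  The components of the birational map of \<open>g\<close> are the images of the coordinates under the inverse of
  \<open>g\<close>. The isomorphism from the standard torus is therefore composed with inversion, which is again a
  homomorphism as the torus is commutative, so that the action of \<open>\<psi> t\<close> on functions is the one whose
  rationality is known. The dense open set of the action contains some point, and the curve used is
  the translate of the one-parameter subgroup through the group component of that point.
\<close>

theorem torus_subgroup_parametrization:
  fixes T :: "('k::alg_closed_field ratfun \<Rightarrow> 'k ratfun) set"
  assumes "torus_subgroup n d T A"
  obtains \<psi> where "\<psi> \<in> hom (torus d) (cremona n)" "inj_on \<psi> (carrier (torus d))"
    "\<psi> ` carrier (torus d) = T"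
    "\<And>j f. j < d \<Longrightarrow> f \<in> ratfuns n \<Longrightarrow>
       \<exists>p q. q \<noteq> 0 \<and> (MOST s. \<psi> (cocharacter d j s) f * poly q (const s) = poly p (const s))"
proof -
  let ?G = "cremona n :: ('k ratfun \<Rightarrow> 'k ratfun) monoid" and ?X = "T \<times> (affine_space n :: (nat \<Rightarrow> 'k) set)"
  let ?R = "product_functions T A (affine_space n) (affine_functions n)"
  interpret G: group ?G by (rule group_cremona)
  have sub: "subgroup T ?G" and action: "rational_action (?G\<lparr>carrier := T\<rparr>) A n (\<lambda>g. g)"
    using assms by (auto simp: torus_subgroup_def algebraic_subgroup_def)
  have TG: "T \<subseteq> carrier ?G" using subgroup.subset[OF sub] .
  obtain \<phi> where iso: "\<phi> \<in> iso (?G\<lparr>carrier := T\<rparr>) (torus d)"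
    and reg: "regular_map (carrier (torus d)) (torus_functions d) T A (inv_into T \<phi>)"
    using assms by (auto simp: torus_subgroup_def algebraic_group_iso_def)
  define \<chi> where "\<chi> = inv_into T \<phi>"
  have "\<chi> \<in> iso (torus d) (?G\<lparr>carrier := T\<rparr>)"
    using group.iso_set_sym[OF subgroup.subgroup_is_group[OF sub G.is_group] iso] by (simp add: \<chi>_def)
  then have \<chi>: "bij_betw \<chi> (carrier (torus d)) T"
    and \<chi>_hom: "\<And>t u. t \<in> carrier (torus d) \<Longrightarrow> u \<in> carrier (torus d) \<Longrightarrow>
      \<chi> (t \<otimes>\<^bsub>torus d\<^esub> u) = \<chi> t \<otimes>\<^bsub>?G\<^esub> \<chi> u"
    by (auto simp: iso_def hom_def)
  have \<chi>_T: "\<chi> t \<in> T" if "t \<in> carrier (torus d)" for t using \<chi> that by (auto dest: bij_betw_apply)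
  then have \<chi>_G: "\<chi> t \<in> carrier ?G" if "t \<in> carrier (torus d)" for t using TG that by blast
  have comm: "t \<otimes>\<^bsub>torus d\<^esub> u = u \<otimes>\<^bsub>torus d\<^esub> t" for t u :: "nat \<Rightarrow> 'k"
    by (simp add: mult_torus mult.commute)
  define \<psi> where "\<psi> t = inv\<^bsub>?G\<^esub> (\<chi> t)" for t
  have \<psi>_G: "\<psi> t \<in> carrier ?G" if "t \<in> carrier (torus d)" for t
    using \<chi>_G[OF that] by (simp add: \<psi>_def)
  have hom: "\<psi> \<in> hom (torus d) ?G"
  proof (rule homI)
    fix t u :: "nat \<Rightarrow> 'k" assume tu: "t \<in> carrier (torus d)" "u \<in> carrier (torus d)"
    have "\<psi> (u \<otimes>\<^bsub>torus d\<^esub> t) = \<psi> t \<otimes>\<^bsub>?G\<^esub> \<psi> u"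
      using tu by (simp add: \<psi>_def \<chi>_hom \<chi>_G G.inv_mult_group)
    then show "\<psi> (t \<otimes>\<^bsub>torus d\<^esub> u) = \<psi> t \<otimes>\<^bsub>?G\<^esub> \<psi> u" by (simp only: comm)
  qed (rule \<psi>_G)
  have inj: "inj_on \<psi> (carrier (torus d))"
  proof (rule inj_onI)
    fix t u :: "nat \<Rightarrow> 'k" assume tu: "t \<in> carrier (torus d)" "u \<in> carrier (torus d)" "\<psi> t = \<psi> u"
    then have "\<chi> t = \<chi> u" using \<chi>_G unfolding \<psi>_def by (metis G.inv_inv)
    then show "t = u" using \<chi> tu(1,2) by (auto simp: bij_betw_def dest: inj_onD)
  qed
  have image: "\<psi> ` carrier (torus d) = T"
  proof
    show "\<psi> ` carrier (torus d) \<subseteq> T"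
      using \<chi>_T subgroup.m_inv_closed[OF sub] by (auto simp: \<psi>_def)
    show "T \<subseteq> \<psi> ` carrier (torus d)"
    proof
      fix g assume g: "g \<in> T"
      then have "inv\<^bsub>?G\<^esub> g \<in> T" by (rule subgroup.m_inv_closed[OF sub])
      then obtain t where t: "t \<in> carrier (torus d)" "\<chi> t = inv\<^bsub>?G\<^esub> g"
        using \<chi> by (auto simp: bij_betw_def)
      have "g \<in> carrier ?G" using g TG by blast
      then have "\<psi> t = g" by (simp add: \<psi>_def t(2))
      then show "g \<in> \<psi> ` carrier (torus d)" using t(1) by blast
    qed
  qed
  obtain U p q where U: "dense_open (zariski ?X ?R) U" and pq_all: "\<forall>i<n. p i \<in> ?R \<and> q i \<in> ?R"
    and val_all: "\<forall>(g, x) \<in> U. \<exists>y. maps_point n g x y \<and>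
       (\<forall>i<n. q i (g, x) \<noteq> 0 \<and> y i = p i (g, x) / q i (g, x))"
    using action unfolding rational_action_def Let_def by auto
  have pq: "p i \<in> ?R" "q i \<in> ?R" if "i < n" for i using pq_all that by auto
  have val: "\<exists>y. maps_point n g x y \<and> (\<forall>i<n. q i (g, x) \<noteq> 0 \<and> y i = p i (g, x) / q i (g, x))"
    if "(g, x) \<in> U" for g x using val_all that by auto
  have "function_algebra ?X ?R"
    unfolding product_functions_def by (rule function_algebra_generated) (auto split: if_splits)
  moreover have "?X \<noteq> {}"
  proof -
    have "(\<lambda>i\<in>{..<n}. 0) \<in> (affine_space n :: (nat \<Rightarrow> 'k) set)" by (simp add: affine_space_def)
    then show ?thesis using subgroup.one_closed[OF sub] by blast
  qed
  ultimately obtain h gx where h: "h \<in> ?R" "gx \<in> ?X" "h gx \<noteq> 0" "{x \<in> ?X. h x \<noteq> 0} \<subseteq> U"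
    using dense_open_contains_basic[OF _ U] by blast
  obtain g x0 where gx: "gx = (g, x0)" "g \<in> T" "x0 \<in> affine_space n" using h(2) by auto
  obtain t where t: "t \<in> carrier (torus d)" "\<chi> t = g" using \<chi> gx(2) by (auto simp: bij_betw_def)
  have "\<exists>p q. q \<noteq> 0 \<and> (MOST s. \<psi> (cocharacter d j s) f * poly q (const s) = poly p (const s))"
    if j: "j < d" and f: "f \<in> ratfuns n" for j f
  proof (rule rational_orbit_from_coordinates[OF _ \<psi>_G[OF t(1)] _ f])
    show "\<psi> (cocharacter d j s) \<in> carrier ?G" if "s \<noteq> 0" for s
      by (rule \<psi>_G[OF cocharacter_in_torus[OF that]])
    fix i assume i: "i < n"
    define line where "line s = \<chi> (t(j := t j * s))" for s
    have mem: "t(j := t j * s) \<in> carrier (torus d)" if "s \<noteq> 0" for s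
      using t(1) j that by (auto simp: carrier_torus PiE_iff extensional_def)
    have "\<exists>p q. q \<noteq> 0 \<and> (MOST s. (inv\<^bsub>?G\<^esub> (line s)) (var i) * poly q (const s) = poly p (const s))"
    proof (rule action_rational_on_line[where h = h and p = "p i" and q = "q i" and U = U, OF TG])
      show "line s \<in> T" if "s \<noteq> 0" for s using \<chi>_T[OF mem[OF that]] by (simp add: line_def)
      show "\<exists>N p. \<forall>s. s \<noteq> 0 \<longrightarrow> f (line s) * s ^ N = poly p s" if "f \<in> A" for f
      proof -
        have "(\<lambda>t\<in>carrier (torus d). f (\<chi> t)) \<in> torus_functions d"
          using reg that by (auto simp: regular_map_def \<chi>_def)
        from torus_function_on_line[OF this t(1) j] show ?thesis by (simp add: line_def mem)
      qed
      show "h (line 1, x0) \<noteq> 0" using h(3) by (simp add: line_def gx t(2))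
      show "q i (g, x) \<noteq> 0 \<and> has_value n ((inv\<^bsub>?G\<^esub> g) (var i)) x (p i (g, x) / q i (g, x))"
        if "(g, x) \<in> U" for g x
        using val[OF that] i by (auto simp: maps_point_def)
    qed (use h gx pq[OF i] i in auto)
    moreover have "(inv\<^bsub>?G\<^esub> (line s)) (var i) = \<psi> (cocharacter d j s) (\<psi> t (var i))" if "s \<noteq> 0" for s
    proof -
      have "t(j := t j * s) = cocharacter d j s \<otimes>\<^bsub>torus d\<^esub> t"
        using t(1) j by (auto simp: mult_torus cocharacter_def carrier_torus PiE_iff extensional_def)
      then have "inv\<^bsub>?G\<^esub> (line s) = \<psi> (cocharacter d j s \<otimes>\<^bsub>torus d\<^esub> t)"
        by (simp add: line_def \<psi>_def)
      also have "\<dots> = \<psi> (cocharacter d j s) \<otimes>\<^bsub>?G\<^esub> \<psi> t"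
        by (rule hom_mult[OF hom cocharacter_in_torus[OF that] t(1)])
      finally show ?thesis
        by (simp add: cremona_mult[OF \<psi>_G[OF cocharacter_in_torus[OF that]] \<psi>_G[OF t(1)] var_in_ratfuns[OF i]])
    qed
    ultimately obtain p q where pq: "q \<noteq> 0"
      "MOST s. (inv\<^bsub>?G\<^esub> (line s)) (var i) * poly q (const s) = poly p (const s)"
      and line: "\<And>s. s \<noteq> 0 \<Longrightarrow> (inv\<^bsub>?G\<^esub> (line s)) (var i) = \<psi> (cocharacter d j s) (\<psi> t (var i))"
      by blast
    have "MOST s::'k. s \<noteq> 0" by simp
    with pq(2) have "MOST s. \<psi> (cocharacter d j s) (\<psi> t (var i)) * poly q (const s) = poly p (const s)"
      by eventually_elim (simp add: line)
    then show "\<exists>p q. q \<noteq> 0 \<and>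
        (MOST s. \<psi> (cocharacter d j s) (\<psi> t (var i)) * poly q (const s) = poly p (const s))"
      using pq(1) by blast
  qed
  with hom inj image show thesis by (rule that)
qed

section \<open>Semi-invariant free generators\<close>

lemma cremona_power_int:
  assumes s: "s \<in> carrier (cremona n)" and f: "f \<in> ratfuns n"
  shows "s (f powi m) = s f powi m"
proof -
  have pow: "s (f ^ e) = s f ^ e" for e
    by (induction e) (simp_all add: cremona_1[OF s] cremona_times[OF s f subfield_power[OF subfield_ratfuns f]])
  have "s (inverse f ^ e) = inverse (s f) ^ e" for e
    using pow[of e] cremona_inverse[OF s subfield_power[OF subfield_ratfuns f]]
    by (simp add: power_inverse)
  then show ?thesis by (simp add: power_int_def pow)
qed

lemma free_generators_nonzero:
  fixes z :: "nat \<Rightarrow> 'k::field ratfun"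
  assumes "free_generators n z" "i < n" shows "z i \<noteq> 0"
proof
  assume "z i = 0"
  then have "insertion const z (mvar i) = 0" by simp
  moreover have "(mvar i :: 'k mpoly) \<in> polys_in {..<n}" using assms(2) by (intro polys_in_mvar) simp
  ultimately have 0: "(mvar i :: 'k mpoly) = 0"
    using assms(1) unfolding free_generators_def alg_indep_def by blast
  show False
    using const.insertion_mvar[of "\<lambda>_. 1 :: 'k ratfun" i] unfolding 0 by simp
qed

lemma power_int_root_exists:
  fixes b :: "'k::alg_closed_field"
  assumes "e \<noteq> 0" "b \<noteq> 0" shows "\<exists>a. a \<noteq> 0 \<and> a powi e = b"
proof -
  have root: "\<exists>a. a \<noteq> 0 \<and> a ^ m = c" if "m > 0" "c \<noteq> 0" for m and c :: 'k
    using nth_root_exists[OF that(1), of c] that by (metis zero_power)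
  show ?thesis
  proof (cases "e > 0")
    case True
    then show ?thesis using root[of "nat e" b] assms(2) by (auto simp: power_int_def)
  next
    case False
    then have "nat (- e) > 0" using assms(1) by simp
    then obtain a where "a \<noteq> 0" "a ^ nat (- e) = inverse b"
      using root[of "nat (- e)" "inverse b"] assms(2) by auto
    then show ?thesis using False assms(1) by (intro exI[of _ a]) (auto simp: power_int_def power_inverse)
  qed
qed

text \<open>
  Back substitution: the last equation determines a power of its diagonal unknown from the values
  \<open>u\<close> of the later unknowns, and every non-trivial power map of the multiplicative group of an algebraically
  closed field is onto. Prescribing the values \<open>u\<close> from \<open>r\<close> on permits an induction on \<open>r\<close>, and it is also what
  produces a non-trivial element of the kernel in \<open>exists_pivot\<close>.
\<close>

lemma triangular_monomial_system:
  fixes u c :: "nat \<Rightarrow> 'k::alg_closed_field" and w :: "nat \<Rightarrow> nat \<Rightarrow> int"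
  assumes "r \<le> d" "\<And>l. r \<le> l \<Longrightarrow> l < d \<Longrightarrow> u l \<noteq> 0" "\<And>i. i < r \<Longrightarrow> c i \<noteq> 0"
    and "\<And>j. j < r \<Longrightarrow> w j j \<noteq> 0" "\<And>i j. j < i \<Longrightarrow> i < r \<Longrightarrow> w i j = 0"
  shows "\<exists>t. (\<forall>l<d. t l \<noteq> 0) \<and> (\<forall>l. r \<le> l \<longrightarrow> l < d \<longrightarrow> t l = u l) \<and>
    (\<forall>i<r. (\<Prod>j<d. t j powi w i j) = c i)"
  using assms
proof (induction r arbitrary: u)
  case 0
  then show ?case by (intro exI[of _ u]) simp
next
  case (Suc r)
  define b where "b = (\<Prod>j\<in>{Suc r..<d}. u j powi w r j)"
  have b: "b \<noteq> 0" using Suc.prems(2) by (auto simp: b_def)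
  obtain a where a: "a \<noteq> 0" "a powi w r r = c r / b"
    using power_int_root_exists[of "w r r" "c r / b"] Suc.prems(3,4)[of r] b by auto
  have "\<exists>t. (\<forall>l<d. t l \<noteq> 0) \<and> (\<forall>l. r \<le> l \<longrightarrow> l < d \<longrightarrow> t l = (u(r := a)) l) \<and>
      (\<forall>i<r. (\<Prod>j<d. t j powi w i j) = c i)"
    using Suc.prems a(1) by (intro Suc.IH) auto
  then obtain t where t: "\<And>l. l < d \<Longrightarrow> t l \<noteq> 0" "\<And>l. r \<le> l \<Longrightarrow> l < d \<Longrightarrow> t l = (u(r := a)) l"
    "\<And>i. i < r \<Longrightarrow> (\<Prod>j<d. t j powi w i j) = c i" by blast
  have "(\<Prod>j<d. t j powi w r j) = (\<Prod>j\<in>{r..<d}. t j powi w r j)"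
    using Suc.prems(5)[of _ r] by (intro prod.mono_neutral_right) (auto simp: not_le)
  also have "{r..<d} = insert r {Suc r..<d}" using Suc.prems(1) by auto
  also have "(\<Prod>j\<in>insert r {Suc r..<d}. t j powi w r j) = a powi w r r * b"
    using Suc.prems(1) t(2) by (simp add: b_def)
  finally have "(\<Prod>j<d. t j powi w r j) = c r" using a(2) b by simp
  then have "\<forall>i<Suc r. (\<Prod>j<d. t j powi w i j) = c i" using t(3) by (auto simp: less_Suc_eq)
  then show ?case using t(1,2) by (intro exI[of _ t]) auto
qed

text \<open>
  A faithful action of the standard torus by automorphisms, of which only rationality along the
  coordinate subgroups is retained.
\<close>

locale rational_torus =
  fixes n d :: nat and \<psi> :: "(nat \<Rightarrow> 'k::alg_closed_field) \<Rightarrow> 'k ratfun \<Rightarrow> 'k ratfun"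
  assumes hom: "\<psi> \<in> hom (torus d) (cremona n)"
    and inj: "inj_on \<psi> (carrier (torus d))"
    and rational: "j < d \<Longrightarrow> f \<in> ratfuns n \<Longrightarrow>
       \<exists>p q. q \<noteq> 0 \<and> (MOST s. \<psi> (cocharacter d j s) f * poly q (const s) = poly p (const s))"
begin

lemma mem: "t \<in> carrier (torus d) \<Longrightarrow> \<psi> t \<in> carrier (cremona n)"
  by (rule hom_in_carrier[OF hom])

lemma apply_mult:
  assumes "t \<in> carrier (torus d)" "u \<in> carrier (torus d)" "f \<in> ratfuns n"
  shows "\<psi> (\<lambda>i\<in>{..<d}. t i * u i) f = \<psi> t (\<psi> u f)"
  using hom_mult[OF hom assms(1,2)] cremona_mult[OF mem[OF assms(1)] mem[OF assms(2)] assms(3)]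
  by (simp add: mult_torus)

lemma apply_one:
  assumes f: "f \<in> ratfuns n" shows "\<psi> (\<lambda>i\<in>{..<d}. 1) f = f"
proof -
  let ?e = "\<lambda>i\<in>{..<d}. 1 :: 'k"
  have e: "?e \<in> carrier (torus d)" by (auto simp: carrier_torus)
  have "(\<lambda>i\<in>{..<d}. ?e i * ?e i) = ?e" by (rule ext) auto
  then have "\<psi> ?e (\<psi> ?e f) = \<psi> ?e f" using apply_mult[OF e e f] by simp
  then show ?thesis
    using cremona_inv_left[OF mem[OF e] f] cremona_inv_left[OF mem[OF e] cremona_mem[OF mem[OF e] f]] by simp
qed

abbreviation \<sigma> where "\<sigma> j s \<equiv> \<psi> (cocharacter d j s)"

lemma \<sigma>_mem: "s \<noteq> 0 \<Longrightarrow> \<sigma> j s \<in> carrier (cremona n)"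
  by (rule mem[OF cocharacter_in_torus])

lemma \<sigma>_mult:
  assumes "s \<noteq> 0" "u \<noteq> 0" "f \<in> ratfuns n" shows "\<sigma> j s (\<sigma> j u f) = \<sigma> j (s * u) f"
proof -
  have "(\<lambda>i\<in>{..<d}. cocharacter d j s i * cocharacter d j u i) = cocharacter d j (s * u)"
    by (rule ext) (auto simp: cocharacter_def)
  then show ?thesis
    using apply_mult[OF cocharacter_in_torus[OF assms(1)] cocharacter_in_torus[OF assms(2)] assms(3), of j j] by simp
qed

lemma \<sigma>_commute:
  assumes "s \<noteq> 0" "u \<noteq> 0" "f \<in> ratfuns n" shows "\<sigma> j s (\<sigma> l u f) = \<sigma> l u (\<sigma> j s f)"
  using apply_mult[OF cocharacter_in_torus[OF assms(1)] cocharacter_in_torus[OF assms(2)] assms(3), of j l]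
    apply_mult[OF cocharacter_in_torus[OF assms(2)] cocharacter_in_torus[OF assms(1)] assms(3), of l j]
  by (simp add: mult.commute)

lemma \<sigma>_one: "f \<in> ratfuns n \<Longrightarrow> \<sigma> j 1 f = f"
  using apply_one[of f] by (simp add: cocharacter_def)

lemma \<sigma>_tower_automorphism:
  assumes L: "is_subfield L" "range const \<subseteq> L" and K: "K \<subseteq> ratfuns n" "is_subfield K" "L \<subseteq> K"
    and stable: "\<And>t. t \<in> carrier (torus d) \<Longrightarrow> \<psi> t ` K \<subseteq> K" "\<And>t. t \<in> carrier (torus d) \<Longrightarrow> \<psi> t ` L \<subseteq> L"
    and s: "s \<noteq> 0"
  shows "tower_automorphism K L (\<sigma> j s)"
proof
  have image: "\<sigma> j s ` M = M" if M: "M \<subseteq> ratfuns n" and st: "\<And>t. t \<in> carrier (torus d) \<Longrightarrow> \<psi> t ` M \<subseteq> M" for M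
  proof
    show "\<sigma> j s ` M \<subseteq> M" by (rule st[OF cocharacter_in_torus[OF s]])
    show "M \<subseteq> \<sigma> j s ` M"
    proof
      fix a assume a: "a \<in> M"
      then have aF: "a \<in> ratfuns n" using M by blast
      have "\<sigma> j (inverse s) a \<in> M" using st[OF cocharacter_in_torus[of "inverse s"]] s a by auto
      moreover have "a = \<sigma> j s (\<sigma> j (inverse s) a)"
        using \<sigma>_mult[OF s _ aF, of "inverse s" j] s \<sigma>_one[OF aF] by simp
      ultimately show "a \<in> \<sigma> j s ` M" by (rule rev_image_eqI)
    qed
  qed
  show "\<sigma> j s ` K = K" by (rule image[OF K(1) stable(1)])
  show "\<sigma> j s ` L = L" by (rule image[OF order_trans[OF K(3,1)] stable(2)])
  show "\<sigma> j s (a + b) = \<sigma> j s a + \<sigma> j s b" "\<sigma> j s (a * b) = \<sigma> j s a * \<sigma> j s b"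
    if "a \<in> K" "b \<in> K" for a b
    using that K(1) by (auto intro: cremona_add[OF \<sigma>_mem[OF s]] cremona_times[OF \<sigma>_mem[OF s]])
  show "\<sigma> j s (const c) = const c" for c by (rule cremona_const[OF \<sigma>_mem[OF s]])
qed (use assms in auto)

text \<open>
  A generator that is semi-invariant under the first \<open>m\<close> coordinate subgroups is replaced by one obtained
  from the next subgroup, \<open>\<sigma> m\<close>. For \<open>\<rho> = \<sigma> m u\<close> the commutation relation holds with \<open>\<epsilon> = 1\<close> and \<open>\<kappa> = u\<close>,
  and for the earlier subgroups, by induction, with \<open>\<epsilon> = u powi w j\<close> and \<open>\<kappa> = 1\<close>; so the new generator is
  semi-invariant under all of them.
\<close>

lemma semi_invariant_tower_step:
  assumes L: "is_subfield L" "range const \<subseteq> L" and z: "transcendental_over L z"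
    and K: "K = adjoin L {z}" "K \<subseteq> ratfuns n"
    and stable: "\<And>t. t \<in> carrier (torus d) \<Longrightarrow> \<psi> t ` K \<subseteq> K" "\<And>t. t \<in> carrier (torus d) \<Longrightarrow> \<psi> t ` L \<subseteq> L"
    and m: "m \<le> d"
  shows "\<exists>y w. transcendental_over L y \<and> adjoin L {y} = K \<and>
    (\<forall>j<m. \<forall>s. s \<noteq> 0 \<longrightarrow> \<sigma> j s y = const (s powi w j) * y)"
  using m
proof (induction m)
  case 0
  show ?case using z K by auto
next
  case (Suc m)
  have LK: "L \<subseteq> K" and subK: "is_subfield K"
    unfolding K(1) using adjoin_superset[of "{z}" L] subfield_adjoin by auto
  obtain y w where y: "transcendental_over L y" "adjoin L {y} = K"
    and w: "\<And>j s. j < m \<Longrightarrow> s \<noteq> 0 \<Longrightarrow> \<sigma> j s y = const (s powi w j) * y"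
    using Suc.IH Suc.prems by auto
  have yK: "y \<in> K" using y(2) adjoin_superset[of "{y}" L] by auto
  then have yF: "y \<in> ratfuns n" using K(2) by blast
  have stable_aut: "tower_automorphism K L (\<sigma> j s)" if "s \<noteq> 0" for j s
    by (rule \<sigma>_tower_automorphism[OF L K(2) subK LK stable that])
  have m: "m < d" using Suc.prems by simp
  interpret one_parameter_extension L y "\<sigma> m"
  proof (rule one_parameter_extension.intro)
    show "tower_automorphism (adjoin L {y}) L (\<sigma> m s)" if "s \<noteq> 0" for s
      unfolding y(2) using that by (rule stable_aut)
  qed (rule L y(1) rational[OF m yF])+
  obtain y' e i where y': "transcendental_over L y'" "adjoin L {y'} = adjoin L {y}"
    and eig: "\<And>\<rho> \<epsilon> \<kappa>. tower_automorphism (adjoin L {y}) L \<rho> \<Longrightarrow> \<epsilon> \<noteq> 0 \<Longrightarrow> \<kappa> \<noteq> 0 \<Longrightarrow>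
       (MOST s. \<rho> (\<sigma> m s y) = const \<epsilon> * \<sigma> m (\<kappa> * s) y) \<Longrightarrow> \<rho> y' = const (\<kappa> powi e * \<epsilon> ^ i) * y'"
    by (rule semi_invariant_generator) blast
  have nz: "MOST s::'k. s \<noteq> 0" by simp
  have last: "\<sigma> m u y' = const (u powi e) * y'" if "u \<noteq> 0" for u
  proof -
    have "MOST s. \<sigma> m u (\<sigma> m s y) = const 1 * \<sigma> m (u * s) y"
      using nz by eventually_elim (simp add: \<sigma>_mult[OF that _ yF])
    then show ?thesis using eig[OF aut[OF that], of 1 u] that by simp
  qed
  have old: "\<sigma> j u y' = const (u powi (w j * int i)) * y'" if "j < m" "u \<noteq> 0" for j u
  proof -
    have "MOST s. \<sigma> j u (\<sigma> m s y) = const (u powi w j) * \<sigma> m (1 * s) y"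
      using nz
    proof eventually_elim
      case (elim s)
      have "\<sigma> j u (\<sigma> m s y) = \<sigma> m s (\<sigma> j u y)" by (rule \<sigma>_commute[OF that(2) elim yF])
      also have "\<dots> = const (u powi w j) * \<sigma> m s y"
        unfolding w[OF that] by (simp add: cremona_times[OF \<sigma>_mem[OF elim] _ yF] cremona_const[OF \<sigma>_mem[OF elim]])
      finally show ?case by simp
    qed
    moreover have "tower_automorphism (adjoin L {y}) L (\<sigma> j u)"
      unfolding y(2) by (rule stable_aut[OF that(2)])
    ultimately have "\<sigma> j u y' = const (1 powi e * (u powi w j) ^ i) * y'"
      using that(2) by (intro eig) simp_all
    then show ?thesis by (simp add: power_int_mult)
  qed
  have "\<forall>j<Suc m. \<forall>s. s \<noteq> 0 \<longrightarrow> \<sigma> j s y' = const (s powi (if j < m then w j * int i else e)) * y'"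
    using last old by (auto simp: less_Suc_eq)
  then show ?case
    using y' y(2) by (intro exI[of _ y'] exI[of _ "\<lambda>j. if j < m then w j * int i else e"]) simp
qed

definition semi_invariant :: "(nat \<Rightarrow> 'k ratfun) \<Rightarrow> (nat \<Rightarrow> nat \<Rightarrow> int) \<Rightarrow> bool" where
  "semi_invariant z w \<longleftrightarrow> free_generators n z \<and>
    (\<forall>i<n. \<forall>t\<in>carrier (torus d). \<psi> t (z i) = const (\<Prod>j<d. t j powi w i j) * z i)"

text \<open>
  Every element of the torus is a product of elements of the coordinate subgroups; \<open>tr r\<close> is the product
  of the first \<open>r\<close> of them.
\<close>

lemma weights_from_cocharacters:
  assumes w: "\<And>j s. j < d \<Longrightarrow> s \<noteq> 0 \<Longrightarrow> \<sigma> j s y = const (s powi w j) * y" and y: "y \<in> ratfuns n"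
    and t: "t \<in> carrier (torus d)"
  shows "\<psi> t y = const (\<Prod>j<d. t j powi w j) * y"
proof -
  define tr where "tr r = (\<lambda>i\<in>{..<d}. if i < r then t i else 1)" for r
  have t0: "t j \<noteq> 0" if "j < d" for j using t that by (auto simp: carrier_torus)
  have tr: "tr r \<in> carrier (torus d)" for r using t0 by (auto simp: carrier_torus tr_def)
  have "\<psi> (tr r) y = const (\<Prod>j<r. t j powi w j) * y" if "r \<le> d" for r
    using that
  proof (induction r)
    case 0
    have "tr 0 = (\<lambda>i\<in>{..<d}. 1)" by (simp add: tr_def)
    then have "\<psi> (tr 0) y = y" using apply_one[OF y] by (simp only:)
    then show ?case by simp
  next
    case (Suc r)
    then have r: "r < d" by simp
    have "tr (Suc r) = (\<lambda>i\<in>{..<d}. tr r i * cocharacter d r (t r) i)"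
      by (rule ext) (auto simp: tr_def cocharacter_def less_Suc_eq)
    then have "\<psi> (tr (Suc r)) y = \<psi> (tr r) (\<sigma> r (t r) y)"
      using apply_mult[OF tr cocharacter_in_torus[OF t0[OF r]] y] by simp
    also have "\<dots> = const (t r powi w r) * \<psi> (tr r) y"
      unfolding w[OF r t0[OF r]] by (simp add: cremona_times[OF mem[OF tr] _ y] cremona_const[OF mem[OF tr]])
    also have "\<dots> = const (\<Prod>j<Suc r. t j powi w j) * y"
      using Suc by (simp add: const_mult ac_simps)
    finally show ?case .
  qed
  moreover have "tr d = t" using t by (auto simp: tr_def carrier_torus PiE_iff extensional_def)
  ultimately show ?thesis by (metis order_refl)
qed

theorem semi_invariant_free_generators:
  assumes "rationally_triangulable n (\<psi> ` carrier (torus d))"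
  shows "\<exists>z w. semi_invariant z w"
proof -
  obtain K where K: "K n = ratfuns n" "K 0 = range const"
    and K_stable: "\<forall>i\<le>n. is_subfield (K i) \<and> (\<forall>g\<in>\<psi> ` carrier (torus d). g ` K i \<subseteq> K i)"
    and K_ext: "\<forall>i<n. one_extension (K (Suc i)) (K i)"
    using assms unfolding rationally_triangulable_def by blast
  have stable: "\<psi> t ` K i \<subseteq> K i" if "i \<le> n" "t \<in> carrier (torus d)" for i t
    using K_stable that by blast
  have ext: "one_extension (K (Suc i)) (K i)" if "i < n" for i using K_ext that by blast
  have Suc_mono: "K i \<subseteq> K (Suc i)" if "i < n" for i using ext[OF that] by (auto simp: one_extension_def)
  have sub_n: "K i \<subseteq> ratfuns n" if "i \<le> n" for i
    using that
  proof (induction rule: inc_induct)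
    case base
    then show ?case by (simp add: K(1))
  next
    case (step i)
    then show ?case using Suc_mono[of i] by blast
  qed
  have const_sub: "range const \<subseteq> K i" if "i \<le> n" for i
    using that
  proof (induction i)
    case 0
    then show ?case by (simp add: K(2))
  next
    case (Suc i)
    then show ?case using Suc_mono[of i] by simp
  qed
  have "\<exists>y w. transcendental_over (K i) y \<and> adjoin (K i) {y} = K (Suc i) \<and>
    (\<forall>j<d. \<forall>s. s \<noteq> 0 \<longrightarrow> \<sigma> j s y = const (s powi w j) * y)" if i: "i < n" for i
  proof -
    obtain z where z: "is_subfield (K i)" "transcendental_over (K i) z" "K (Suc i) = adjoin (K i) {z}"
      using ext[OF i] by (auto simp: one_extension_adjoin)
    show ?thesis
      using i by (intro semi_invariant_tower_step[OF z(1) const_sub z(2) z(3) sub_n stable stable order_refl]) auto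
  qed
  then obtain z w where z: "\<And>i. i < n \<Longrightarrow> transcendental_over (K i) (z i)"
    "\<And>i. i < n \<Longrightarrow> adjoin (K i) {z i} = K (Suc i)"
    "\<And>i j s. i < n \<Longrightarrow> j < d \<Longrightarrow> s \<noteq> 0 \<Longrightarrow> \<sigma> j s (z i) = const (s powi w i j) * z i"
    by metis
  have Ki: "K i = const_adjoin (z ` {..<i})" if "i \<le> n" for i
    using that
  proof (induction i)
    case 0
    show ?case by (simp add: K(2) const_adjoin_empty)
  next
    case (Suc i)
    then have "K (Suc i) = adjoin (const_adjoin (z ` {..<i})) {z i}" using z(2)[of i] by simp
    then show ?case by (simp add: adjoin_const_adjoin lessThan_Suc)
  qed
  have free: "free_generators n z"
    using z(1) Ki K(1) by (simp add: free_generators_def alg_indep_tower)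
  then have "semi_invariant z w"
    using z(3) free_generators_in_ratfuns
    by (auto simp: semi_invariant_def intro!: weights_from_cocharacters)
  then show ?thesis by blast
qed

lemma semi_invariant_row_operation:
  assumes zw: "semi_invariant z w" and il: "i < n" "l < n" "i \<noteq> l"
  shows "semi_invariant (z(l := z l * z i powi m)) (w(l := \<lambda>j. w l j + m * w i j))"
proof -
  have free: "free_generators n z" using zw by (simp add: semi_invariant_def)
  note zF = free_generators_in_ratfuns[OF free]
  have zi: "z i powi m \<noteq> 0" using free_generators_nonzero[OF free il(1)] by simp
  have "z i \<in> const_adjoin (z ` ({..<n} - {l}))" using il by (intro in_const_adjoin) auto
  then have "free_generators n (z(l := z i powi m * z l + 0))"
    by (intro free_generators_update[OF free il(2) _ _ zi] subfield_power_int subfield_0 subfield_adjoin)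
  then have "free_generators n (z(l := z l * z i powi m))" by (simp add: mult.commute)
  moreover have "\<psi> t (z l * z i powi m) = const (\<Prod>j<d. t j powi (w l j + m * w i j)) * (z l * z i powi m)"
    if t: "t \<in> carrier (torus d)" for t
  proof -
    have t0: "t j \<noteq> 0" if "j < d" for j using t that by (auto simp: carrier_torus)
    have "\<psi> t (z l * z i powi m) = \<psi> t (z l) * \<psi> t (z i) powi m"
      by (simp add: cremona_times[OF mem[OF t] zF[OF il(2)] subfield_power_int[OF subfield_ratfuns zF[OF il(1)]]]
          cremona_power_int[OF mem[OF t] zF[OF il(1)]])
    also have "\<dots> = const ((\<Prod>j<d. t j powi w l j) * (\<Prod>j<d. t j powi w i j) powi m) * (z l * z i powi m)"
      using zw t il by (simp add: semi_invariant_def power_int_mult_distrib const_mult const_power_int ac_simps)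
    also have "(\<Prod>j<d. t j powi w l j) * (\<Prod>j<d. t j powi w i j) powi m = (\<Prod>j<d. t j powi (w l j + m * w i j))"
    proof -
      have "(\<Prod>j<e. t j powi w i j) powi m = (\<Prod>j<e. t j powi (m * w i j))" for e
        by (induction e) (simp_all add: power_int_mult_distrib power_int_mult[symmetric] mult.commute)
      moreover have "t j powi (w l j + m * w i j) = t j powi w l j * t j powi (m * w i j)" if "j < d" for j
        using t0[OF that] by (simp add: power_int_add)
      ultimately show ?thesis by (simp add: prod.distrib)
    qed
    finally show ?thesis .
  qed
  ultimately show ?thesis using zw by (auto simp: semi_invariant_def)
qed

definition triangular :: "nat \<Rightarrow> (nat \<Rightarrow> nat \<Rightarrow> int) \<Rightarrow> bool" where
  "triangular r w \<longleftrightarrow> (\<forall>j<r. w j j \<noteq> 0 \<and> (\<forall>i. j < i \<longrightarrow> i < n \<longrightarrow> w i j = 0))"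

lemma triangular_row_operation:
  assumes "triangular r w" "r \<le> i" "i < n" "r \<le> l" "l < n"
  shows "triangular r (w(l := \<lambda>j. w l j + m * w i j))"
  using assms by (auto simp: triangular_def)

text \<open>
  If column \<open>r\<close> vanished from row \<open>r\<close> on, then a torus element with entry \<open>c \<noteq> 1\<close> at \<open>r\<close>, entries \<open>1\<close> after
  \<open>r\<close>, and entries before \<open>r\<close> solving the first \<open>r\<close> equations would act trivially on all generators.
\<close>

lemma exists_pivot:
  assumes zw: "semi_invariant z w" "triangular r w" and r: "r < d" "r \<le> n"
  shows "\<exists>i. r \<le> i \<and> i < n \<and> w i r \<noteq> 0"
proof (rule ccontr)
  assume no: "\<not> ?thesis"
  obtain c :: 'k where c: "c \<noteq> 0" "c \<noteq> 1"
  proof -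
    have "infinite (UNIV - {0, 1 :: 'k})" using infinite_alg_closed by (rule Diff_infinite_finite[rotated]) simp
    then have "UNIV - {0, 1 :: 'k} \<noteq> {}" by (metis finite.emptyI)
    then show thesis using that by blast
  qed
  define u where "u l = (if l = r then c else 1)" for l
  have "\<exists>t. (\<forall>l<d. t l \<noteq> 0) \<and> (\<forall>l. r \<le> l \<longrightarrow> l < d \<longrightarrow> t l = u l) \<and>
    (\<forall>i<r. (\<Prod>j<d. t j powi w i j) = 1)"
    by (rule triangular_monomial_system) (use zw(2) r c in \<open>auto simp: u_def triangular_def\<close>)
  then obtain t0 where t0: "\<And>l. l < d \<Longrightarrow> t0 l \<noteq> 0" "\<And>l. r \<le> l \<Longrightarrow> l < d \<Longrightarrow> t0 l = u l"
    "\<And>i. i < r \<Longrightarrow> (\<Prod>j<d. t0 j powi w i j) = 1"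
    by blast
  define t where "t = (\<lambda>i\<in>{..<d}. t0 i)"
  have t: "t \<in> carrier (torus d)" using t0(1) by (auto simp: t_def carrier_torus)
  let ?e = "\<lambda>i\<in>{..<d}. 1 :: 'k"
  have e: "?e \<in> carrier (torus d)" by (auto simp: carrier_torus)
  have weight: "(\<Prod>j<d. t j powi w i j) = 1" if i: "i < n" for i
  proof (cases "i < r")
    case True
    then show ?thesis using t0(3) by (simp add: t_def)
  next
    case False
    have "t j powi w i j = 1" if "j < d" for j
    proof -
      consider "j < r" | "j = r" | "r < j" by linarith
      then show ?thesis
      proof cases
        case 1
        then have "w i j = 0" using zw(2) False i by (auto simp: triangular_def)
        then show ?thesis by simp
      next
        case 2
        then have "w i j = 0" using no False i by auto
        then show ?thesis by simp
      next
        case 3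
        then show ?thesis using t0(2)[of j] that by (simp add: t_def u_def)
      qed
    qed
    then show ?thesis by simp
  qed
  have free: "free_generators n z" using zw(1) by (simp add: semi_invariant_def)
  have fix_z: "\<psi> t (z i) = z i" if "i < n" for i
    using zw(1) weight[OF that] t that by (simp add: semi_invariant_def)
  have "\<psi> t f = \<psi> ?e f" if f: "f \<in> ratfuns n" for f
  proof -
    have "is_subfield {f \<in> ratfuns n. \<psi> t f = f}"
      by (rule is_subfieldI) (auto simp: cremona_add[OF mem[OF t]] cremona_times[OF mem[OF t]]
          cremona_uminus[OF mem[OF t]] cremona_inverse[OF mem[OF t]] cremona_0[OF mem[OF t]] cremona_1[OF mem[OF t]]
          intro: subfield_closed[OF subfield_ratfuns])
    then have "const_adjoin (z ` {..<n}) \<subseteq> {f \<in> ratfuns n. \<psi> t f = f}"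
      by (rule const_adjoin_least) (auto simp: cremona_const[OF mem[OF t]] fix_z free_generators_in_ratfuns[OF free])
    then have "\<psi> t f = f" using f free by (auto simp: free_generators_def)
    then show ?thesis using apply_one[OF f] by (simp only:)
  qed
  then have "\<psi> t = \<psi> ?e"
    using var_in_ratfuns by (intro cremona_eqI[OF mem[OF t] mem[OF e]]) blast
  then have "t = ?e" using inj t e by (auto dest: inj_onD)
  then have "t r = 1" using r(1) by simp
  then show False using t0(2)[of r] r(1) c by (simp add: t_def u_def)
qed

text \<open>
  The Euclidean algorithm on the part of column \<open>r\<close> from row \<open>r\<close> on, in the form of a minimality argument:
  choose generators for which the sum of the absolute values in this part is least. If there were
  two non-zero entries, adding or subtracting the row of the smaller one would decrease the other, so
  exactly one is left. The pivot found by \<open>exists_pivot\<close> also shows \<open>r < n\<close>.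
\<close>

theorem semi_invariant_triangular:
  assumes start: "\<exists>z w. semi_invariant z w" and "r \<le> d"
  shows "r \<le> n \<and> (\<exists>z w. semi_invariant z w \<and> triangular r w)"
  using assms(2)
proof (induction r)
  case 0
  then show ?case using start by (simp add: triangular_def)
next
  case (Suc r)
  then have r: "r < d" "r \<le> n" by auto
  define S where "S w = (\<Sum>i\<in>{r..<n}. nat \<bar>w i r\<bar>)" for w :: "nat \<Rightarrow> nat \<Rightarrow> int"
  define Q where "Q m \<longleftrightarrow> (\<exists>z w. semi_invariant z w \<and> triangular r w \<and> S w = m)" for m
  have "\<exists>m. Q m" using Suc by (auto simp: Q_def)
  then have "Q (LEAST m. Q m)" by (rule LeastI_ex)
  then obtain z w where zw: "semi_invariant z w" "triangular r w" and S: "S w = (LEAST m. Q m)"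
    unfolding Q_def by blast
  have minimal: "S w \<le> S w'" if "semi_invariant z' w'" "triangular r w'" for z' w'
    unfolding S by (rule Least_le) (use that in \<open>auto simp: Q_def\<close>)
  obtain i where i: "r \<le> i" "i < n" "w i r \<noteq> 0" using exists_pivot[OF zw r] by blast
  have le: "\<bar>w l r\<bar> < \<bar>w a r\<bar>"
    if nz: "w a r \<noteq> 0" "w l r \<noteq> 0" and al: "r \<le> a" "a < n" "r \<le> l" "l < n" "a \<noteq> l" for a l
  proof (rule ccontr)
    assume ge: "\<not> \<bar>w l r\<bar> < \<bar>w a r\<bar>"
    \<comment> \<open>Adding \<open>m\<close> times row \<open>a\<close> moves the entry of row \<open>l\<close>, which is not the smaller one, towards zero.\<close>
    define m where "m = - (sgn (w a r) * sgn (w l r))"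
    let ?w = "w(l := \<lambda>j. w l j + m * w a j)"
    have small: "\<bar>?w l r\<bar> < \<bar>w l r\<bar>"
      using ge nz by (auto simp: m_def sgn_if abs_if split: if_splits)
    have "S ?w < S w"
      unfolding S_def
    proof (rule sum_strict_mono_ex1)
      show "\<forall>a\<in>{r..<n}. nat \<bar>?w a r\<bar> \<le> nat \<bar>w a r\<bar>" using small by auto
      show "\<exists>a\<in>{r..<n}. nat \<bar>?w a r\<bar> < nat \<bar>w a r\<bar>" using small al by (intro bexI[of _ l]) auto
    qed simp
    then show False
      using minimal[OF semi_invariant_row_operation[OF zw(1) al(2,4,5)] triangular_row_operation[OF zw(2) al(1-4)], of m]
      by simp
  qed
  have others: "w l r = 0" if "r \<le> l" "l < n" "l \<noteq> i" for l
    using le[of i l] le[of l i] i that by fastforce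
  have "\<exists>z w. semi_invariant z w \<and> triangular r w \<and> w r r \<noteq> 0 \<and> (\<forall>l. r < l \<longrightarrow> l < n \<longrightarrow> w l r = 0)"
  proof (cases "i = r")
    case True
    then show ?thesis using zw i others by (intro exI[of _ z] exI[of _ w]) auto
  next
    case False
    then have rn: "r < n" "r \<noteq> i" using i by auto
    \<comment> \<open>The pivot is moved into row \<open>r\<close>, where the entry is zero, by adding its row to row \<open>r\<close> and then
      subtracting the result from row \<open>i\<close>; this avoids permuting the generators.\<close>
    define w1 where "w1 = w(r := \<lambda>j. w r j + 1 * w i j)"
    have 1: "semi_invariant (z(r := z r * z i powi 1)) w1" "triangular r w1"
      unfolding w1_def using i rn zw
      by (intro semi_invariant_row_operation triangular_row_operation; simp)+
    define w2 where "w2 = w1(i := \<lambda>j. w1 i j + (- 1) * w1 r j)"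
    obtain z2 where 2: "semi_invariant z2 w2" "triangular r w2"
      unfolding w2_def using i rn semi_invariant_row_operation[OF 1(1) rn(1) i(2) rn(2), of "- 1"]
        triangular_row_operation[OF 1(2) order_refl rn(1) i(1,2), of "- 1"] by blast
    have "w r r = 0" using others[of r] rn by simp
    then have "w2 r r \<noteq> 0" "w2 i r = 0" "\<And>l. l \<noteq> r \<Longrightarrow> l \<noteq> i \<Longrightarrow> w2 l r = w l r"
      using i rn by (simp_all add: w2_def w1_def)
    then show ?thesis
      using 2 others by (intro exI[of _ z2] exI[of _ w2]) (metis less_imp_le less_irrefl)
  qed
  then obtain z' w' where zw': "semi_invariant z' w'" "triangular r w'" "w' r r \<noteq> 0"
    "\<And>l. r < l \<Longrightarrow> l < n \<Longrightarrow> w' l r = 0" by blast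
  then have "triangular (Suc r) w'" by (auto simp: triangular_def less_Suc_eq)
  then show ?case using zw'(1) i by auto
qed

end

section \<open>Triangularizing commuting linear maps\<close>

locale alg_closed_vector_space = vector_space scale
  for scale :: "'k::alg_closed_field \<Rightarrow> 'v::ab_group_add \<Rightarrow> 'v" (infixr "*s" 75)
begin

lemma dim_strict_mono:
  assumes U: "subspace U'" "U' \<subset> U" and B: "finite B" "U \<subseteq> span B"
  shows "dim U' < dim U"
proof -
  obtain B' where B': "B' \<subseteq> U'" "independent B'" "U' \<subseteq> span B'" "card B' = dim U'"
    by (rule basis_exists)
  obtain u where u: "u \<in> U" "u \<notin> U'" using U(2) by blast
  have "span B' \<subseteq> U'" by (rule span_minimal[OF B'(1) U(1)])
  then have u': "u \<notin> span B'" using u(2) by blast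
  then have "u \<notin> B'" using span_base by blast
  have ind: "independent (insert u B')" using B'(2) u' by (simp add: independent_insert)
  have "insert u B' \<subseteq> U" using B'(1) u(1) U(2) by blast
  then obtain B'' where B'': "insert u B' \<subseteq> B''" "B'' \<subseteq> U" "independent B''" "U \<subseteq> span B''"
    using maximal_independent_subset_extend[OF _ ind] by blast
  have fin: "finite B''" using independent_span_bound[OF B(1) B''(3)] B''(2) B(2) by blast
  then have "card (insert u B') \<le> card B''" using B''(1) by (rule card_mono)
  moreover have "card (insert u B') = Suc (card B')"
    using \<open>u \<notin> B'\<close> finite_subset[OF B''(1) fin] by simp
  ultimately show ?thesis using basis_card_eq_dim[OF B''(2,4,3)] B'(4) by simp
qed

text \<open>
  \<open>p(g) u\<close> by Horner's scheme. Only a stable subspace carries a linear map here, so \<open>g\<close> cannot be made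
  into an element of a ring of endomorphisms to which a polynomial could be applied.
\<close>

definition poly_action :: "('v \<Rightarrow> 'v) \<Rightarrow> 'v \<Rightarrow> 'k poly \<Rightarrow> 'v" where
  "poly_action g u p = foldr (\<lambda>a v. a *s u + g v) (coeffs p) 0"

lemma poly_action_0 [simp]: "poly_action g u 0 = 0"
  by (simp add: poly_action_def)

lemma poly_action_pCons:
  assumes "g 0 = 0" shows "poly_action g u (pCons a p) = a *s u + g (poly_action g u p)"
  using assms by (cases "a = 0 \<and> p = 0") (auto simp: poly_action_def cCons_def)

definition linear_endo :: "'v set \<Rightarrow> ('v \<Rightarrow> 'v) \<Rightarrow> bool" where
  "linear_endo U g \<longleftrightarrow> (\<forall>a\<in>U. g a \<in> U) \<and> (\<forall>a\<in>U. \<forall>b\<in>U. g (a + b) = g a + g b) \<and>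
     (\<forall>c. \<forall>a\<in>U. g (c *s a) = c *s g a)"

lemma linear_endo_0: "linear_endo U g \<Longrightarrow> subspace U \<Longrightarrow> g 0 = 0"
  unfolding linear_endo_def by (metis scale_zero_left subspace_0)

context
  fixes U :: "'v set" and g :: "'v \<Rightarrow> 'v" and u :: 'v
  assumes U: "subspace U" and g: "linear_endo U g" and u: "u \<in> U"
begin

lemma poly_action_in: "poly_action g u p \<in> U"
proof (induction p)
  case 0
  then show ?case using subspace_0[OF U] by simp
next
  case (pCons a p)
  then show ?case
    unfolding poly_action_pCons[of g, OF linear_endo_0[OF g U]]
    using g u by (intro subspace_add[OF U] subspace_scale[OF U]) (auto simp: linear_endo_def)
qed

lemma poly_action_add: "poly_action g u (p + q) = poly_action g u p + poly_action g u q"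
proof (induction p q rule: poly_induct2)
  case (pCons a p b q)
  have "g (poly_action g u p + poly_action g u q) = g (poly_action g u p) + g (poly_action g u q)"
    using g poly_action_in by (simp add: linear_endo_def)
  then show ?case
    using pCons by (simp add: poly_action_pCons[of g, OF linear_endo_0[OF g U]] scale_left_distrib)
qed simp

lemma poly_action_smult: "poly_action g u (smult c p) = c *s poly_action g u p"
proof (induction p)
  case (pCons a p)
  have "g (c *s poly_action g u p) = c *s g (poly_action g u p)"
    using g poly_action_in by (simp add: linear_endo_def)
  then show ?case
    using pCons by (simp add: poly_action_pCons[of g, OF linear_endo_0[OF g U]] scale_right_distrib)
qed simp

lemma poly_action_sum: "poly_action g u (sum f S) = (\<Sum>i\<in>S. poly_action g u (f i))"
  by (induction S rule: infinite_finite_induct) (simp_all add: poly_action_add)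

text \<open>
  Otherwise the vectors \<open>g\<^sup>i u\<close> would be linearly independent, more than \<open>card B\<close> of them in the span
  of \<open>B\<close>.
\<close>

lemma poly_action_annihilator:
  assumes B: "finite B" "U \<subseteq> span B"
  shows "\<exists>p. p \<noteq> 0 \<and> poly_action g u p = 0"
proof (rule ccontr)
  assume "\<not> ?thesis"
  then have inj0: "p = 0" if "poly_action g u p = 0" for p using that by blast
  let ?f = "\<lambda>i. poly_action g u (monom 1 i)"
  have inj: "inj_on ?f {..card B}"
  proof (rule inj_onI)
    fix i j assume "?f i = ?f j"
    then have "poly_action g u (monom 1 i + smult (- 1) (monom 1 j)) = 0"
      unfolding poly_action_add poly_action_smult by simp
    then have "monom 1 i + smult (- 1) (monom 1 j) = (0 :: 'k poly)" by (rule inj0)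
    then have "coeff (monom 1 i + smult (- 1) (monom 1 j)) i = (0 :: 'k)" by simp
    then show "i = j" by (auto split: if_splits)
  qed
  have "independent (?f ` {..card B})"
  proof (rule independent_if_scalars_zero)
    fix h x assume "(\<Sum>x\<in>?f ` {..card B}. h x *s x) = 0" and x: "x \<in> ?f ` {..card B}"
    then have "(\<Sum>i\<le>card B. h (?f i) *s ?f i) = 0" by (simp add: sum.reindex[OF inj])
    then have "poly_action g u (\<Sum>i\<le>card B. smult (h (?f i)) (monom 1 i)) = 0"
      unfolding poly_action_sum poly_action_smult .
    then have "(\<Sum>i\<le>card B. smult (h (?f i)) (monom 1 i)) = 0" by (rule inj0)
    then have "coeff (\<Sum>i\<le>card B. smult (h (?f i)) (monom 1 i)) j = 0" for j by simp
    then have "h (?f j) = 0" if "j \<le> card B" for j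
    proof -
      have "coeff (\<Sum>i\<le>card B. smult (h (?f i)) (monom 1 i)) j = (\<Sum>i\<le>card B. if i = j then h (?f j) else 0)"
        unfolding coeff_sum by (rule sum.cong) auto
      also have "\<dots> = h (?f j)" using that by simp
      finally show ?thesis using \<open>\<And>j. coeff (\<Sum>i\<le>card B. smult (h (?f i)) (monom 1 i)) j = 0\<close> by simp
    qed
    then show "h x = 0" using x by blast
  qed simp
  moreover have "?f ` {..card B} \<subseteq> span B" using poly_action_in B(2) by blast
  ultimately have "card (?f ` {..card B}) \<le> card B" using independent_span_bound[OF B(1)] by blast
  then show False by (simp add: card_image[OF inj])
qed

end

text \<open>
  Choose \<open>u\<close> outside \<open>W\<close> and \<open>p \<noteq> 0\<close> of least degree with \<open>p(g) u \<in> W\<close>. If \<open>p = (X - c) q\<close>, then \<open>q(g) u\<close>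
  is outside \<open>W\<close> by minimality and an eigenvector modulo \<open>W\<close>. The argument works inside \<open>U\<close> and
  avoids the quotient space.
\<close>

lemma eigenvector_modulo_subspace:
  assumes U: "subspace U" and B: "finite B" "U \<subseteq> span B" and g: "linear_endo U g"
    and W: "subspace W" "W \<subset> U"
  shows "\<exists>c u. u \<in> U \<and> u \<notin> W \<and> g u - c *s u \<in> W"
proof -
  define Q where "Q m \<longleftrightarrow> (\<exists>p u. Polynomial.degree p = m \<and> p \<noteq> 0 \<and> u \<in> U \<and> u \<notin> W \<and> poly_action g u p \<in> W)" for m
  obtain u0 where u0: "u0 \<in> U" "u0 \<notin> W" using W(2) by blast
  obtain p0 where "p0 \<noteq> 0" "poly_action g u0 p0 = 0"
    using poly_action_annihilator[OF U g u0(1) B] by blast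
  then have "Q (Polynomial.degree p0)" unfolding Q_def using u0 subspace_0[OF W(1)] by metis
  then have "Q (LEAST m. Q m)" by (rule LeastI)
  then obtain p u where p: "Polynomial.degree p = (LEAST m. Q m)" "p \<noteq> 0" "u \<in> U" "u \<notin> W" "poly_action g u p \<in> W"
    unfolding Q_def by blast
  note lin0 = linear_endo_0[OF g U]
  have "Polynomial.degree p \<noteq> 0"
  proof
    assume "Polynomial.degree p = 0"
    then obtain a where a: "p = [:a:]" by (rule degree_eq_zeroE)
    then have "a *s u \<in> W" using p(5) by (simp add: poly_action_pCons[of g, OF lin0] lin0)
    then have "inverse a *s (a *s u) \<in> W" by (rule subspace_scale[OF W(1)])
    moreover have "a \<noteq> 0" using p(2) a by simp
    ultimately show False using p(4) by simp
  qed
  then obtain c where "poly p c = 0" using alg_closed_imp_poly_has_root[of p] by auto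
  then obtain q where q: "p = [:- c, 1:] * q" using poly_eq_0_iff_dvd[of p c] by (auto elim: dvdE)
  have q0: "q \<noteq> 0" using p(2) q by auto
  then have "Polynomial.degree q < Polynomial.degree p" unfolding q by (subst degree_mult_eq) auto
  then have "\<not> Q (Polynomial.degree q)" unfolding p(1) by (rule not_less_Least)
  then have "poly_action g u q \<notin> W" unfolding Q_def using q0 p(3,4) by blast
  moreover have "poly_action g u q \<in> U" by (rule poly_action_in[OF U g p(3)])
  moreover have "g (poly_action g u q) - c *s poly_action g u q \<in> W"
  proof -
    have "p = smult (- c) q + pCons 0 q" by (simp add: q)
    then have "poly_action g u p = - (c *s poly_action g u q) + g (poly_action g u q)"
      by (simp only: poly_action_add[OF U g p(3)] poly_action_smult[OF U g p(3)] poly_action_pCons[of g, OF lin0]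
          scale_minus_left scale_zero_left add_0)
    then have "g (poly_action g u q) - c *s poly_action g u q = poly_action g u p" by simp
    then show ?thesis using p(5) by (simp only:)
  qed
  ultimately show ?thesis by blast
qed

text \<open>
  Among the stable subspaces of \<open>V\<close> that strictly contain \<open>W\<close>, let \<open>U\<close> have least dimension. The
  eigenspace modulo \<open>W\<close> of one of the maps in \<open>U\<close> is stable under all of them because they commute, so
  it is all of \<open>U\<close>. Hence each map acts on \<open>U\<close> modulo \<open>W\<close> as a scalar.
\<close>

theorem common_eigenvector_modulo_subspace:
  assumes V: "subspace V" "finite B" "V \<subseteq> span B" and W: "subspace W" "W \<subset> V"
    and lin: "\<And>g. g \<in> T \<Longrightarrow> linear_endo V g" and stable: "\<And>g w. g \<in> T \<Longrightarrow> w \<in> W \<Longrightarrow> g w \<in> W"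
    and comm: "\<And>g h v. g \<in> T \<Longrightarrow> h \<in> T \<Longrightarrow> v \<in> V \<Longrightarrow> g (h v) = h (g v)"
  obtains u where "u \<in> V" "u \<notin> W" "\<And>g. g \<in> T \<Longrightarrow> \<exists>c. g u - c *s u \<in> W"
proof -
  define Q where "Q U \<longleftrightarrow> subspace U \<and> W \<subset> U \<and> U \<subseteq> V \<and> (\<forall>g\<in>T. \<forall>v\<in>U. g v \<in> U)" for U
  have "Q V" using V W lin by (auto simp: Q_def linear_endo_def)
  then obtain U where U: "Q U" and minimal: "\<And>U'. Q U' \<Longrightarrow> dim U \<le> dim U'"
    using ex_has_least_nat[of Q V dim] by blast
  have sub: "subspace U" "W \<subset> U" "U \<subseteq> V" and Ust: "\<And>g v. g \<in> T \<Longrightarrow> v \<in> U \<Longrightarrow> g v \<in> U"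
    using U by (auto simp: Q_def)
  have scalar: "\<exists>c. \<forall>v\<in>U. g v - c *s v \<in> W" if gT: "g \<in> T" for g
  proof -
    have gU: "linear_endo U g"
      using lin[OF gT] Ust[OF gT] subsetD[OF sub(3)] by (simp add: linear_endo_def)
    obtain c u where cu: "u \<in> U" "u \<notin> W" "g u - c *s u \<in> W"
      using eigenvector_modulo_subspace[OF sub(1) V(2) order_trans[OF sub(3) V(3)] gU W(1) sub(2)] by blast
    define U' where "U' = {v \<in> U. g v - c *s v \<in> W}"
    have "subspace U'"
    proof (rule subspaceI)
      show "0 \<in> U'"
        using subspace_0[OF sub(1)] subspace_0[OF W(1)] linear_endo_0[OF gU sub(1)] by (simp add: U'_def)
      show "x + y \<in> U'" if "x \<in> U'" "y \<in> U'" for x y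
      proof -
        have "g (x + y) - c *s (x + y) = (g x - c *s x) + (g y - c *s y)"
          using that gU by (simp add: U'_def linear_endo_def scale_right_distrib)
        then show ?thesis using that subspace_add[OF sub(1)] subspace_add[OF W(1)] by (simp add: U'_def)
      qed
      show "e *s x \<in> U'" if "x \<in> U'" for e x
      proof -
        have "g (e *s x) - c *s (e *s x) = e *s (g x - c *s x)"
          using that gU by (simp add: U'_def linear_endo_def scale_right_diff_distrib mult.commute)
        then show ?thesis using that subspace_scale[OF sub(1)] subspace_scale[OF W(1)] by (simp add: U'_def)
      qed
    qed
    moreover have "W \<subseteq> U'"
      using sub(2) stable[OF gT] subspace_diff[OF W(1)] subspace_scale[OF W(1)] by (auto simp: U'_def)
    moreover have "u \<in> U'" using cu by (simp add: U'_def)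
    moreover have "h v \<in> U'" if h: "h \<in> T" and v: "v \<in> U'" for h v
    proof -
      have vV: "v \<in> U" "v \<in> V" using v sub(3) by (auto simp: U'_def)
      have hlin: "linear_endo V h" by (rule lin[OF h])
      have gv: "g v \<in> V" using Ust[OF gT vV(1)] sub(3) by blast
      have "h (g v + (- c) *s v) = h (g v) + h ((- c) *s v)"
        using hlin gv subspace_scale[OF V(1) vV(2), of "- c"] unfolding linear_endo_def by blast
      also have "h ((- c) *s v) = (- c) *s h v"
        using hlin vV(2) unfolding linear_endo_def by blast
      finally have "g (h v) - c *s h v = h (g v - c *s v)" by (simp add: comm[OF gT h vV(2)])
      also have "\<dots> \<in> W" using v by (intro stable[OF h]) (simp add: U'_def)
      finally show ?thesis using Ust[OF h vV(1)] by (simp add: U'_def)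
    qed
    ultimately have "Q U'" using cu(2) sub(3) by (auto simp: Q_def U'_def)
    then have "dim U \<le> dim U'" by (rule minimal)
    then have "\<not> U' \<subset> U"
      using dim_strict_mono[OF \<open>subspace U'\<close> _ V(2) order_trans[OF sub(3) V(3)]] by fastforce
    then have "U' = U" by (auto simp: U'_def)
    then show ?thesis by (auto simp: U'_def)
  qed
  obtain u where "u \<in> U" "u \<notin> W" using sub(2) by blast
  then show thesis using that[of u] scalar sub(3) by blast
qed

end

section \<open>Flags of fields from flags of linear forms\<close>

interpretation ratfun_space: alg_closed_vector_space
  "\<lambda>(c :: 'k::alg_closed_field) (f :: 'k ratfun). const c * f"
  by unfold_locales (simp_all add: algebra_simps const_add const_mult)

lemma subspace_subfield:
  assumes "is_subfield M" "range const \<subseteq> M" shows "ratfun_space.subspace M"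
  using assms by (intro ratfun_space.subspaceI) (auto intro: subfield_closed[OF assms(1)])

lemma span_in_const_adjoin: "ratfun_space.span S \<subseteq> const_adjoin S"
proof (rule ratfun_space.span_minimal)
  show "S \<subseteq> const_adjoin S" using in_const_adjoin by blast
  show "ratfun_space.subspace (const_adjoin S)"
    by (rule subspace_subfield[OF subfield_adjoin]) auto
qed

lemma span_image_eq_sums:
  assumes "finite I" "u \<in> ratfun_space.span (y ` I)"
  shows "\<exists>a. u = (\<Sum>i\<in>I. const (a i) * y i)"
proof -
  have "ratfun_space.subspace {u. \<exists>a. u = (\<Sum>i\<in>I. const (a i) * y i)}"
  proof (rule ratfun_space.subspaceI)
    show "0 \<in> {u. \<exists>a. u = (\<Sum>i\<in>I. const (a i) * y i)}"
      by (intro CollectI exI[of _ "\<lambda>_. 0"]) simp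
    fix u v assume "u \<in> {u. \<exists>a. u = (\<Sum>i\<in>I. const (a i) * y i)}" "v \<in> {u. \<exists>a. u = (\<Sum>i\<in>I. const (a i) * y i)}"
    then obtain a b where "u = (\<Sum>i\<in>I. const (a i) * y i)" "v = (\<Sum>i\<in>I. const (b i) * y i)" by blast
    then show "u + v \<in> {u. \<exists>a. u = (\<Sum>i\<in>I. const (a i) * y i)}"
      by (intro CollectI exI[of _ "\<lambda>i. a i + b i"]) (simp add: const_add distrib_right sum.distrib)
  next
    fix c u assume "u \<in> {u. \<exists>a. u = (\<Sum>i\<in>I. const (a i) * y i)}"
    then obtain a where a: "u = (\<Sum>i\<in>I. const (a i) * y i)" by blast
    have "const c * u = (\<Sum>i\<in>I. const (c * a i) * y i)"
      unfolding a sum_distrib_left const_mult mult.assoc ..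
    then show "const c * u \<in> {u. \<exists>a. u = (\<Sum>i\<in>I. const (a i) * y i)}"
      by (intro CollectI exI[of _ "\<lambda>i. c * a i"])
  qed
  moreover have "y ` I \<subseteq> {u. \<exists>a. u = (\<Sum>i\<in>I. const (a i) * y i)}"
  proof
    fix u assume "u \<in> y ` I"
    then obtain l where l: "l \<in> I" "u = y l" by blast
    have "(\<Sum>i\<in>I. const (if i = l then 1 else 0) * y i) = (\<Sum>i\<in>I. if i = l then y l else 0)"
      by (rule sum.cong) auto
    then have "u = (\<Sum>i\<in>I. const (if i = l then 1 else 0) * y i)" using assms(1) l by simp
    then show "u \<in> {u. \<exists>a. u = (\<Sum>i\<in>I. const (a i) * y i)}"
      by (intro CollectI exI[of _ "\<lambda>i. if i = l then 1 else 0"])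
  qed
  ultimately have "ratfun_space.span (y ` I) \<subseteq> {u. \<exists>a. u = (\<Sum>i\<in>I. const (a i) * y i)}"
    by (intro ratfun_space.span_minimal)
  then show ?thesis using assms(2) by blast
qed

lemma cremona_image_span:
  assumes g: "g \<in> carrier (cremona n)" and S: "S \<subseteq> ratfuns n" and M: "ratfun_space.subspace M"
    and gS: "\<And>a. a \<in> S \<Longrightarrow> g a \<in> M" and f: "f \<in> ratfun_space.span S"
  shows "g f \<in> M"
proof -
  have "ratfun_space.span S \<subseteq> {f \<in> ratfuns n. g f \<in> M}"
  proof (rule ratfun_space.span_minimal)
    show "S \<subseteq> {f \<in> ratfuns n. g f \<in> M}" using S gS by blast
    show "ratfun_space.subspace {f \<in> ratfuns n. g f \<in> M}"
      by (rule ratfun_space.subspaceI)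
        (auto simp: cremona_0[OF g] cremona_add[OF g] cremona_times[OF g] cremona_const[OF g]
          intro: subfield_closed[OF subfield_ratfuns] ratfun_space.subspace_0[OF M]
            ratfun_space.subspace_add[OF M] ratfun_space.subspace_scale[OF M])
  qed
  then show ?thesis using f by blast
qed

lemma alg_indep_subset: "alg_indep J z \<Longrightarrow> I \<subseteq> J \<Longrightarrow> alg_indep I z"
  using polys_in_mono[of I J] by (auto simp: alg_indep_def)

text \<open>
  A flag of subspaces given by an increasing chain of index sets. The chain takes the place of a
  reordering of the generators: the basis vector that is exchanged in a step may have any index outside
  the present set.
\<close>

definition stable_flag ::
    "nat \<Rightarrow> ('k::alg_closed_field ratfun \<Rightarrow> 'k ratfun) set \<Rightarrow> (nat \<Rightarrow> 'k ratfun) \<Rightarrow> (nat \<Rightarrow> nat set) \<Rightarrow> nat \<Rightarrow> bool"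
where
  "stable_flag n T y I r \<longleftrightarrow>
    I 0 = {} \<and> (\<forall>q<r. \<exists>l<n. l \<notin> I q \<and> I (Suc q) = insert l (I q)) \<and>
    (\<forall>q\<le>r. I q \<subseteq> {..<n} \<and> card (I q) = q \<and>
       (\<forall>i\<in>I q. \<forall>g\<in>T. g (y i) \<in> ratfun_space.span (y ` I q)))"

text \<open>
  The flag is extended by a common eigenvector \<open>u\<close> modulo its last member \<open>W\<close>. Some generator \<open>y l\<close>
  outside \<open>W\<close> occurs in \<open>u\<close>, and exchanging it for \<open>u\<close> is an invertible affine change of \<open>y l\<close>,
  so the generators stay free.
\<close>

lemma commuting_linear_flag:
  fixes z :: "nat \<Rightarrow> 'k::alg_closed_field ratfun"
  assumes T: "T \<subseteq> carrier (cremona n)"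
    and comm: "\<And>g h f. g \<in> T \<Longrightarrow> h \<in> T \<Longrightarrow> f \<in> ratfuns n \<Longrightarrow> g (h f) = h (g f)"
    and free: "free_generators n z"
    and lin: "\<And>g i. g \<in> T \<Longrightarrow> i < n \<Longrightarrow> g (z i) \<in> ratfun_space.span (z ` {..<n})"
    and r: "r \<le> n"
  shows "\<exists>y I. free_generators n y \<and> ratfun_space.span (y ` {..<n}) = ratfun_space.span (z ` {..<n}) \<and>
    stable_flag n T y I r"
  using r
proof (induction r)
  case 0
  show ?case using free by (intro exI[of _ z] exI[of _ "\<lambda>_. {}"]) (auto simp: stable_flag_def)
next
  case (Suc r)
  define V where "V = ratfun_space.span (z ` {..<n})"
  obtain y I where y: "free_generators n y" "ratfun_space.span (y ` {..<n}) = V"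
    and flag: "stable_flag n T y I r"
    using Suc by (auto simp: V_def)
  from flag have I0: "I 0 = {}"
    and I_step: "\<And>q. q < r \<Longrightarrow> \<exists>l<n. l \<notin> I q \<and> I (Suc q) = insert l (I q)"
    and I_stable: "\<And>q. q \<le> r \<Longrightarrow> I q \<subseteq> {..<n} \<and> card (I q) = q \<and>
       (\<forall>i\<in>I q. \<forall>g\<in>T. g (y i) \<in> ratfun_space.span (y ` I q))"
    unfolding stable_flag_def by blast+
  define W where "W = ratfun_space.span (y ` I r)"
  have Ir: "I r \<subseteq> {..<n}" "card (I r) = r" using I_stable[of r] by auto
  have fin: "finite (I r)" using Ir(1) finite_subset by blast
  have yF: "y ` {..<n} \<subseteq> ratfuns n" using free_generators_in_ratfuns[OF y(1)] by auto
  have zF: "z ` {..<n} \<subseteq> ratfuns n" using free_generators_in_ratfuns[OF free] by auto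
  have subF: "ratfun_space.subspace (ratfuns n)" by (rule subspace_subfield[OF subfield_ratfuns]) auto
  have VF: "V \<subseteq> ratfuns n" unfolding V_def by (rule ratfun_space.span_minimal[OF zF subF])
  have subV: "ratfun_space.subspace V" and subW: "ratfun_space.subspace W" by (simp_all add: V_def W_def)
  obtain l0 where l0: "l0 < n" "l0 \<notin> I r"
  proof -
    have "I r \<noteq> {..<n}"
    proof
      assume "I r = {..<n}"
      then have "card (I r) = n" by simp
      then show False using Ir(2) Suc.prems by linarith
    qed
    then show thesis using that Ir(1) by blast
  qed
  \<comment> \<open>Algebraic independence is used here in place of linear independence.\<close>
  have "y l0 \<notin> W"
  proof -
    have "alg_indep (insert l0 (I r)) y"
      using y(1) l0 Ir(1) by (auto simp: free_generators_def intro!: alg_indep_subset[of "{..<n}"])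
    then have "transcendental_over (const_adjoin (y ` I r)) (y l0)"
      using alg_indep_insert[OF fin l0(2), of y] by simp
    then have "y l0 \<notin> const_adjoin (y ` I r)"
      by (rule transcendental_over_notin) (rule subfield_adjoin)
    then show ?thesis unfolding W_def using span_in_const_adjoin by blast
  qed
  moreover have "y l0 \<in> V" unfolding y(2)[symmetric] using l0(1) by (intro ratfun_space.span_base) simp
  moreover have "W \<subseteq> V" unfolding W_def y(2)[symmetric] using Ir(1) by (intro ratfun_space.span_mono) blast
  ultimately have WV: "W \<subset> V" by blast
  have gV: "g f \<in> V" if g: "g \<in> T" and f: "f \<in> V" for g f
  proof (rule cremona_image_span[of g n "z ` {..<n}" V f, OF _ zF subV])
    show "g \<in> carrier (cremona n)" using g T by blast
    show "g a \<in> V" if "a \<in> z ` {..<n}" for a using that lin[OF g] unfolding V_def by blast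
    show "f \<in> ratfun_space.span (z ` {..<n})" using f unfolding V_def .
  qed
  have gW: "g f \<in> W" if g: "g \<in> T" and f: "f \<in> W" for g f
  proof (rule cremona_image_span[of g n "y ` I r" W f, OF _ _ subW])
    show "g \<in> carrier (cremona n)" using g T by blast
    show "y ` I r \<subseteq> ratfuns n" using yF Ir(1) by blast
    show "g a \<in> W" if "a \<in> y ` I r" for a using that I_stable[OF order_refl] g unfolding W_def by blast
    show "f \<in> ratfun_space.span (y ` I r)" using f unfolding W_def .
  qed
  have linV: "ratfun_space.linear_endo V g" if g: "g \<in> T" for g
    unfolding ratfun_space.linear_endo_def
  proof (intro conjI ballI allI)
    have gc: "g \<in> carrier (cremona n)" using g T by blast
    show "g a \<in> V" if "a \<in> V" for a by (rule gV[OF g that])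
    show "g (a + b) = g a + g b" if "a \<in> V" "b \<in> V" for a b
      by (rule cremona_add[OF gc subsetD[OF VF that(1)] subsetD[OF VF that(2)]])
    show "g (const c * a) = const c * g a" if "a \<in> V" for c a
      by (simp only: cremona_times[OF gc const_in_ratfuns subsetD[OF VF that]] cremona_const[OF gc])
  qed
  obtain u where u: "u \<in> V" "u \<notin> W" "\<And>g. g \<in> T \<Longrightarrow> \<exists>c. g u - const c * u \<in> W"
  proof (rule ratfun_space.common_eigenvector_modulo_subspace[of V "z ` {..<n}" W T, OF subV _ _ subW WV])
    show "ratfun_space.linear_endo V g" if "g \<in> T" for g using that by (rule linV)
    show "g w \<in> W" if "g \<in> T" "w \<in> W" for g w using that by (rule gW)
    show "finite (z ` {..<n})" "V \<subseteq> ratfun_space.span (z ` {..<n})" by (simp_all add: V_def)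
    show "g (h v) = h (g v)" if "g \<in> T" "h \<in> T" "v \<in> V" for g h v
      using comm[OF that(1,2)] that(3) VF by blast
  qed (rule that)
  obtain a where a: "u = (\<Sum>i<n. const (a i) * y i)"
    using span_image_eq_sums[of "{..<n}" u y] u(1) y(2) by auto
  obtain l where l: "l < n" "l \<notin> I r" "a l \<noteq> 0"
  proof -
    have "\<exists>l<n. l \<notin> I r \<and> a l \<noteq> 0"
    proof (rule ccontr)
      assume "\<not> (\<exists>l<n. l \<notin> I r \<and> a l \<noteq> 0)"
      then have "u = (\<Sum>i\<in>I r. const (a i) * y i)"
        unfolding a using Ir(1) by (intro sum.mono_neutral_right) auto
      also have "\<dots> \<in> W"
        unfolding W_def by (intro ratfun_space.span_sum ratfun_space.span_scale ratfun_space.span_base) simp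
      finally show False using u(2) by simp
    qed
    then show thesis using that by blast
  qed
  define b where "b = (\<Sum>i\<in>{..<n} - {l}. const (a i) * y i)"
  have ub: "u = const (a l) * y l + b"
    unfolding a b_def using l(1) by (subst sum.remove[of _ l]) auto
  define y' where "y' = y(l := u)"
  have b_mem: "b \<in> ratfun_space.span (y ` ({..<n} - {l}))"
    unfolding b_def by (intro ratfun_space.span_sum ratfun_space.span_scale ratfun_space.span_base) simp
  have free': "free_generators n y'"
    unfolding y'_def ub
    by (rule free_generators_update[OF y(1) l(1)]) (use b_mem span_in_const_adjoin l(3) in auto)
  have y'_eq: "y' i = y i" if "i \<noteq> l" for i using that by (simp add: y'_def)
  have span': "ratfun_space.span (y' ` {..<n}) = V"
  proof
    have "y' ` {..<n} \<subseteq> V"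
      using u(1) y(2) ratfun_space.span_base[of _ "y ` {..<n}"] by (auto simp: y'_def)
    then show "ratfun_space.span (y' ` {..<n}) \<subseteq> V" by (rule ratfun_space.span_minimal[OF _ subV])
    have "y ` ({..<n} - {l}) \<subseteq> y' ` {..<n}" using y'_eq by force
    then have b': "b \<in> ratfun_space.span (y' ` {..<n})" using b_mem ratfun_space.span_mono by blast
    have u': "u \<in> ratfun_space.span (y' ` {..<n})"
      using l(1) by (intro ratfun_space.span_base) (auto simp: y'_def)
    have "const (inverse (a l)) * (u - b) = y l"
      using l(3) unfolding ub by (simp add: const_inverse)
    then have yl: "y l \<in> ratfun_space.span (y' ` {..<n})"
      using ratfun_space.span_scale[OF ratfun_space.span_diff[OF u' b'], of "inverse (a l)"] by simp
    have "y i \<in> ratfun_space.span (y' ` {..<n})" if "i < n" for i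
    proof (cases "i = l")
      case False
      have "y' i \<in> ratfun_space.span (y' ` {..<n})" using that by (intro ratfun_space.span_base) simp
      then show ?thesis by (simp add: y'_eq[OF False])
    qed (simp add: yl)
    then show "V \<subseteq> ratfun_space.span (y' ` {..<n})"
      unfolding y(2)[symmetric] by (intro ratfun_space.span_minimal) auto
  qed
  define I' where "I' = I(Suc r := insert l (I r))"
  have Il: "l \<notin> I q" if "q \<le> r" for q
  proof -
    have "I q \<subseteq> I r" using that
    proof (induction rule: inc_induct)
      case (step m)
      then show ?case using I_step[of m] by blast
    qed simp
    then show ?thesis using l(2) by blast
  qed
  have img: "y' ` I q = y ` I q" if "q \<le> r" for q
    using Il[OF that] by (intro image_cong[OF refl] y'_eq) blast
  have "\<exists>l<n. l \<notin> I' q \<and> I' (Suc q) = insert l (I' q)" if "q < Suc r" for q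
    using that I_step[of q] l by (cases "q = r") (auto simp: I'_def)
  moreover have "I' q \<subseteq> {..<n} \<and> card (I' q) = q \<and>
      (\<forall>i\<in>I' q. \<forall>g\<in>T. g (y' i) \<in> ratfun_space.span (y' ` I' q))" if q: "q \<le> Suc r" for q
  proof (cases "q = Suc r")
    case False
    then have q': "q \<le> r" using q by simp
    have "I' q = I q" using False by (simp add: I'_def)
    moreover have "y' i = y i" if "i \<in> I q" for i
      using Il[OF q'] that by (intro y'_eq) blast
    ultimately show ?thesis using I_stable[OF q'] img[OF q'] by fastforce
  next
    case True
    have I'q: "I' q = insert l (I r)" by (simp add: I'_def True)
    have WI: "W \<subseteq> ratfun_space.span (y' ` I' q)"
      unfolding W_def I'q img[OF order_refl, symmetric] by (intro ratfun_space.span_mono) blast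
    have "g (y' i) \<in> ratfun_space.span (y' ` I' q)" if i: "i \<in> I' q" and g: "g \<in> T" for i g
    proof (cases "i = l")
      case True
      obtain c where c: "g u - const c * u \<in> W" using u(3)[OF g] by blast
      have "u \<in> ratfun_space.span (y' ` I' q)"
        unfolding I'q by (intro ratfun_space.span_base) (simp add: y'_def)
      then have "(g u - const c * u) + const c * u \<in> ratfun_space.span (y' ` I' q)"
        using c WI by (intro ratfun_space.span_add ratfun_space.span_scale) auto
      then show ?thesis by (simp add: True y'_def)
    next
      case False
      then have "i \<in> I r" using i I'q by simp
      then have "g (y i) \<in> W" unfolding W_def using I_stable[of r] g by auto
      then show ?thesis using WI y'_eq[OF False] by auto
    qed
    moreover have "I' q \<subseteq> {..<n}" unfolding I'q using Ir(1) l(1) by blast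
    moreover have "card (I' q) = q" unfolding I'q using Ir(2) l(2) fin True by simp
    ultimately show ?thesis by blast
  qed
  moreover have "I' 0 = {}" using I0 by (simp add: I'_def)
  ultimately have "stable_flag n T y' I' (Suc r)" unfolding stable_flag_def by blast
  then show ?case using free' span' unfolding V_def by blast
qed

text \<open>
  The fields generated by the members of a stable flag of linear forms are stable, and each is
  obtained from its predecessor by adjoining one algebraically independent element.
\<close>

theorem commuting_linear_imp_triangulable:
  fixes z :: "nat \<Rightarrow> 'k::alg_closed_field ratfun"
  assumes T: "T \<subseteq> carrier (cremona n)"
    and comm: "\<And>g h f. g \<in> T \<Longrightarrow> h \<in> T \<Longrightarrow> f \<in> ratfuns n \<Longrightarrow> g (h f) = h (g f)"
    and free: "free_generators n z"
    and lin: "\<And>g i. g \<in> T \<Longrightarrow> i < n \<Longrightarrow> g (z i) \<in> ratfun_space.span (z ` {..<n})"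
  shows "rationally_triangulable n T"
proof -
  have "\<exists>y I. free_generators n y \<and> ratfun_space.span (y ` {..<n}) = ratfun_space.span (z ` {..<n}) \<and>
    stable_flag n T y I n"
  proof (rule commuting_linear_flag[OF T _ free _ order_refl])
    show "g (h f) = h (g f)" if "g \<in> T" "h \<in> T" "f \<in> ratfuns n" for g h f using that by (rule comm)
    show "g (z i) \<in> ratfun_space.span (z ` {..<n})" if "g \<in> T" "i < n" for g i using that by (rule lin)
  qed
  then obtain y I where y: "free_generators n y" and flag: "stable_flag n T y I n" by blast
  from flag have I0: "I 0 = {}"
    and I_step: "\<And>q. q < n \<Longrightarrow> \<exists>l<n. l \<notin> I q \<and> I (Suc q) = insert l (I q)"
    and I_stable: "\<And>q. q \<le> n \<Longrightarrow> I q \<subseteq> {..<n} \<and> card (I q) = q \<and>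
       (\<forall>i\<in>I q. \<forall>g\<in>T. g (y i) \<in> ratfun_space.span (y ` I q))"
    unfolding stable_flag_def by blast+
  define K where "K q = const_adjoin (y ` I q)" for q
  have In: "I n = {..<n}"
    using I_stable[of n] by (intro card_subset_eq) auto
  show ?thesis
    unfolding rationally_triangulable_def
  proof (intro exI[of _ K] conjI allI impI ballI)
    show "K n = ratfuns n" using y by (simp add: K_def In free_generators_def)
    show "K 0 = range const" by (simp add: K_def I0 const_adjoin_empty)
    show "is_subfield (K q)" for q by (simp add: K_def subfield_adjoin)
    show "g ` K q \<subseteq> K q" if q: "q \<le> n" and g: "g \<in> T" for q g
    proof
      fix f assume "f \<in> g ` K q"
      then obtain f0 where f0: "f0 \<in> const_adjoin (y ` I q)" "f = g f0" by (auto simp: K_def)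
      show "f \<in> K q"
        unfolding f0(2) K_def
      proof (rule cremona_image_generators[OF _ _ f0(1) subfield_adjoin])
        show "g \<in> carrier (cremona n)" using g T by blast
        show "y ` I q \<subseteq> ratfuns n" using I_stable[OF q] free_generators_in_ratfuns[OF y] by auto
        show "g a \<in> const_adjoin (y ` I q)" if "a \<in> y ` I q" for a
          using I_stable[OF q] g that span_in_const_adjoin by blast
      qed auto
    qed
    show "one_extension (K (Suc q)) (K q)" if q: "q < n" for q
    proof -
      obtain l where l: "l < n" "l \<notin> I q" "I (Suc q) = insert l (I q)" using I_step[OF q] by blast
      have "alg_indep (I (Suc q)) y"
        using y I_stable[of "Suc q"] q by (auto simp: free_generators_def intro!: alg_indep_subset[of "{..<n}"])
      moreover have "finite (I q)" using I_stable[of q] q finite_subset by auto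
      ultimately have "transcendental_over (const_adjoin (y ` I q)) (y l)"
        using alg_indep_insert[of "I q" l y] l by simp
      then show ?thesis
        unfolding one_extension_adjoin K_def l(3)
        by (auto simp: subfield_adjoin adjoin_const_adjoin intro!: exI[of _ "y l"])
    qed
  qed
qed

section \<open>Triangulable, linearizable and diagonalizable tori\<close>

text \<open>
  Applying \<open>s\<close> to a polynomial expression in the coordinates gives the same expression in their images;
  as \<open>s\<close> is bijective, the images are as free as the coordinates.
\<close>

lemma free_generators_image_var:
  fixes s :: "'k::alg_closed_field ratfun \<Rightarrow> 'k ratfun"
  assumes s: "s \<in> carrier (cremona n)"
  shows "free_generators n (\<lambda>i. s (var i))"
proof -
  have F: "s (sum f S) = (\<Sum>i\<in>S. s (f i)) \<and> sum f S \<in> ratfuns n"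
    if "\<And>i. i \<in> S \<Longrightarrow> f i \<in> ratfuns n" for f :: "(nat \<Rightarrow>\<^sub>0 nat) \<Rightarrow> 'k ratfun" and S
    using that by (induction S rule: infinite_finite_induct)
      (auto simp: cremona_0[OF s] cremona_add[OF s] intro: subfield_closed[OF subfield_ratfuns])
  have P: "s (prod f S) = (\<Prod>i\<in>S. s (f i)) \<and> prod f S \<in> ratfuns n"
    if "\<And>i. i \<in> S \<Longrightarrow> f i \<in> ratfuns n" for f :: "nat \<Rightarrow> 'k ratfun" and S
    using that by (induction S rule: infinite_finite_induct)
      (auto simp: cremona_1[OF s] cremona_times[OF s] intro: subfield_closed[OF subfield_ratfuns])
  have E: "s (f ^ e) = s f ^ e \<and> f ^ e \<in> ratfuns n" if "f \<in> ratfuns n" for f e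
    using that by (induction e) (auto simp: cremona_1[OF s] cremona_times[OF s] intro: subfield_closed[OF subfield_ratfuns])
  have ins: "insertion const (\<lambda>i. s (var i)) Q = s (insertion const var Q)" if Q: "Q \<in> polys_in {..<n}" for Q
  proof -
    have mono: "monom_value (\<lambda>i. s (var i)) m = s (monom_value var m) \<and> monom_value var m \<in> (ratfuns n :: 'k ratfun set)"
      if "m \<in> Poly_Mapping.keys Q" for m
    proof -
      have keys: "var i \<in> (ratfuns n :: 'k ratfun set)" if "i \<in> Poly_Mapping.keys m" for i
        using Q \<open>m \<in> Poly_Mapping.keys Q\<close> that by (intro var_in_ratfuns) (auto simp: polys_in_def)
      have "s (\<Prod>i\<in>Poly_Mapping.keys m. var i ^ Poly_Mapping.lookup m i) =
          (\<Prod>i\<in>Poly_Mapping.keys m. s (var i ^ Poly_Mapping.lookup m i)) \<and>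
          (\<Prod>i\<in>Poly_Mapping.keys m. var i ^ Poly_Mapping.lookup m i) \<in> (ratfuns n :: 'k ratfun set)"
        by (rule P[of "Poly_Mapping.keys m" "\<lambda>i. var i ^ Poly_Mapping.lookup m i"])
          (rule E[OF keys, THEN conjunct2])
      moreover have "(\<Prod>i\<in>Poly_Mapping.keys m. s (var i ^ Poly_Mapping.lookup m i)) =
          (\<Prod>i\<in>Poly_Mapping.keys m. s (var i) ^ Poly_Mapping.lookup m i)"
        using keys E by (intro prod.cong) auto
      ultimately show ?thesis by (simp add: monom_value_def)
    qed
    have "s (insertion const var Q) =
        (\<Sum>m\<in>Poly_Mapping.keys Q. s (const (Poly_Mapping.lookup Q m) * monom_value var m))"
      unfolding insertion_def using mono
      by (intro F[THEN conjunct1]) (auto intro: subfield_mult[OF subfield_ratfuns])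
    also have "\<dots> = insertion const (\<lambda>i. s (var i)) Q"
      unfolding insertion_def using mono
      by (intro sum.cong) (auto simp: cremona_times[OF s] cremona_const[OF s])
    finally show ?thesis by simp
  qed
  have "alg_indep {..<n} (\<lambda>i. s (var i))"
    unfolding alg_indep_def
  proof (intro ballI impI)
    fix Q :: "'k mpoly" assume Q: "Q \<in> polys_in {..<n}" "insertion const (\<lambda>i. s (var i)) Q = 0"
    have "insertion const var Q \<in> ratfuns n"
      unfolding ratfuns_eq_const_adjoin by (rule insertion_in_const_adjoin[OF Q(1)])
    then have "insertion const var Q = 0" using Q cremona_eq_0_iff[OF s] ins by simp
    then show "Q = 0" by (simp add: insertion_var)
  qed
  moreover have "const_adjoin ((\<lambda>i. s (var i)) ` {..<n}) = ratfuns n"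
  proof
    show "const_adjoin ((\<lambda>i. s (var i)) ` {..<n}) \<subseteq> ratfuns n"
      by (intro const_adjoin_least subfield_ratfuns) (auto intro: cremona_mem[OF s] var_in_ratfuns)
    show "ratfuns n \<subseteq> const_adjoin ((\<lambda>i. s (var i)) ` {..<n})"
    proof
      fix f :: "'k ratfun" assume f: "f \<in> ratfuns n"
      have "s ((inv\<^bsub>cremona n\<^esub> s) f) \<in> const_adjoin ((\<lambda>i. s (var i)) ` {..<n})"
      proof (rule cremona_image_generators[OF s _ _ subfield_adjoin])
        show "(inv\<^bsub>cremona n\<^esub> s) f \<in> const_adjoin (var ` {..<n})"
          using cremona_mem[OF cremona_inv_closed[OF s] f] by (simp add: ratfuns_eq_const_adjoin)
      qed (auto intro: var_in_ratfuns in_const_adjoin)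
      then show "f \<in> const_adjoin ((\<lambda>i. s (var i)) ` {..<n})" by (simp add: cremona_inv_right[OF s f])
    qed
  qed
  ultimately show ?thesis by (simp add: free_generators_def)
qed

lemma (in group) subgroup_conjugate:
  assumes H: "subgroup H G" and s: "s \<in> carrier G"
  shows "subgroup ((\<lambda>g. s \<otimes> g \<otimes> inv s) ` H) G"
proof -
  note sub = subgroup.mem_carrier[OF H]
  have cancel: "inv s \<otimes> (s \<otimes> x) = x" if "x \<in> carrier G" for x
    using s that by (simp add: m_assoc[symmetric])
  show ?thesis
  proof (rule subgroupI)
    show "(\<lambda>g. s \<otimes> g \<otimes> inv s) ` H \<subseteq> carrier G" using sub s by auto
    show "(\<lambda>g. s \<otimes> g \<otimes> inv s) ` H \<noteq> {}" using subgroup.one_closed[OF H] by blast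
  next
    fix a assume "a \<in> (\<lambda>g. s \<otimes> g \<otimes> inv s) ` H"
    then obtain g where g: "g \<in> H" "a = s \<otimes> g \<otimes> inv s" by blast
    have "inv a = s \<otimes> inv g \<otimes> inv s"
      using g s sub by (simp add: inv_mult_group m_assoc)
    then show "inv a \<in> (\<lambda>g. s \<otimes> g \<otimes> inv s) ` H" using subgroup.m_inv_closed[OF H g(1)] by blast
  next
    fix a b assume "a \<in> (\<lambda>g. s \<otimes> g \<otimes> inv s) ` H" "b \<in> (\<lambda>g. s \<otimes> g \<otimes> inv s) ` H"
    then obtain g h where gh: "g \<in> H" "a = s \<otimes> g \<otimes> inv s" "h \<in> H" "b = s \<otimes> h \<otimes> inv s" by blast
    have "a \<otimes> b = s \<otimes> (g \<otimes> h) \<otimes> inv s"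
      using gh s sub by (simp add: m_assoc cancel)
    then show "a \<otimes> b \<in> (\<lambda>g. s \<otimes> g \<otimes> inv s) ` H" using subgroup.m_closed[OF H gh(1,3)] by blast
  qed
qed

text \<open>
  The matrix describes the inverse automorphism, so its diagonal consists of the inverses of the
  scalars.
\<close>

lemma diagonal_torus_subset_GL:
  fixes n d :: nat
  assumes "d \<le> n"
  shows "diagonal_torus n d \<subseteq> (GL_subgroup n n :: ('k::field ratfun \<Rightarrow> 'k ratfun) set)"
proof
  fix s :: "'k ratfun \<Rightarrow> 'k ratfun" assume "s \<in> diagonal_torus n d"
  then obtain t where s: "s \<in> carrier (cremona n)" and t: "\<And>i. i < d \<Longrightarrow> t i \<noteq> 0"
    "\<And>i. i < n \<Longrightarrow> s (var i) = (if i < d then const (t i) * var i else var i)"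
    by (auto simp: diagonal_torus_def)
  define u where "u i = (if i < d then t i else 1)" for i
  have u: "u i \<noteq> 0" "i < n \<Longrightarrow> s (var i) = const (u i) * var i" for i using t by (auto simp: u_def)
  define M where "M i j = (if i = j then inverse (u i) else 0)" for i j :: nat
  define N where "N i j = (if i = j then u i else 0)" for i j :: nat
  have MN: "(\<Sum>l<n. M i l * N l j) = (if i = j then 1 else 0)" "(\<Sum>l<n. N i l * M l j) = (if i = j then 1 else 0)"
    if "i < n" "j < n" for i j
  proof -
    have "(\<Sum>l<n. M i l * N l j) = (\<Sum>l<n. if l = i then M i i * N i j else 0)"
      "(\<Sum>l<n. N i l * M l j) = (\<Sum>l<n. if l = i then N i i * M i j else 0)"
      by (rule sum.cong[OF refl]; simp add: M_def N_def)+
    then have "(\<Sum>l<n. M i l * N l j) = M i i * N i j" "(\<Sum>l<n. N i l * M l j) = N i i * M i j"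
      using that by (simp_all del: mult_eq_0_iff)
    moreover have "M i i * N i j = (if i = j then 1 else 0)" "N i i * M i j = (if i = j then 1 else 0)"
      using u(1) by (simp_all add: M_def N_def)
    ultimately show "(\<Sum>l<n. M i l * N l j) = (if i = j then 1 else 0)"
      "(\<Sum>l<n. N i l * M l j) = (if i = j then 1 else 0)" by simp_all
  qed
  have "(inv\<^bsub>cremona n\<^esub> s) (var i) = (\<Sum>j<n. const (M i j) * var j)" if i: "i < n" for i
  proof -
    have "s (const (inverse (u i)) * var i) = const (inverse (u i) * u i) * var i"
      using cremona_times[OF s const_in_ratfuns var_in_ratfuns[OF i]] cremona_const[OF s] u(2)[OF i]
      by (simp add: const_mult mult.assoc)
    then have "s (const (inverse (u i)) * var i) = var i" using u(1) by simp
    then have "(inv\<^bsub>cremona n\<^esub> s) (var i) = const (inverse (u i)) * var i"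
      using cremona_inv_left[OF s, of "const (inverse (u i)) * var i"]
      by (simp add: subfield_mult[OF subfield_ratfuns const_in_ratfuns var_in_ratfuns[OF i]])
    also have "\<dots> = (\<Sum>j<n. if j = i then const (M i i) * var i else 0)" using i by (simp add: M_def)
    also have "\<dots> = (\<Sum>j<n. const (M i j) * var j)" by (rule sum.cong) (auto simp: M_def)
    finally show ?thesis .
  qed
  then show "s \<in> GL_subgroup n n"
    unfolding GL_subgroup_def using s MN by (intro CollectI conjI exI[of _ M] exI[of _ N]) auto
qed

context rational_torus
begin

text \<open>
  Let \<open>z\<close> be semi-invariant free generators with triangular weights and \<open>s\<close> the automorphism with
  \<open>s (var i) = z i\<close>. Conjugation by its inverse turns the action of the torus on the \<open>z i\<close> into an action on
  the coordinates through the same characters \<open>\<chi>\<close>. They are trivial from index \<open>d\<close> on, and the first \<open>d\<close> of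
  them take arbitrary values because the triangular system can be solved.
\<close>

theorem triangulable_imp_diagonalizable:
  assumes "rationally_triangulable n (\<psi> ` carrier (torus d))"
  shows "d \<le> n \<and> conjugate_in_cremona n (\<psi> ` carrier (torus d)) (diagonal_torus n d)"
proof -
  let ?G = "cremona n :: ('k ratfun \<Rightarrow> 'k ratfun) monoid"
  interpret G: group ?G by (rule group_cremona)
  obtain z w where dn: "d \<le> n" and zw: "semi_invariant z w" "triangular d w"
    using semi_invariant_triangular[OF semi_invariant_free_generators[OF assms], of d] by auto
  have free: "free_generators n z" using zw(1) by (simp add: semi_invariant_def)
  note zF = free_generators_in_ratfuns[OF free]
  obtain s where s: "s \<in> carrier ?G" "\<And>i. i < n \<Longrightarrow> s (var i) = z i"
    using exists_cremona[OF free] by blast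
  define s' where "s' = inv\<^bsub>?G\<^esub> s"
  have s': "s' \<in> carrier ?G" "inv\<^bsub>?G\<^esub> s' = s" using s(1) by (simp_all add: s'_def)
  have s'z: "s' (z i) = var i" if "i < n" for i
    using cremona_inv_left[OF s(1) var_in_ratfuns[OF that]] s(2)[OF that] by (simp add: s'_def)
  let ?c = "\<lambda>g. s' \<otimes>\<^bsub>?G\<^esub> g \<otimes>\<^bsub>?G\<^esub> inv\<^bsub>?G\<^esub> s'"
  let ?\<chi> = "\<lambda>t i. \<Prod>j<d. t j powi w i j"
  have conj_closed: "?c (\<psi> t) \<in> carrier ?G" if "t \<in> carrier (torus d)" for t
    using s' s(1) mem[OF that] by simp
  have conj_var: "?c (\<psi> t) (var i) = const (?\<chi> t i) * var i" if t: "t \<in> carrier (torus d)" and i: "i < n" for t i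
  proof -
    note vi = var_in_ratfuns[OF i]
    have "?c (\<psi> t) (var i) = s' (\<psi> t (s (var i)))"
      unfolding s'(2)
      by (simp add: cremona_mult[OF G.m_closed[OF s'(1) mem[OF t]] s(1) vi]
          cremona_mult[OF s'(1) mem[OF t] cremona_mem[OF s(1) vi]])
    also have "\<dots> = s' (const (?\<chi> t i) * z i)"
      using zw(1) t i by (simp add: s(2)[OF i] semi_invariant_def)
    also have "\<dots> = const (?\<chi> t i) * var i"
      by (simp add: cremona_times[OF s'(1) const_in_ratfuns zF[OF i]] cremona_const[OF s'(1)] s'z[OF i])
    finally show ?thesis .
  qed
  have \<chi>_1: "?\<chi> t i = 1" if "d \<le> i" "i < n" for t i
    using zw(2) that by (intro prod.neutral) (auto simp: triangular_def)
  have "diagonal_torus n d = ?c ` \<psi> ` carrier (torus d)"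
  proof
    show "?c ` \<psi> ` carrier (torus d) \<subseteq> diagonal_torus n d"
    proof
      fix g assume "g \<in> ?c ` \<psi> ` carrier (torus d)"
      then obtain t where t: "t \<in> carrier (torus d)" "g = ?c (\<psi> t)" by blast
      have "?\<chi> t i \<noteq> 0" for i using t(1) by (auto simp: carrier_torus)
      moreover have "g (var i) = (if i < d then const (?\<chi> t i) * var i else var i)" if "i < n" for i
        using conj_var[OF t(1) that] \<chi>_1[of i t] that t(2) by simp
      ultimately show "g \<in> diagonal_torus n d"
        using conj_closed[OF t(1)] t(2) unfolding diagonal_torus_def
        by (intro CollectI conjI exI[of _ "?\<chi> t"]) simp_all
    qed
    show "diagonal_torus n d \<subseteq> ?c ` \<psi> ` carrier (torus d)"
    proof
      fix g :: "'k ratfun \<Rightarrow> 'k ratfun" assume "g \<in> diagonal_torus n d"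
      then obtain c where g: "g \<in> carrier ?G" and c: "\<And>i. i < d \<Longrightarrow> c i \<noteq> 0"
        "\<And>i. i < n \<Longrightarrow> g (var i) = (if i < d then const (c i) * var i else var i)"
        by (auto simp: diagonal_torus_def)
      have "\<exists>t. (\<forall>l<d. t l \<noteq> 0) \<and> (\<forall>l. d \<le> l \<longrightarrow> l < d \<longrightarrow> t l = 1) \<and>
          (\<forall>i<d. (\<Prod>j<d. t j powi w i j) = c i)"
        by (rule triangular_monomial_system) (use c zw(2) dn in \<open>auto simp: triangular_def\<close>)
      then obtain t0 where t0: "\<And>l. l < d \<Longrightarrow> t0 l \<noteq> 0" "\<And>i. i < d \<Longrightarrow> ?\<chi> t0 i = c i" by blast
      define t where "t = (\<lambda>i\<in>{..<d}. t0 i)"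
      have t: "t \<in> carrier (torus d)" using t0(1) by (auto simp: t_def carrier_torus)
      have "?\<chi> t i = ?\<chi> t0 i" for i by (simp add: t_def)
      then have "g (var i) = ?c (\<psi> t) (var i)" if "i < n" for i
        using conj_var[OF t that] \<chi>_1[of i t] c(2)[OF that] t0(2) that by simp
      then have "g = ?c (\<psi> t)" by (intro cremona_eqI[OF g conj_closed[OF t]])
      then show "g \<in> ?c ` \<psi> ` carrier (torus d)" using t by blast
    qed
  qed
  then show ?thesis using dn s'(1) unfolding conjugate_in_cremona_def by blast
qed

end

text \<open>
  If \<open>s\<close> conjugates \<open>T\<close> into the linear group, the images of the coordinates under the inverse of \<open>s\<close> are
  mapped by \<open>T\<close> to linear combinations of each other. The definition of the linear group speaks of the inverse of its elements;
  since the conjugate of \<open>T\<close> is a group, every element is such an inverse.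
\<close>

lemma linearizable_generators:
  fixes T :: "('k::alg_closed_field ratfun \<Rightarrow> 'k ratfun) set"
  assumes T: "T \<subseteq> carrier (cremona n)" and lin: "linearizable n T"
  obtains z where "free_generators n z"
    "\<And>g i. g \<in> T \<Longrightarrow> i < n \<Longrightarrow> g (z i) \<in> ratfun_space.span (z ` {..<n})"
proof -
  let ?G = "cremona n :: ('k ratfun \<Rightarrow> 'k ratfun) monoid"
  interpret G: group ?G by (rule group_cremona)
  obtain H s where H: "subgroup H ?G" "H \<subseteq> GL_subgroup n n" and s: "s \<in> carrier ?G"
    and HT: "H = (\<lambda>g. s \<otimes>\<^bsub>?G\<^esub> g \<otimes>\<^bsub>?G\<^esub> inv\<^bsub>?G\<^esub> s) ` T"
    using lin unfolding linearizable_def conjugate_in_cremona_def by blast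
  define s' where "s' = inv\<^bsub>?G\<^esub> s"
  have s': "s' \<in> carrier ?G" using s by (simp add: s'_def)
  show thesis
  proof (rule that[OF free_generators_image_var[OF s']])
    fix g i assume g: "g \<in> T" and i: "i < n"
    note vi = var_in_ratfuns[OF i]
    have gG: "g \<in> carrier ?G" using g T by blast
    let ?h = "s \<otimes>\<^bsub>?G\<^esub> g \<otimes>\<^bsub>?G\<^esub> inv\<^bsub>?G\<^esub> s"
    have h: "?h \<in> H" unfolding HT using g by blast
    then have hG: "?h \<in> carrier ?G" using subgroup.mem_carrier[OF H(1)] by blast
    \<comment> \<open>The matrix attached to the inverse of \<open>?h\<close> describes \<open>?h\<close> itself.\<close>
    have "inv\<^bsub>?G\<^esub> ?h \<in> GL_subgroup n n" using subgroup.m_inv_closed[OF H(1) h] H(2) by blast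
    then obtain M where "(inv\<^bsub>?G\<^esub> (inv\<^bsub>?G\<^esub> ?h)) (var i) = (\<Sum>j<n. const (M i j) * var j)"
      using i unfolding GL_subgroup_def by auto
    then have M: "?h (var i) = (\<Sum>j<n. const (M i j) * var j)" using G.inv_inv[OF hG] by simp
    have "?h (var i) = s (g (s' (var i)))"
      unfolding s'_def[symmetric]
      by (simp add: cremona_mult[OF G.m_closed[OF s gG] s' vi] cremona_mult[OF s gG cremona_mem[OF s' vi]])
    then have "g (s' (var i)) = s' (\<Sum>j<n. const (M i j) * var j)"
      using cremona_inv_left[OF s cremona_mem[OF gG cremona_mem[OF s' vi]]] M by (simp add: s'_def)
    also have "\<dots> \<in> ratfun_space.span ((\<lambda>i. s' (var i)) ` {..<n})"
    proof (rule cremona_image_span[of s' n "var ` {..<n}", OF s'])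
      show "(\<Sum>j<n. const (M i j) * var j) \<in> ratfun_space.span (var ` {..<n})"
        by (intro ratfun_space.span_sum ratfun_space.span_scale ratfun_space.span_base) simp
    qed (auto intro: var_in_ratfuns ratfun_space.span_base)
    finally show "g (s' (var i)) \<in> ratfun_space.span ((\<lambda>i. s' (var i)) ` {..<n})" .
  qed
qed

theorem corollary3:
  fixes n d :: nat
    and T :: "('k::alg_closed_field ratfun \<Rightarrow> 'k ratfun) set"
    and A :: "(('k ratfun \<Rightarrow> 'k ratfun) \<Rightarrow> 'k) set"
  assumes "n > 0"
    and "torus_subgroup n d T A"
  shows "(rationally_triangulable n T \<longleftrightarrow> linearizable n T) \<and>
         (linearizable n T \<longleftrightarrow> d \<le> n \<and> conjugate_in_cremona n T (diagonal_torus n d))"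
proof -
  let ?G = "cremona n :: ('k ratfun \<Rightarrow> 'k ratfun) monoid"
  have sub: "subgroup T ?G" using assms(2) by (simp add: torus_subgroup_def algebraic_subgroup_def)
  then have TG: "T \<subseteq> carrier ?G" by (rule subgroup.subset)
  obtain \<psi> where \<psi>: "\<psi> \<in> hom (torus d) ?G" "inj_on \<psi> (carrier (torus d))" "\<psi> ` carrier (torus d) = T"
    "\<And>j f. j < d \<Longrightarrow> f \<in> ratfuns n \<Longrightarrow>
       \<exists>p q. q \<noteq> 0 \<and> (MOST s. \<psi> (cocharacter d j s) f * poly q (const s) = poly p (const s))"
    by (rule torus_subgroup_parametrization[OF assms(2)]) blast
  interpret rational_torus n d \<psi>
    by (rule rational_torus.intro[OF \<psi>(1,2)]) (rule \<psi>(4))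
  have "d \<le> n \<and> conjugate_in_cremona n T (diagonal_torus n d)" if "rationally_triangulable n T"
    using triangulable_imp_diagonalizable that by (simp add: \<psi>(3))
  moreover have "linearizable n T" if conj: "d \<le> n \<and> conjugate_in_cremona n T (diagonal_torus n d)"
  proof -
    obtain s where s: "s \<in> carrier ?G"
      "diagonal_torus n d = (\<lambda>g. s \<otimes>\<^bsub>?G\<^esub> g \<otimes>\<^bsub>?G\<^esub> inv\<^bsub>?G\<^esub> s) ` T"
      using conj unfolding conjugate_in_cremona_def by blast
    have "subgroup (diagonal_torus n d) ?G"
      unfolding s(2) by (rule group.subgroup_conjugate[OF group_cremona sub s(1)])
    then show ?thesis
      using conj diagonal_torus_subset_GL[of d n] unfolding linearizable_def by blast
  qed
  moreover have "rationally_triangulable n T" if lin: "linearizable n T"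
  proof -
    obtain z where z: "free_generators n z"
      "\<And>g i. g \<in> T \<Longrightarrow> i < n \<Longrightarrow> g (z i) \<in> ratfun_space.span (z ` {..<n})"
      by (rule linearizable_generators[OF TG lin]) blast
    show ?thesis
    proof (rule commuting_linear_imp_triangulable[OF TG _ z(1)])
      show "g (h f) = h (g f)" if gh: "g \<in> T" "h \<in> T" and f: "f \<in> ratfuns n" for g h f
      proof -
        obtain t u where tu: "t \<in> carrier (torus d)" "g = \<psi> t" "u \<in> carrier (torus d)" "h = \<psi> u"
          using gh unfolding \<psi>(3)[symmetric] by blast
        have "\<psi> t (\<psi> u f) = \<psi> u (\<psi> t f)"
          using apply_mult[OF tu(1,3) f] apply_mult[OF tu(3,1) f] by (simp add: mult.commute)
        then show ?thesis by (simp add: tu)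
      qed
    qed (rule z(2))
  qed
  ultimately show ?thesis by blast
qed

end
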